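(* Let $V$ be a spectrally negative Lévy process which is not the opposite of a subordinator, with Laplace exponent $\Psi_V$, let $\kappa$ be as defined in the context, let $V^{\uparrow}$ be $V$ conditioned to stay positive (starting from $0$), and let $I(V^{\uparrow}) := \int_0^{+\infty} e^{-V^{\uparrow}(t)}\,dt$. Then the random variable $I(V^{\uparrow})$ is almost surely finite and $$\forall \lambda < \Psi_V(\kappa+1), \quad \mathbb{E}\left[e^{\lambda I(V^{\uparrow})}\right] < +\infty .$$ Moreover, there are two positive constants $K_1 > K_2 > 0$ such that for all $x$ large enough $$\exp(-K_1 x) \leq \mathbb{P}\left(I(V^{\uparrow}) \geq x\right) \leq \exp(-K_2 x).$$ By the finiteness of the exponential moments above, $K_2$ can be chosen as close as desired to $\Psi_V(\kappa+1)$.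
   Context: A spectrally negative Lévy process is a real-valued càdlàg Lévy process $V$ with $V(0)=0$ and no positive jumps. Its Laplace exponent $\Psi_V$ is given by $\mathbb{E}[e^{\lambda V(t)}] = e^{t\Psi_V(\lambda)}$ for $t,\lambda \geq 0$. If $V$ drifts to $-\infty$ (i.e. $V(t)\to-\infty$ a.s. as $t\to+\infty$), $\kappa := \inf\{\lambda>0 : \Psi_V(\lambda)=0\}$ is the non-trivial zero of $\Psi_V$; otherwise $\kappa := 0$. Write $V_x := x+V$ for $V$ started from $x$. Scale function: $W$ is the continuous increasing function on $[0,+\infty[$ with $\int_0^{+\infty} e^{-\lambda x}W(x)\,dx = 1/\Psi_V(\lambda) < +\infty$ for all $\lambda>\kappa$. $V$ conditioned to stay positive: for $x>0$, $V^{\uparrow}_x$ is the Markov process started from $x$, with values in $]0,+\infty[$ and infinite lifetime, whose transition semigroup is $p^{\uparrow}_t(x,dy) := \frac{W(y)}{W(x)}\,\mathbb{P}\left(V_x(t)\in dy,\ \inf_{[0,t]}V_x>0\right)$ for $t\geq 0$, $x,y>0$. $V^{\uparrow}=V^{\uparrow}_0$ is the process started from $0$ obtained as the limit in distribution of $V^{\uparrow}_x$ as $x\to 0+$; it is a Feller process whose transition laws restricted to $]0,+\infty[$ are given by $p^{\uparrow}_t$.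
   Formalization: The lower bound exp(-K_1 x) ≤ P(I(V↑) ≥ x) is claimed only when V is not a pure drift V(t)=ct: for c>0 one has V↑=V and I(V↑)=1/c is constant, so that bound fails. All other conclusions are stated for every V. *)

theory Defs
  imports "HOL-Probability.Probability"
begin

text \<open>
  Processes are functions \<open>X :: real \<Rightarrow> 'a \<Rightarrow> real\<close> (time first) of which only the times \<open>t \<ge> 0\<close>
  are ever used.  All paths are required to be cadlag, not just almost all of them, so that events
  such as \<open>{inf\<^bsub>[0,t]\<^esub> X > 0}\<close> are measurable although the probability space need not be complete;
  the other path properties are only required almost surely.
\<close>

definition cadlag :: "(real \<Rightarrow> real) \<Rightarrow> bool" where
  "cadlag f \<longleftrightarrow> (\<forall>t\<ge>0. continuous (at_right t) f) \<and> (\<forall>t>0. \<exists>l. (f \<longlongrightarrow> l) (at_left t))"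

definition cadlag_process :: "'a measure \<Rightarrow> (real \<Rightarrow> 'a \<Rightarrow> real) \<Rightarrow> bool" where
  "cadlag_process M X \<longleftrightarrow> prob_space M \<and>
     (\<forall>t\<ge>0. X t \<in> borel_measurable M) \<and> (\<forall>\<omega>\<in>space M. cadlag (\<lambda>t. X t \<omega>))"

definition levy_process :: "'a measure \<Rightarrow> (real \<Rightarrow> 'a \<Rightarrow> real) \<Rightarrow> bool" where
  "levy_process M X \<longleftrightarrow> cadlag_process M X \<and>
     (AE \<omega> in M. X 0 \<omega> = 0) \<and>
     (\<forall>(t :: nat \<Rightarrow> real) n. 0 \<le> t 0 \<longrightarrow> mono t \<longrightarrow>
        prob_space.indep_vars M (\<lambda>_. borel) (\<lambda>i \<omega>. X (t (Suc i)) \<omega> - X (t i) \<omega>) {..<n}) \<and>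
     (\<forall>s\<ge>0. \<forall>h\<ge>0. distr M borel (\<lambda>\<omega>. X (s + h) \<omega> - X s \<omega>) = distr M borel (X h))"

definition spectrally_negative_levy :: "'a measure \<Rightarrow> (real \<Rightarrow> 'a \<Rightarrow> real) \<Rightarrow> bool" where
  "spectrally_negative_levy M V \<longleftrightarrow> levy_process M V \<and>
     (AE \<omega> in M. \<forall>t>0. V t \<omega> - Lim (at_left t) (\<lambda>s. V s \<omega>) \<le> 0)"

definition subordinator :: "'a measure \<Rightarrow> (real \<Rightarrow> 'a \<Rightarrow> real) \<Rightarrow> bool" where
  "subordinator M X \<longleftrightarrow> levy_process M X \<and> (AE \<omega> in M. mono_on {0..} (\<lambda>t. X t \<omega>))"

text \<open>
  For \<open>V(t) = c t\<close> with \<open>c > 0\<close> the process conditioned to stay positive is \<open>V\<close> itself and its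
  exponential functional is the constant \<open>1 / c\<close>, whose tail has no exponential lower bound.
\<close>

definition deterministic_drift :: "'a measure \<Rightarrow> (real \<Rightarrow> 'a \<Rightarrow> real) \<Rightarrow> bool" where
  "deterministic_drift M V \<longleftrightarrow> (\<exists>c. AE \<omega> in M. \<forall>t\<ge>0. V t \<omega> = c * t)"

text \<open>
  The Bochner integral of a non-integrable function is \<open>0\<close>, so the equation below forces
  \<open>exp (q * V t)\<close> to be integrable.
\<close>

definition laplace_exponent :: "'a measure \<Rightarrow> (real \<Rightarrow> 'a \<Rightarrow> real) \<Rightarrow> (real \<Rightarrow> real) \<Rightarrow> bool" where
  "laplace_exponent M V \<Psi> \<longleftrightarrow>
     (\<forall>t\<ge>0. \<forall>q\<ge>0. prob_space.expectation M (\<lambda>\<omega>. exp (q * V t \<omega>)) = exp (t * \<Psi> q))"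

definition drifts_to_minus_infinity :: "'a measure \<Rightarrow> (real \<Rightarrow> 'a \<Rightarrow> real) \<Rightarrow> bool" where
  "drifts_to_minus_infinity M V \<longleftrightarrow> (AE \<omega> in M. filterlim (\<lambda>t. V t \<omega>) at_bot at_top)"

definition kappa :: "'a measure \<Rightarrow> (real \<Rightarrow> 'a \<Rightarrow> real) \<Rightarrow> (real \<Rightarrow> real) \<Rightarrow> real" where
  "kappa M V \<Psi> = (if drifts_to_minus_infinity M V then Inf {q. q > 0 \<and> \<Psi> q = 0} else 0)"

definition scale_function ::
    "'a measure \<Rightarrow> (real \<Rightarrow> 'a \<Rightarrow> real) \<Rightarrow> (real \<Rightarrow> real) \<Rightarrow> (real \<Rightarrow> real) \<Rightarrow> bool" where
  "scale_function M V \<Psi> W \<longleftrightarrow> continuous_on {0..} W \<and> mono_on {0..} W \<and>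
     (\<forall>q>kappa M V \<Psi>. set_integrable lborel {0..} (\<lambda>x. exp (- q * x) * W x) \<and>
        (LINT x:{0..}|lborel. exp (- q * x) * W x) = 1 / \<Psi> q)"

text \<open>
  \<open>killed_law M V t x\<close> is the sub-probability \<open>P (V\<^sub>x(t) \<in> dy, inf\<^bsub>[0,t]\<^esub> V\<^sub>x > 0)\<close>, and
  \<open>p_up M V W t x\<close> is \<open>p\<^sup>\<up>\<^sub>t(x, dy)\<close> for \<open>x > 0\<close>, as a measure on the whole real line.  The
  indicator in the density keeps it measurable whatever the values of \<open>W\<close> at negative arguments.
\<close>

definition killed_law :: "'a measure \<Rightarrow> (real \<Rightarrow> 'a \<Rightarrow> real) \<Rightarrow> real \<Rightarrow> real \<Rightarrow> real measure" where
  "killed_law M V t x =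
     distr (density M (indicator {\<omega> \<in> space M. (INF s\<in>{0..t}. x + V s \<omega>) > 0}))
       borel (\<lambda>\<omega>. x + V t \<omega>)"

definition p_up ::
    "'a measure \<Rightarrow> (real \<Rightarrow> 'a \<Rightarrow> real) \<Rightarrow> (real \<Rightarrow> real) \<Rightarrow> real \<Rightarrow> real \<Rightarrow> real measure" where
  "p_up M V W t x =
     density (killed_law M V t x) (\<lambda>y. ennreal (W y / W x) * indicator {0<..} y)"

definition natural_filtration ::
    "'a measure \<Rightarrow> (real \<Rightarrow> 'a \<Rightarrow> real) \<Rightarrow> real \<Rightarrow> 'a measure" where
  "natural_filtration M X s =
     sigma (space M) {X r -` B \<inter> space M | r B. 0 \<le> r \<and> r \<le> s \<and> B \<in> sets borel}"

definition markov_process ::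
    "'a measure \<Rightarrow> (real \<Rightarrow> 'a \<Rightarrow> real) \<Rightarrow> (real \<Rightarrow> real \<Rightarrow> real measure) \<Rightarrow> bool" where
  "markov_process M X P \<longleftrightarrow>
     (\<forall>s\<ge>0. \<forall>t\<ge>0. \<forall>B\<in>sets borel. AE \<omega> in M.
        real_cond_exp M (natural_filtration M X s) (\<lambda>\<omega>. indicator B (X (s + t) \<omega>)) \<omega>
          = measure (P t (X s \<omega>)) B)"

definition conditioned_positive ::
    "'a measure \<Rightarrow> (real \<Rightarrow> 'a \<Rightarrow> real) \<Rightarrow> (real \<Rightarrow> real) \<Rightarrow> real \<Rightarrow>
     'b measure \<Rightarrow> (real \<Rightarrow> 'b \<Rightarrow> real) \<Rightarrow> bool" where
  "conditioned_positive M V W x N X \<longleftrightarrow> cadlag_process N X \<and>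
     (AE \<omega> in N. X 0 \<omega> = x) \<and> (AE \<omega> in N. \<forall>t\<ge>0. X t \<omega> > 0) \<and>
     markov_process N X (p_up M V W)"

text \<open>
  Convergence of a sequence for the Skorokhod (J1) topology on the space of cadlag functions on
  \<open>[0, \<infinity>[\<close> (Jacod and Shiryaev, Theorem VI.1.14).  That topology is metrizable, so sequential
  continuity is continuity.
\<close>

definition skorokhod_tendsto :: "(nat \<Rightarrow> real \<Rightarrow> real) \<Rightarrow> (real \<Rightarrow> real) \<Rightarrow> bool" where
  "skorokhod_tendsto f g \<longleftrightarrow>
     (\<exists>l :: nat \<Rightarrow> real \<Rightarrow> real.
        (\<forall>n. strict_mono_on {0..} (l n) \<and> continuous_on {0..} (l n) \<and> l n ` {0..} = {0..}) \<and>
        uniform_limit {0..} l (\<lambda>s. s) sequentially \<and>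
        (\<forall>T\<ge>0. uniform_limit {0..T} (\<lambda>n s. f n (l n s)) g sequentially))"

definition skorokhod_continuous :: "((real \<Rightarrow> real) \<Rightarrow> real) \<Rightarrow> bool" where
  "skorokhod_continuous F \<longleftrightarrow>
     (\<forall>f g. (\<forall>n. cadlag (f n)) \<longrightarrow> cadlag g \<longrightarrow> skorokhod_tendsto f g \<longrightarrow>
        (\<lambda>n. F (f n)) \<longlonglongrightarrow> F g)"

definition process_converges_in_distribution ::
    "('i \<Rightarrow> 'b measure) \<Rightarrow> ('i \<Rightarrow> real \<Rightarrow> 'b \<Rightarrow> real) \<Rightarrow>
     'c measure \<Rightarrow> (real \<Rightarrow> 'c \<Rightarrow> real) \<Rightarrow> 'i filter \<Rightarrow> bool" where
  "process_converges_in_distribution N X N' Y \<F> \<longleftrightarrow>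
     (\<forall>F. skorokhod_continuous F \<longrightarrow> (\<exists>b. \<forall>f. \<bar>F f\<bar> \<le> b) \<longrightarrow>
        ((\<lambda>i. \<integral>\<omega>. F (\<lambda>t. X i t \<omega>) \<partial>N i) \<longlongrightarrow> (\<integral>\<omega>. F (\<lambda>t. Y t \<omega>) \<partial>N')) \<F>)"

text \<open>
  Feller semigroups on \<open>[0, \<infinity>[\<close>: conservative transition kernels acting strongly continuously on
  \<open>C\<^sub>0([0, \<infinity>[)\<close>, pointwise convergence as \<open>t \<rightarrow> 0\<close> being sufficient.  The measures live on the
  real line and are carried by \<open>[0, \<infinity>[\<close>.
\<close>

definition C0_nonneg :: "(real \<Rightarrow> real) \<Rightarrow> bool" where
  "C0_nonneg f \<longleftrightarrow> continuous_on {0..} f \<and> (f \<longlongrightarrow> 0) at_top"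

definition feller_semigroup :: "(real \<Rightarrow> real \<Rightarrow> real measure) \<Rightarrow> bool" where
  "feller_semigroup P \<longleftrightarrow>
     (\<forall>t\<ge>0. \<forall>x\<ge>0. sets (P t x) = sets borel \<and> prob_space (P t x) \<and> (AE y in P t x. y \<ge> 0)) \<and>
     (\<forall>x\<ge>0. P 0 x = return borel x) \<and>
     (\<forall>s\<ge>0. \<forall>t\<ge>0. \<forall>x\<ge>0. \<forall>B\<in>sets borel.
        emeasure (P (s + t) x) B = (\<integral>\<^sup>+y\<in>{0..}. emeasure (P t y) B \<partial>P s x)) \<and>
     (\<forall>f. C0_nonneg f \<longrightarrow>
        (\<forall>t\<ge>0. C0_nonneg (\<lambda>x. LINT y:{0..}|P t x. f y)) \<and>
        (\<forall>x\<ge>0. ((\<lambda>t. LINT y:{0..}|P t x. f y) \<longlongrightarrow> f x) (at_right 0)))"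

definition conditioned_positive_from_0 ::
    "'a measure \<Rightarrow> (real \<Rightarrow> 'a \<Rightarrow> real) \<Rightarrow> (real \<Rightarrow> real) \<Rightarrow>
     (real \<Rightarrow> 'b measure) \<Rightarrow> (real \<Rightarrow> real \<Rightarrow> 'b \<Rightarrow> real) \<Rightarrow>
     'c measure \<Rightarrow> (real \<Rightarrow> 'c \<Rightarrow> real) \<Rightarrow> bool" where
  "conditioned_positive_from_0 M V W N X N0 X0 \<longleftrightarrow>
     (\<forall>x>0. conditioned_positive M V W x (N x) (X x)) \<and>
     cadlag_process N0 X0 \<and>
     (AE \<omega> in N0. X0 0 \<omega> = 0) \<and> (AE \<omega> in N0. \<forall>t\<ge>0. X0 t \<omega> \<ge> 0) \<and>
     process_converges_in_distribution N X N0 X0 (at_right 0) \<and>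
     (\<exists>P. feller_semigroup P \<and> (\<forall>t\<ge>0. \<forall>x>0. P t x = p_up M V W t x) \<and> markov_process N0 X0 P)"

definition exp_functional :: "(real \<Rightarrow> 'a \<Rightarrow> real) \<Rightarrow> 'a \<Rightarrow> ennreal" where
  "exp_functional X \<omega> = (\<integral>\<^sup>+t\<in>{0..}. ennreal (exp (- X t \<omega>)) \<partial>lborel)"

end

(*
  Let P be the transition semigroup of the conditioned process X, C = 1 / Psi(kappa + 1), and extend W
  by 0 to the negative half-line.  Comparing Laplace transforms shows that W solves L W = delta_0 for
  the generator L of V.  Hence, with g(y) = exp(-y) W(y), the function H = W * g satisfies L H = g on
  the whole line, it vanishes on the negative half-line, and killing V below 0 gives
     E_x int_0^t g(V_s) 1{inf_[0,s] V > 0} ds  <=  E_x [H(V_t); inf_[0,t] V > 0].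
  The function exp(-kappa y) W(y) is nondecreasing: stop V when it first reaches a higher level, which
  it does without overshoot, and apply Doob's inequality to exp(kappa V).  Therefore H <= C W, and since
  P has mass one, W is invariant for the killed semigroup.  Dividing by W(x) yields
  E_x I(X) <= C for every x > 0, and for x = 0 by the Feller property.  Khasminskii's lemma turns this
  uniform bound into E I(X)^n <= n! C^n, which gives the exponential moments and the upper tail.

  For the lower tail, unless V is a pure drift it can move up and down by bounded amounts, so from
  each point of a suitable compact interval K the process X spends in K a mean time bounded below.
  The same induction gives E I(X)^n >= rho n! c^n, and the Paley-Zygmund inequality for I(X)^n
  with n proportional to x concludes.
*)
theory Submission
  imports Defs "HOL-Complex_Analysis.Conformal_Mappings"
begin

section \<open>Uniqueness of two-sided Laplace transforms\<close>

text \<open>No stochastic calculus and no strong Markov property enter, only independent stationary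
  increments at deterministic times and right continuity of paths. Stopping is therefore carried out
  on grids, by decomposing over the first grid time above a level, and continuous time is recovered
  by refining the grid. Absence of positive jumps makes the overshoot negligible in this limit, and
  a small shift of the starting point separates surviving paths from paths that merely touch 0. W is
  not known to be positive beforehand: it cannot vanish because \<open>p_up\<close> has mass one,
  and its sign is read off from its Laplace transform. The constant 1 / \<Psi>(\<kappa> + 1) is the
  Laplace transform of W at \<kappa> + 1: the growth of W supplies \<kappa>, the integrand exp (- y)
  supplies 1. Moment bounds carry an arbitrary weight from the past, which is what makes the
  induction on the order of the moment possible. Pure drift is the only exception for the lower tail
  because nondecreasing paths without positive jumps are continuous; this forces \<Psi> 2 = 2 \<Psi>
  1, hence zero variance of exp (V t).\<close>

lemma (in real_distribution) exp_transform_holomorphic: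
  assumes r: "r > 0" and int: "\<And>q. \<bar>q\<bar> < r \<Longrightarrow> integrable M (\<lambda>x. exp (q * x))"
  shows "(\<lambda>z. CLINT x|M. exp (z * of_real x)) holomorphic_on {z. \<bar>Re z\<bar> < r}"
proof -
  define F where "F z = (CLINT x|M. exp (z * of_real x))" for z :: complex
  \<comment> \<open>Around z the transform is a power series whose radius is the distance from z to
    the edge of the strip. Real exponential moments suffice because the modulus of exp (z x) depends
    only on Re z.\<close>
  have loc: "F holomorphic_on ball z (r - \<bar>Re z\<bar>)" if z: "\<bar>Re z\<bar> < r" for z
  proof -
    define a where "a n = (CLINT x|M. (of_real x ^ n / fact n) * exp (z * of_real x))" for n
    have "(\<lambda>n. a n * (w - z) ^ n) sums F w" if w: "w \<in> ball z (r - \<bar>Re z\<bar>)" for w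
    proof -
      define d where "d = cmod (w - z)"
      have d0: "d \<ge> 0" by (simp add: d_def)
      have d: "d < r - \<bar>Re z\<bar>" using w by (simp add: d_def dist_norm norm_minus_commute)
      define f where "f n x = (of_real x ^ n / fact n) * exp (z * of_real x) * (w - z) ^ n" for n and x :: real
      have nf: "norm (f n x) = (\<bar>x\<bar> * d) ^ n /\<^sub>R fact n * exp (Re z * x)" for n x
        using norm_fact[of n, where ?'a=complex]
        by (simp add: f_def norm_mult norm_divide norm_power d_def power_mult_distrib divide_inverse norm_inverse mult_ac)
      have nsum: "(\<lambda>n. norm (f n x)) sums (exp (\<bar>x\<bar> * d) * exp (Re z * x))" for x
        unfolding nf by (intro sums_mult2 exp_converges)
      have fsum: "(\<lambda>n. f n x) sums exp (w * of_real x)" for x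
      proof -
        have "(\<lambda>n. (((w - z) * of_real x) ^ n /\<^sub>R fact n) * exp (z * of_real x)) sums (exp ((w-z) * of_real x) * exp (z * of_real x))"
          by (intro sums_mult2 exp_converges)
        moreover have "exp ((w-z) * of_real x) * exp (z * of_real x) = exp (w * of_real x)"
          by (simp add: exp_add[symmetric] algebra_simps)
        moreover have "(((w - z) * of_real x) ^ n /\<^sub>R fact n) * exp (z * of_real x) = f n x" for n
          by (simp add: f_def power_mult_distrib scaleR_conv_of_real divide_inverse mult_ac)
        ultimately show ?thesis by simp
      qed
      have fm: "f n \<in> borel_measurable M" for n unfolding f_def by measurable
      \<comment> \<open>The factor \<open>exp (\<bar>x\<bar> * d)\<close> is paid for by two
        exponential moments: Re z + d and Re z - d both lie in the strip, and one of them dominates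
        for each sign of x.\<close>
      have dom: "integrable M (\<lambda>x. exp (\<bar>x\<bar> * d) * exp (Re z * x))"
      proof (rule Bochner_Integration.integrable_bound)
        show "integrable M (\<lambda>x. exp ((Re z + d) * x) + exp ((Re z - d) * x))"
          using d d0 by (intro Bochner_Integration.integrable_add int) auto
        have "exp (\<bar>x\<bar> * d) * exp (Re z * x) \<le> exp ((Re z + d) * x) + exp ((Re z - d) * x)" for x
          by (auto simp: exp_add[symmetric] abs_if algebra_simps)
        then show "AE x in M. norm (exp (\<bar>x\<bar> * d) * exp (Re z * x)) \<le> norm (exp ((Re z + d) * x) + exp ((Re z - d) * x))"
          by (simp add: add_nonneg_nonneg abs_of_nonneg)
      qed measurable
      have fint: "integrable M (f n)" for n
      proof (rule Bochner_Integration.integrable_bound[OF dom fm])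
        show "AE x in M. norm (f n x) \<le> norm (exp (\<bar>x\<bar> * d) * exp (Re z * x))"
        proof (intro AE_I2)
          fix x
          have "norm (f n x) \<le> suminf (\<lambda>n. norm (f n x))"
            using sum_le_suminf[of "\<lambda>n. norm (f n x)" "{n}"] nsum[of x] by (auto simp: sums_iff)
          then show "norm (f n x) \<le> norm (exp (\<bar>x\<bar> * d) * exp (Re z * x))"
            using nsum[of x] by (simp add: sums_iff)
        qed
      qed
      have sni: "summable (\<lambda>n. \<integral>x. norm (f n x) \<partial>M)"
      proof (rule summableI_nonneg_bounded)
        fix n
        have "(\<Sum>i<n. \<integral>x. norm (f i x) \<partial>M) = (\<integral>x. (\<Sum>i<n. norm (f i x)) \<partial>M)"
          using fint by (subst Bochner_Integration.integral_sum) auto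
        also have "\<dots> \<le> (\<integral>x. exp (\<bar>x\<bar> * d) * exp (Re z * x) \<partial>M)"
        proof (rule integral_mono)
          show "(\<Sum>i<n. norm (f i x)) \<le> exp (\<bar>x\<bar> * d) * exp (Re z * x)" for x
            using sum_le_suminf[of "\<lambda>n. norm (f n x)" "{..<n}"] nsum[of x] by (auto simp: sums_iff)
        qed (use fint dom in auto)
        finally show "(\<Sum>i<n. \<integral>x. norm (f i x) \<partial>M) \<le> (\<integral>x. exp (\<bar>x\<bar> * d) * exp (Re z * x) \<partial>M)" .
      qed simp
      have "(\<lambda>n. \<integral>x. f n x \<partial>M) sums (\<integral>x. (\<Sum>n. f n x) \<partial>M)"
        by (rule sums_integral[OF fint _ sni]) (use nsum in \<open>auto simp: sums_iff\<close>)
      moreover have "(\<Sum>n. f n x) = exp (w * of_real x)" for x using fsum[of x] by (simp add: sums_iff)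
      moreover have "(\<integral>x. f n x \<partial>M) = a n * (w - z) ^ n" for n
        by (simp add: f_def a_def)
      ultimately show ?thesis by (simp add: F_def)
    qed
    then show ?thesis by (rule power_series_holomorphic)
  qed
  have "open {z::complex. \<bar>Re z\<bar> < r}"
    by (intro open_Collect_less continuous_intros)
  moreover have "F field_differentiable at z" if "\<bar>Re z\<bar> < r" for z
    using holomorphic_on_imp_differentiable_at[OF loc[OF that]] that by simp
  ultimately show ?thesis
    unfolding F_def[symmetric] by (subst holomorphic_on_open) (auto simp: field_differentiable_def)
qed

text \<open>Two holomorphic functions on a strip that agree on a real segment agree on the imaginary
  axis, where they are the characteristic functions; Levy's uniqueness theorem concludes.\<close>

lemma real_distribution_eq_if_exp_moments_eq:
  fixes M1 M2 :: "real measure"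
  assumes "real_distribution M1" "real_distribution M2" and r: "r > 0"
    and int: "\<And>q. \<bar>q\<bar> < r \<Longrightarrow> integrable M1 (\<lambda>x. exp (q * x))" "\<And>q. \<bar>q\<bar> < r \<Longrightarrow> integrable M2 (\<lambda>x. exp (q * x))"
    and eq: "\<And>q. \<bar>q\<bar> < r \<Longrightarrow> (\<integral>x. exp (q * x) \<partial>M1) = (\<integral>x. exp (q * x) \<partial>M2)"
  shows "M1 = M2"
proof -
  interpret M1: real_distribution M1 by fact
  interpret M2: real_distribution M2 by fact
  define F1 where "F1 z = (CLINT x|M1. exp (z * of_real x))" for z :: complex
  define F2 where "F2 z = (CLINT x|M2. exp (z * of_real x))" for z :: complex
  let ?S = "{z::complex. \<bar>Re z\<bar> < r}"
  have h1: "F1 holomorphic_on ?S" unfolding F1_def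
    by (rule M1.exp_transform_holomorphic[OF r int(1)])
  have h2: "F2 holomorphic_on ?S" unfolding F2_def
    by (rule M2.exp_transform_holomorphic[OF r int(2)])
  have op: "open ?S"
    by (intro open_Collect_less continuous_intros)
  have "?S = {z. Re z < r} \<inter> {z. Re z > - r}" by auto
  then have conn: "connected ?S"
    by (metis convex_Int convex_connected convex_halfspace_Re_gt convex_halfspace_Re_lt)
  have eqr: "F1 (of_real q) = F2 (of_real q)" if "\<bar>q\<bar> < r" for q
  proof -
    have "F1 (of_real q) = of_real (\<integral>x. exp (q * x) \<partial>M1)"
      unfolding F1_def by (subst integral_complex_of_real[symmetric]) (simp flip: exp_of_real)
    also have "\<dots> = of_real (\<integral>x. exp (q * x) \<partial>M2)" using eq[OF that] by simp
    also have "\<dots> = F2 (of_real q)"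
      unfolding F2_def by (subst integral_complex_of_real[symmetric]) (simp flip: exp_of_real)
    finally show ?thesis .
  qed
  have "F1 z - F2 z = 0" if "z \<in> ?S" for z
  proof (rule analytic_continuation[of "\<lambda>z. F1 z - F2 z" ?S "of_real ` {-r<..<r}" 0])
    show "(\<lambda>z. F1 z - F2 z) holomorphic_on ?S" using h1 h2 by (intro holomorphic_intros)
    show "(0::complex) islimpt complex_of_real ` {- r<..<r}"
      unfolding islimpt_approachable
    proof (intro allI impI)
      fix e :: real assume "e > 0"
      then show "\<exists>x'\<in>complex_of_real ` {- r<..<r}. x' \<noteq> 0 \<and> dist x' 0 < e"
        using r by (intro bexI[of _ "of_real (min (e/2) (r/2))"]) (auto simp: min_def)
    qed
  qed (use r op conn eqr that in auto)
  then have "F1 (\<i> * of_real t) = F2 (\<i> * of_real t)" for t using r by simp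
  then have "char M1 = char M2"
    by (intro ext) (simp add: char_def F1_def F2_def mult_ac)
  then show ?thesis by (rule Levy_uniqueness[OF assms(1,2)])
qed

text \<open>The measures may have infinite mass and the interval need not contain 0. Tilting both by
  exp (c x) at the midpoint c and dividing by the common integral m gives distributions with
  exponential moments around 0, and the tilting can be undone.\<close>

lemma measure_eq_if_exp_integrals_eq:
  fixes \<mu> \<nu> :: "real measure"
  assumes sets: "sets \<mu> = sets borel" "sets \<nu> = sets borel" and ab: "a < b"
    and eq: "\<And>q. a < q \<Longrightarrow> q < b \<Longrightarrow> (\<integral>\<^sup>+x. ennreal (exp (q * x)) \<partial>\<mu>) = (\<integral>\<^sup>+x. ennreal (exp (q * x)) \<partial>\<nu>)"
    and fin: "\<And>q. a < q \<Longrightarrow> q < b \<Longrightarrow> (\<integral>\<^sup>+x. ennreal (exp (q * x)) \<partial>\<mu>) < \<infinity>"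
  shows "\<mu> = \<nu>"
proof -
  define c where "c = (a + b) / 2"
  define m where "m = enn2real (\<integral>\<^sup>+x. ennreal (exp (c * x)) \<partial>\<mu>)"
  have c: "a < c" "c < b" using ab by (auto simp: c_def)
  have [measurable_cong]: "sets \<mu> = sets borel" "sets \<nu> = sets borel" by fact+
  have mm: "ennreal m = (\<integral>\<^sup>+x. ennreal (exp (c * x)) \<partial>\<mu>)"
    using fin[OF c] by (simp add: m_def)
  show ?thesis
  proof (cases "m = 0")
    \<comment> \<open>m = 0 admits no normalisation, but a measure that gives integral 0 to a
      positive function is the null measure.\<close>
    case True
    have null: "emeasure \<rho> A = 0"
      if s: "sets \<rho> = sets borel" and z: "(\<integral>\<^sup>+x. ennreal (exp (c * x)) \<partial>\<rho>) = 0" and A: "A \<in> sets borel" for \<rho> A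
    proof -
      have [measurable_cong]: "sets \<rho> = sets borel" by fact
      have "AE x in \<rho>. ennreal (exp (c * x)) = 0" using z by (simp add: nn_integral_0_iff_AE)
      then have "AE x in \<rho>. x \<notin> A" by eventually_elim (simp add: ennreal_eq_0_iff not_le)
      then show ?thesis using A s by (subst AE_iff_measurable[of A \<rho> "\<lambda>x. x \<notin> A", symmetric])
        (auto simp: sets_eq_imp_space_eq[OF s])
    qed
    have "emeasure \<mu> A = emeasure \<nu> A" if "A \<in> sets borel" for A
      using null[OF sets(1) _ that] null[OF sets(2) _ that] mm True eq[OF c] by simp
    then show ?thesis using sets by (intro measure_eqI) auto
  next
    case False
    then have m0: "m > 0" by (simp add: m_def less_le)
    define T where "T \<mu> = density \<mu> (\<lambda>x. ennreal (exp (c * x) / m))" for \<mu> :: "real measure"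
    define r where "r = (b - a) / 2"
    have r0: "r > 0" using ab by (simp add: r_def)
    \<comment> \<open>With r half the length of the interval, \<bar>q\<bar> < r says exactly that q
      + c lies between a and b. The statement is proved once and used for both measures.\<close>
    have T: "real_distribution (T \<mu>') \<and> (\<forall>q. \<bar>q\<bar> < r \<longrightarrow> integrable (T \<mu>') (\<lambda>x. exp (q * x)) \<and>
        (\<integral>x. exp (q * x) \<partial>T \<mu>') = enn2real ((\<integral>\<^sup>+x. ennreal (exp ((q + c) * x)) \<partial>\<mu>')) / m) \<and>
        density (T \<mu>') (\<lambda>x. ennreal (m * exp (- c * x))) = \<mu>'"
      if s [measurable_cong]: "sets \<mu>' = sets borel"
        and eq': "\<And>q. a < q \<Longrightarrow> q < b \<Longrightarrow> (\<integral>\<^sup>+x. ennreal (exp (q * x)) \<partial>\<mu>') = (\<integral>\<^sup>+x. ennreal (exp (q * x)) \<partial>\<mu>)"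
      for \<mu>'
    proof (intro conjI allI impI)
      have e1: "(\<integral>\<^sup>+x. ennreal (exp (q * x)) \<partial>T \<mu>') = (\<integral>\<^sup>+x. ennreal (exp ((q + c) * x)) \<partial>\<mu>') / ennreal m" for q
      proof -
        have "(\<integral>\<^sup>+x. ennreal (exp (q * x)) \<partial>T \<mu>') = (\<integral>\<^sup>+x. ennreal (exp (c * x) / m) * ennreal (exp (q * x)) \<partial>\<mu>')"
          unfolding T_def by (subst nn_integral_density) auto
        also have "\<dots> = (\<integral>\<^sup>+x. ennreal (exp ((q + c) * x)) / ennreal m \<partial>\<mu>')"
          using m0 by (intro nn_integral_cong)
            (simp add: divide_ennreal ennreal_mult[symmetric] exp_add[symmetric] algebra_simps)
        finally show ?thesis by (simp add: nn_integral_divide)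
      qed
      have "emeasure (T \<mu>') (space (T \<mu>')) = (\<integral>\<^sup>+x. ennreal (exp (0 * x)) \<partial>T \<mu>')" by simp
      also have "\<dots> = 1" unfolding e1 by (simp only: add_0_left eq'[OF c] mm[symmetric]) (use m0 in \<open>simp add: divide_ennreal\<close>)
      finally have "prob_space (T \<mu>')" by (rule prob_spaceI)
      then show "real_distribution (T \<mu>')"
        using s by (auto simp: real_distribution_def real_distribution_axioms_def T_def)
      fix q :: real assume q: "\<bar>q\<bar> < r"
      then have qc: "a < q + c" "q + c < b" by (auto simp: r_def c_def field_simps)
      show "integrable (T \<mu>') (\<lambda>x. exp (q * x))"
      proof (rule integrableI_nonneg)
        show "(\<integral>\<^sup>+x. ennreal (exp (q * x)) \<partial>T \<mu>') < \<infinity>"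
          unfolding e1 eq'[OF qc] using fin[OF qc] m0 by (simp add: ennreal_divide_eq_top_iff less_top[symmetric])
      qed (simp_all add: T_def)
      show "(\<integral>x. exp (q * x) \<partial>T \<mu>') = enn2real ((\<integral>\<^sup>+x. ennreal (exp ((q + c) * x)) \<partial>\<mu>')) / m"
      proof -
        have "(\<integral>x. exp (q * x) \<partial>T \<mu>') = enn2real (\<integral>\<^sup>+x. ennreal (exp (q * x)) \<partial>T \<mu>')"
          by (rule integral_eq_nn_integral) (auto simp: T_def)
        then show ?thesis
          unfolding e1 using m0 by (simp add: divide_ennreal_def inverse_ennreal enn2real_mult divide_inverse)
      qed
    next
      show "density (T \<mu>') (\<lambda>x. ennreal (m * exp (- c * x))) = \<mu>'"
      proof -
        have "density (T \<mu>') (\<lambda>x. ennreal (m * exp (- c * x))) = density \<mu>' (\<lambda>x. ennreal (exp (c * x) / m) * ennreal (m * exp (- c * x)))"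
          unfolding T_def by (subst density_density_eq) auto
        also have "\<dots> = density \<mu>' (\<lambda>x. 1)"
          using m0 by (intro density_cong) (auto simp: ennreal_mult[symmetric] exp_minus)
        finally show ?thesis by (simp add: density_1)
      qed
    qed
    have Tm: "real_distribution (T \<mu>)" "\<And>q. \<bar>q\<bar> < r \<Longrightarrow> integrable (T \<mu>) (\<lambda>x. exp (q * x))"
      "\<And>q. \<bar>q\<bar> < r \<Longrightarrow> (\<integral>x. exp (q * x) \<partial>T \<mu>) = enn2real ((\<integral>\<^sup>+x. ennreal (exp ((q + c) * x)) \<partial>\<mu>)) / m"
      "density (T \<mu>) (\<lambda>x. ennreal (m * exp (- c * x))) = \<mu>"
      using T[OF sets(1) refl] by blast+
    have Tn: "real_distribution (T \<nu>)" "\<And>q. \<bar>q\<bar> < r \<Longrightarrow> integrable (T \<nu>) (\<lambda>x. exp (q * x))"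
      "\<And>q. \<bar>q\<bar> < r \<Longrightarrow> (\<integral>x. exp (q * x) \<partial>T \<nu>) = enn2real ((\<integral>\<^sup>+x. ennreal (exp ((q + c) * x)) \<partial>\<nu>)) / m"
      "density (T \<nu>) (\<lambda>x. ennreal (m * exp (- c * x))) = \<nu>"
      using T[OF sets(2) eq[symmetric]] by blast+
    have "T \<mu> = T \<nu>"
    proof (rule real_distribution_eq_if_exp_moments_eq[OF Tm(1) Tn(1) r0 Tm(2) Tn(2)])
      fix q :: real assume q: "\<bar>q\<bar> < r"
      then have "a < q + c" "q + c < b" by (auto simp: r_def c_def field_simps)
      then show "(\<integral>x. exp (q * x) \<partial>T \<mu>) = (\<integral>x. exp (q * x) \<partial>T \<nu>)"
        using eq by (simp add: Tm(3)[OF q] Tn(3)[OF q])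
    qed auto
    then show ?thesis using Tm(4) Tn(4) by metis
  qed
qed

section \<open>Cadlag paths\<close>

lemma cadlag_right:
  assumes "cadlag f" "r \<ge> 0" "e > 0"
  obtains d where "d > 0" "\<And>u. r \<le> u \<Longrightarrow> u < r + d \<Longrightarrow> \<bar>f u - f r\<bar> < e"
proof -
  have "(f \<longlongrightarrow> f r) (at_right r)"
    using assms by (auto simp: cadlag_def continuous_within)
  then have "eventually (\<lambda>u. dist (f u) (f r) < e) (at_right r)"
    using \<open>e > 0\<close> by (rule tendstoD)
  then obtain b where b: "b > r" "\<And>u. r < u \<Longrightarrow> u < b \<Longrightarrow> dist (f u) (f r) < e"
    unfolding eventually_at_right_field by auto
  show thesis
  proof (rule that[of "b - r"])
    show "\<bar>f u - f r\<bar> < e" if "r \<le> u" "u < r + (b - r)" for u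
      using b(2)[of u] that \<open>e > 0\<close> by (cases "u = r") (auto simp: dist_real_def)
  qed (use b in auto)
qed

lemma cadlag_left:
  assumes "cadlag f" "r > 0" "e > 0"
  obtains d where "d > 0" "\<And>u. 0 \<le> u \<Longrightarrow> r - d < u \<Longrightarrow> u < r \<Longrightarrow> \<bar>f u - Lim (at_left r) f\<bar> < e"
proof -
  obtain l where l: "(f \<longlongrightarrow> l) (at_left r)" using assms by (auto simp: cadlag_def)
  then have L: "Lim (at_left r) f = l" by (intro tendsto_Lim) auto
  have "eventually (\<lambda>u. dist (f u) l < e) (at_left r)"
    using l \<open>e > 0\<close> by (rule tendstoD)
  then obtain b where b: "b < r" "\<And>u. b < u \<Longrightarrow> u < r \<Longrightarrow> dist (f u) l < e"
    unfolding eventually_at_left_field by auto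
  show thesis
    by (rule that[of "r - b"]) (use b L in \<open>auto simp: dist_real_def\<close>)
qed

text \<open>A compactness argument by bisection: near each point the path is bounded on the right by
  its value and on the left by its left limit.\<close>

lemma cadlag_bounded:
  assumes f: "cadlag f"
  obtains B where "\<And>s. 0 \<le> s \<Longrightarrow> s \<le> t \<Longrightarrow> \<bar>f s\<bar> \<le> B"
proof (cases "t \<ge> 0")
  case False
  then show ?thesis by (intro that[of 0]) auto
next
  case True
  define P where "P a b \<longleftrightarrow> (\<exists>B. \<forall>s. 0 \<le> s \<longrightarrow> a \<le> s \<longrightarrow> s \<le> b \<longrightarrow> \<bar>f s\<bar> \<le> B)" for a b
  have "P 0 t" using True
  proof (induction rule: Bolzano)
    case (trans a b c)
    then obtain B C where "\<forall>s. 0 \<le> s \<longrightarrow> a \<le> s \<longrightarrow> s \<le> b \<longrightarrow> \<bar>f s\<bar> \<le> B"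
      "\<forall>s. 0 \<le> s \<longrightarrow> b \<le> s \<longrightarrow> s \<le> c \<longrightarrow> \<bar>f s\<bar> \<le> C" unfolding P_def by blast
    then show ?case unfolding P_def
      by (intro exI[of _ "max B C"]) (metis linorder_le_cases max.coboundedI1 max.coboundedI2)
  next
    case (local r)
    obtain d1 where d1: "d1 > 0" "\<And>u. r \<le> u \<Longrightarrow> u < r + d1 \<Longrightarrow> \<bar>f u - f r\<bar> < 1"
      using cadlag_right[OF f \<open>0 \<le> r\<close> zero_less_one] by blast
    show ?case
    \<comment> \<open>At 0 no left limit is provided, but there every admissible s lies to the right
      of r.\<close>
    proof (cases "r = 0")
      case True
      have "P a b" if "a \<le> r" "r \<le> b" "b - a < d1" for a b
        unfolding P_def
      proof (intro exI allI impI)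
        fix s assume "0 \<le> s" "a \<le> s" "s \<le> b"
        then have "\<bar>f s - f r\<bar> < 1" using that True by (intro d1) auto
        then show "\<bar>f s\<bar> \<le> \<bar>f r\<bar> + 1" by linarith
      qed
      then show ?thesis using d1(1) by blast
    next
      case False
      then have "r > 0" using local by simp
      then obtain d2 where d2: "d2 > 0"
        "\<And>u. 0 \<le> u \<Longrightarrow> r - d2 < u \<Longrightarrow> u < r \<Longrightarrow> \<bar>f u - Lim (at_left r) f\<bar> < 1"
        using cadlag_left[OF f _ zero_less_one] by blast
      have "P a b" if "a \<le> r" "r \<le> b" "b - a < min d1 d2" for a b
        unfolding P_def
      proof (intro exI allI impI)
        fix s assume s: "0 \<le> s" "a \<le> s" "s \<le> b"
        show "\<bar>f s\<bar> \<le> \<bar>f r\<bar> + \<bar>Lim (at_left r) f\<bar> + 1"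
        proof (cases "s < r")
          case True
          then have "\<bar>f s - Lim (at_left r) f\<bar> < 1" using that s by (intro d2) auto
          then show ?thesis by linarith
        next
          case False
          then have "\<bar>f s - f r\<bar> < 1" using that s by (intro d1) auto
          then show ?thesis by linarith
        qed
      qed
      then show ?thesis using d1(1) d2(1) by (intro exI[of _ "min d1 d2"]) auto
    qed
  qed
  then show ?thesis using that unfolding P_def by blast
qed

text \<open>Otherwise pairs s \<le> u with vanishing gap and increment above e accumulate at some r.
  Two points on the same side of r contradict the one-sided limit there, and a pair straddling r
  exhibits an upward jump at r. This one-sided uniform continuity is the form in which absence of
  positive jumps is used.\<close>

lemma cadlag_no_pos_jump_increment:
  assumes f: "cadlag f" and nj: "\<And>t. t > 0 \<Longrightarrow> f t \<le> Lim (at_left t) f" and e: "e > 0"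
  obtains d where "d > 0" "\<And>s u. 0 \<le> s \<Longrightarrow> s \<le> u \<Longrightarrow> u \<le> T \<Longrightarrow> u \<le> s + d \<Longrightarrow> f u \<le> f s + e"
proof (rule ccontr)
  note ex = that
  assume "\<not> thesis"
  then have neg: "\<exists>s u. 0 \<le> s \<and> s \<le> u \<and> u \<le> T \<and> u \<le> s + d \<and> f u > f s + e" if "d > 0" for d
    using ex[OF that] by (meson not_le)
  define d where "d n = inverse (real (Suc n))" for n
  have "\<exists>p. 0 \<le> fst p \<and> fst p \<le> snd p \<and> snd p \<le> T \<and> snd p \<le> fst p + d n \<and> f (snd p) > f (fst p) + e" for n
    using neg[of "d n"] by (auto simp: d_def)
  then obtain p where p: "\<And>n. 0 \<le> fst (p n)" "\<And>n. fst (p n) \<le> snd (p n)" "\<And>n. snd (p n) \<le> T"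
      "\<And>n. snd (p n) \<le> fst (p n) + d n" "\<And>n. f (snd (p n)) > f (fst (p n)) + e" by metis
  have "\<forall>n. (fst \<circ> p) n \<in> {0..T}"
  proof
    fix n show "(fst \<circ> p) n \<in> {0..T}" using p(1-3)[of n] by simp
  qed
  then obtain r \<phi> where "r \<in> {0..T}" and \<phi>: "strict_mono \<phi>" and "((fst \<circ> p) \<circ> \<phi>) \<longlonglongrightarrow> r"
    by (rule seq_compactE[OF compact_imp_seq_compact[OF compact_Icc]])
  then have r: "r \<in> {0..T}" "strict_mono \<phi>" "(\<lambda>n. fst (p (\<phi> n))) \<longlonglongrightarrow> r"
    by (auto simp: o_def)
  have d0: "(\<lambda>n. d (\<phi> n)) \<longlonglongrightarrow> 0"
    using LIMSEQ_subseq_LIMSEQ[OF LIMSEQ_inverse_real_of_nat r(2)] by (simp add: d_def o_def)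
  have r': "(\<lambda>n. snd (p (\<phi> n))) \<longlonglongrightarrow> r"
  proof (rule tendsto_sandwich[OF _ _ r(3)])
    show "(\<lambda>n. fst (p (\<phi> n)) + d (\<phi> n)) \<longlonglongrightarrow> r" using tendsto_add[OF r(3) d0] by simp
  qed (use p in auto)
  obtain d1 where d1: "d1 > 0" "\<And>u. r \<le> u \<Longrightarrow> u < r + d1 \<Longrightarrow> \<bar>f u - f r\<bar> < e/2"
    using cadlag_right[OF f, of r "e/2"] r e by auto
  obtain d2 where d2: "d2 > 0"
    "\<And>u. 0 \<le> u \<Longrightarrow> r - d2 < u \<Longrightarrow> u < r \<Longrightarrow> \<bar>f u - Lim (at_left r) f\<bar> < e/2"
  proof (cases "r = 0")
    \<comment> \<open>At r = 0 the claim about points left of r is vacuous, so any positive d2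
      serves.\<close>
    case True
    then show ?thesis by (intro that[of 1]) auto
  next
    case False
    then show ?thesis using cadlag_left[OF f, of r "e/2"] r e that by auto
  qed
  have "\<forall>\<^sub>F n in sequentially. dist (fst (p (\<phi> n))) r < min d1 d2 \<and> dist (snd (p (\<phi> n))) r < min d1 d2"
    by (rule eventually_conj[OF tendstoD[OF r(3), of "min d1 d2"] tendstoD[OF r', of "min d1 d2"]])
      (use d1(1) d2(1) in auto)
  then obtain n where n: "dist (fst (p (\<phi> n))) r < min d1 d2" "dist (snd (p (\<phi> n))) r < min d1 d2"
    using eventually_happens'[OF sequentially_bot] by blast
  define s u where "s = fst (p (\<phi> n))" and "u = snd (p (\<phi> n))"
  have su: "0 \<le> s" "s \<le> u" "f u > f s + e" "\<bar>s - r\<bar> < d1" "\<bar>s - r\<bar> < d2" "\<bar>u - r\<bar> < d1" "\<bar>u - r\<bar> < d2"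
    using p n by (auto simp: s_def u_def dist_real_def)
  show False
  proof (cases "u < r")
    case True
    then show False using su d2(2)[of u] d2(2)[of s] by (auto simp: abs_if split: if_splits)
  next
    case ur: False
    then have fu: "\<bar>f u - f r\<bar> < e/2" using su by (intro d1) auto
    show False
    proof (cases "s < r")
      case True
      then have "\<bar>f s - Lim (at_left r) f\<bar> < e/2" using su by (intro d2) auto
      moreover have "f r \<le> Lim (at_left r) f" using su True by (intro nj) auto
      ultimately show False using fu su by (auto simp: abs_if split: if_splits)
    next
      case False
      then have "\<bar>f s - f r\<bar> < e/2" using su by (intro d1) auto
      then show False using fu su by (auto simp: abs_if split: if_splits)
    qed
  qed
qed

lemma cadlag_tendsto_right:
  assumes f: "cadlag f" and t: "t \<ge> 0" and x: "x \<longlonglongrightarrow> t" "\<And>n. x n \<ge> t"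
  shows "(\<lambda>n. f (x n)) \<longlonglongrightarrow> f t"
proof (rule tendstoI)
  fix e :: real assume "e > 0"
  then obtain d where d: "d > 0" "\<And>u. t \<le> u \<Longrightarrow> u < t + d \<Longrightarrow> \<bar>f u - f t\<bar> < e"
    using cadlag_right[OF f t] by blast
  have "\<forall>\<^sub>F n in sequentially. dist (x n) t < d" using x(1) d(1) by (rule tendstoD)
  then show "\<forall>\<^sub>F n in sequentially. dist (f (x n)) (f t) < e"
  proof eventually_elim
    case (elim n)
    then show ?case using d(2)[of "x n"] x(2)[of n] by (simp add: dist_real_def)
  qed
qed

text \<open>The successor moves the grid point strictly to the right of t, the side on which cadlag
  paths are continuous; the floor keeps it within one mesh of t.\<close>

lemma grid_approx_right:
  fixes t :: real assumes "t \<ge> 0"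
  shows "(\<lambda>n. real (Suc (nat \<lfloor>real (Suc n) * t\<rfloor>)) / real (Suc n)) \<longlonglongrightarrow> t"
    and "real (Suc (nat \<lfloor>real (Suc n) * t\<rfloor>)) / real (Suc n) > t"
    and "real (Suc (nat \<lfloor>real (Suc n) * t\<rfloor>)) / real (Suc n) \<le> t + inverse (real (Suc n))"
proof -
  have *: "real (Suc (nat \<lfloor>real (Suc n) * t\<rfloor>)) / real (Suc n) > t \<and>
    real (Suc (nat \<lfloor>real (Suc n) * t\<rfloor>)) / real (Suc n) \<le> t + inverse (real (Suc n))" for n
  proof -
    have "real (nat \<lfloor>real (Suc n) * t\<rfloor>) = of_int \<lfloor>real (Suc n) * t\<rfloor>" using assms by simp
    then have "real (nat \<lfloor>real (Suc n) * t\<rfloor>) \<le> t * real (Suc n)"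
        "real (nat \<lfloor>real (Suc n) * t\<rfloor>) + 1 > t * real (Suc n)" by (simp_all add: mult.commute[of t] del: of_nat_Suc)
    moreover have "(t + inverse (real (Suc n))) * real (Suc n) = t * real (Suc n) + 1"
      by (simp add: distrib_right del: of_nat_Suc)
    ultimately show ?thesis
      by (simp add: pos_less_divide_eq pos_divide_le_eq del: of_nat_Suc)
  qed
  show "real (Suc (nat \<lfloor>real (Suc n) * t\<rfloor>)) / real (Suc n) > t"
    "real (Suc (nat \<lfloor>real (Suc n) * t\<rfloor>)) / real (Suc n) \<le> t + inverse (real (Suc n))" using * by auto
  have lim: "(\<lambda>n. t + inverse (real (Suc n))) \<longlonglongrightarrow> t"
    using tendsto_add[OF tendsto_const LIMSEQ_inverse_real_of_nat, of t] by simp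
  show "(\<lambda>n. real (Suc (nat \<lfloor>real (Suc n) * t\<rfloor>)) / real (Suc n)) \<longlonglongrightarrow> t"
    by (rule tendsto_sandwich[OF _ _ tendsto_const lim])
      (use * in \<open>simp_all add: less_imp_le del: of_nat_Suc\<close>)
qed

text \<open>By right continuity a visit to an open set lasts for a while to the right, long enough
  to be seen on a fine grid. Only s = t leaves no room to the right, and t is itself the last grid
  point.\<close>

lemma cadlag_grid_hit:
  assumes f: "cadlag f" and s: "0 \<le> s" "s \<le> t" and o: "open A" "f s \<in> A"
  shows "\<forall>\<^sub>F n in sequentially. \<exists>k\<le>Suc n. f (real k * (t / real (Suc n))) \<in> A"
proof (cases "s = t")
  case True
  have "\<exists>k\<le>Suc n. f (real k * (t / real (Suc n))) \<in> A" for n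
    using o True by (intro exI[of _ "Suc n"]) (simp del: of_nat_Suc)
  then show ?thesis by simp
next
  case False
  then have st: "s < t" "t > 0" using s by auto
  obtain e where e: "e > 0" "ball (f s) e \<subseteq> A" using o by (meson open_contains_ball)
  obtain d where d: "d > 0" "\<And>u. s \<le> u \<Longrightarrow> u < s + d \<Longrightarrow> \<bar>f u - f s\<bar> < e"
    using cadlag_right[OF f s(1) e(1)] by blast
  have "s / t \<ge> 0" using s st by simp
  note g = grid_approx_right[OF this]
  have "(\<lambda>n. t * (s / t + inverse (real (Suc n)))) \<longlonglongrightarrow> t * (s / t + 0)"
    by (intro tendsto_intros LIMSEQ_inverse_real_of_nat)
  then have "\<forall>\<^sub>F n in sequentially. t * (s / t + inverse (real (Suc n))) < min t (s + d)"
    using st d(1) by (intro order_tendstoD) auto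
  then show ?thesis
  proof eventually_elim
    case (elim n)
    define k where "k = Suc (nat \<lfloor>real (Suc n) * (s/t)\<rfloor>)"
    have k: "real k / real (Suc n) > s / t" "real k / real (Suc n) \<le> s / t + inverse (real (Suc n))"
      using g(2,3)[of n] by (auto simp: k_def)
    have eq: "t * (real k / real (Suc n)) = real k * (t / real (Suc n))" by simp
    have 1: "real k * (t / real (Suc n)) > s"
      using mult_strict_left_mono[OF k(1) st(2)] st unfolding eq by simp
    have 2: "real k * (t / real (Suc n)) < min t (s + d)"
      using mult_left_mono[OF k(2) less_imp_le[OF st(2)]] elim unfolding eq by linarith
    have "(real k / real (Suc n)) * t < 1 * t" using 2 by (simp del: of_nat_Suc)
    then have "real k / real (Suc n) < 1" using st(2) by (simp only: mult_less_cancel_right_pos)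
    then have "k \<le> Suc n" by (simp del: of_nat_Suc)
    moreover have "f (real k * (t / real (Suc n))) \<in> A"
      using e(2) d(2)[of "real k * (t / real (Suc n))"] 1 2
      by (auto simp: subset_iff dist_real_def abs_minus_commute)
    ultimately show ?case by blast
  qed
qed

section \<open>Running infimum and measurability jointly in time and outcome\<close>

definition run_inf :: "(real \<Rightarrow> real) \<Rightarrow> real \<Rightarrow> real" where
  "run_inf f t = (INF s\<in>{0..t}. f s)"

lemma cadlag_bdd_below: "cadlag f \<Longrightarrow> bdd_below (f ` {0..t})"
proof -
  assume "cadlag f"
  then obtain B where "\<And>s. 0 \<le> s \<Longrightarrow> s \<le> t \<Longrightarrow> \<bar>f s\<bar> \<le> B" using cadlag_bounded by blast
  then have "f s \<ge> - B" if "0 \<le> s" "s \<le> t" for s using that by fastforce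
  then show ?thesis by (intro bdd_belowI2[of _ "- B"]) auto
qed

lemma run_inf_le: "cadlag f \<Longrightarrow> 0 \<le> s \<Longrightarrow> s \<le> t \<Longrightarrow> run_inf f t \<le> f s"
  unfolding run_inf_def by (intro cINF_lower cadlag_bdd_below) auto

lemma run_inf_ge: "0 \<le> t \<Longrightarrow> (\<And>s. 0 \<le> s \<Longrightarrow> s \<le> t \<Longrightarrow> a \<le> f s) \<Longrightarrow> a \<le> run_inf f t"
  unfolding run_inf_def by (intro cINF_greatest) auto

lemma run_inf_add:
  assumes "cadlag f" "t \<ge> 0"
  shows "(INF s\<in>{0..t}. x + f s) = x + run_inf f t"
proof (rule cInf_eq_non_empty)
  show "x + run_inf f t \<le> y" if "y \<in> (\<lambda>s. x + f s) ` {0..t}" for y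
    using that run_inf_le[OF assms(1)] by auto
  show "y \<le> x + run_inf f t" if "\<And>z. z \<in> (\<lambda>s. x + f s) ` {0..t} \<Longrightarrow> y \<le> z" for y
    using run_inf_ge[OF assms(2), of "y - x" f] that by (force simp: algebra_simps)
qed (use assms in auto)

text \<open>Times are written as u * t with rational u in [0, 1], so that the countable index set
  does not depend on t; this is what gives joint measurability in t. A value strictly below the
  rational infimum would be an open condition, detected on a grid of rational multiples of
  t.\<close>

lemma run_inf_rat:
  assumes f: "cadlag f" and t: "t \<ge> 0"
  shows "run_inf f t = (INF u\<in>\<rat> \<inter> {0..1}. f (u * t))"
proof (rule antisym)
  have ut: "0 \<le> u * t \<and> u * t \<le> t" if "u \<in> {0..1}" for u
    using that t by (auto intro: mult_left_le_one_le)
  show "run_inf f t \<le> (INF u\<in>\<rat> \<inter> {0..1}. f (u * t))"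
    using ut by (intro cINF_greatest run_inf_le f) auto
  have bdd: "bdd_below ((\<lambda>u. f (u * t)) ` (\<rat> \<inter> {0..1}))"
    using cadlag_bdd_below[OF f, of t] by (rule bdd_below_mono) (use ut in auto)
  show "(INF u\<in>\<rat> \<inter> {0..1}. f (u * t)) \<le> run_inf f t"
  proof (rule run_inf_ge[OF t], rule ccontr)
    fix s assume s: "0 \<le> s" "s \<le> t" and n: "\<not> (INF u\<in>\<rat> \<inter> {0..1}. f (u * t)) \<le> f s"
    let ?m = "INF u\<in>\<rat> \<inter> {0..1}. f (u * t)"
    have "\<forall>\<^sub>F n in sequentially. \<exists>k\<le>Suc n. f (real k * (t / real (Suc n))) \<in> {..< ?m}"
      using n by (intro cadlag_grid_hit[OF f s]) auto
    then obtain n where "\<exists>k\<le>Suc n. f (real k * (t / real (Suc n))) \<in> {..< ?m}"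
      using eventually_happens'[OF sequentially_bot] by blast
    then obtain k where k: "k \<le> Suc n" "f (real k * (t / real (Suc n))) < ?m" by blast
    have "?m \<le> f ((real k / real (Suc n)) * t)"
      using k by (intro cINF_lower[OF bdd]) (auto simp del: of_nat_Suc)
    then show False using k by (simp add: field_simps)
  qed
qed

lemma cadlag_processD:
  assumes "cadlag_process M X"
  shows "prob_space M" "t \<ge> 0 \<Longrightarrow> X t \<in> borel_measurable M" "\<omega> \<in> space M \<Longrightarrow> cadlag (\<lambda>t. X t \<omega>)"
  using assms by (auto simp: cadlag_process_def)

text \<open>Right continuity makes X the limit of versions frozen at the next grid point, each
  selecting among countably many random variables. Clipping by \<open>max 0\<close> is used because
  nothing is assumed about negative times.\<close>

lemma cadlag_process_measurable_pair:
  assumes "cadlag_process M X"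
  shows "(\<lambda>(t, \<omega>). X (max 0 t) \<omega>) \<in> borel_measurable ((borel :: real measure) \<Otimes>\<^sub>M M)"
proof (rule borel_measurable_LIMSEQ_real)
  let ?g = "\<lambda>n t. nat \<lfloor>real (Suc n) * max 0 t\<rfloor>"
  let ?X = "\<lambda>n i p. X (real (Suc i) / real (Suc n)) (snd p)"
  show "(\<lambda>n. ?X n (?g n (fst p)) p) \<longlonglongrightarrow> (case p of (t, \<omega>) \<Rightarrow> X (max 0 t) \<omega>)"
    if "p \<in> space ((borel :: real measure) \<Otimes>\<^sub>M M)" for p
  proof -
    have "snd p \<in> space M" using that by (auto simp: space_pair_measure)
    then show ?thesis
      using cadlag_tendsto_right[OF cadlag_processD(3)[OF assms], of "snd p" "max 0 (fst p)"]
        grid_approx_right[of "max 0 (fst p)"] by (auto simp: split_beta less_imp_le simp del: of_nat_Suc)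
  qed
  show "(\<lambda>p. ?X n (?g n (fst p)) p) \<in> borel_measurable ((borel :: real measure) \<Otimes>\<^sub>M M)" for n
  proof (rule measurable_compose_countable[where g="\<lambda>p. ?g n (fst p)"])
    show "?X n i \<in> borel_measurable ((borel :: real measure) \<Otimes>\<^sub>M M)" for i
      using cadlag_processD(2)[OF assms] by (intro measurable_compose[OF measurable_snd]) auto
    show "(\<lambda>p. ?g n (fst p)) \<in> borel \<Otimes>\<^sub>M M \<rightarrow>\<^sub>M count_space UNIV" by measurable
  qed
qed

lemma run_inf_measurable_pair:
  assumes "cadlag_process M X"
  shows "(\<lambda>(t, \<omega>). run_inf (\<lambda>s. X s \<omega>) (max 0 t)) \<in> borel_measurable ((borel :: real measure) \<Otimes>\<^sub>M M)"
proof -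
  have "(\<lambda>p. INF u\<in>\<rat> \<inter> {0..1}. (case (u * max 0 (fst p), snd p) of (t, \<omega>) \<Rightarrow> X (max 0 t) \<omega>)) \<in> borel_measurable ((borel :: real measure) \<Otimes>\<^sub>M M)"
  proof (rule borel_measurable_cINF)
    show "countable (\<rat> \<inter> {0..1::real})" by (intro countable_Int1 countable_rat)
    show "(\<lambda>p. case (u * max 0 (fst p), snd p) of (t, \<omega>) \<Rightarrow> X (max 0 t) \<omega>) \<in> borel_measurable ((borel :: real measure) \<Otimes>\<^sub>M M)" for u
      by (rule measurable_compose[OF _ cadlag_process_measurable_pair[OF assms]]) measurable
    fix p assume "p \<in> space ((borel :: real measure) \<Otimes>\<^sub>M M)"
    then have "snd p \<in> space M" by (auto simp: space_pair_measure)
    then have "bdd_below ((\<lambda>t. X t (snd p)) ` {0..max 0 (fst p)})"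
      by (intro cadlag_bdd_below cadlag_processD(3)[OF assms])
    then show "bdd_below ((\<lambda>u. case (u * max 0 (fst p), snd p) of (t, \<omega>) \<Rightarrow> X (max 0 t) \<omega>) ` (\<rat> \<inter> {0..1}))"
      by (rule bdd_below_mono) (auto simp: max_def mult_left_le_one_le split: if_splits intro!: imageI)
  qed
  then show ?thesis
  proof (rule measurable_cong[THEN iffD1, rotated])
    fix p assume "p \<in> space ((borel :: real measure) \<Otimes>\<^sub>M M)"
    then have "snd p \<in> space M" by (auto simp: space_pair_measure)
    then have "run_inf (\<lambda>s. X s (snd p)) (max 0 (fst p)) = (INF u\<in>\<rat> \<inter> {0..1}. X (u * max 0 (fst p)) (snd p))"
      by (intro run_inf_rat cadlag_processD(3)[OF assms]) auto
    also have "\<dots> = (INF u\<in>\<rat> \<inter> {0..1}. X (max 0 (u * max 0 (fst p))) (snd p))"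
      by (intro INF_cong refl) (auto simp: max_def)
    finally show "(INF u\<in>\<rat> \<inter> {0..1}. (case (u * max 0 (fst p), snd p) of (t, \<omega>) \<Rightarrow> X (max 0 t) \<omega>)) =
        (case p of (t, \<omega>) \<Rightarrow> run_inf (\<lambda>s. X s \<omega>) (max 0 t))"
      by (simp add: split_beta)
  qed
qed

section \<open>Levy processes along grids\<close>

locale levy =
  fixes M :: "'a measure" and V :: "real \<Rightarrow> 'a \<Rightarrow> real"
  assumes levy: "levy_process M V"
begin

sublocale prob_space M
  using levy by (simp add: levy_process_def cadlag_process_def)

lemma cadlag_process_V: "cadlag_process M V"
  using levy by (simp add: levy_process_def)

lemma V_measurable: "t \<ge> 0 \<Longrightarrow> V t \<in> borel_measurable M"
  by (rule cadlag_processD(2)[OF cadlag_process_V])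

lemma cadlag_V: "\<omega> \<in> space M \<Longrightarrow> cadlag (\<lambda>t. V t \<omega>)"
  by (rule cadlag_processD(3)[OF cadlag_process_V])

abbreviation R :: "real \<Rightarrow> 'a \<Rightarrow> real" where "R t \<omega> \<equiv> run_inf (\<lambda>s. V s \<omega>) t"

lemma V_pair_measurable [measurable]: "(\<lambda>(t, \<omega>). V (max 0 t) \<omega>) \<in> borel_measurable (borel \<Otimes>\<^sub>M M)"
  by (rule cadlag_process_measurable_pair[OF cadlag_process_V])

lemma R_pair_measurable [measurable]: "(\<lambda>(t, \<omega>). R (max 0 t) \<omega>) \<in> borel_measurable (borel \<Otimes>\<^sub>M M)"
  by (rule run_inf_measurable_pair[OF cadlag_process_V])

lemma V_compose_measurable [measurable (raw)]:
  assumes "f \<in> N \<rightarrow>\<^sub>M borel" "g \<in> N \<rightarrow>\<^sub>M M"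
  shows "(\<lambda>x. V (max 0 (f x)) (g x)) \<in> borel_measurable N"
  using measurable_compose[OF measurable_Pair[OF assms] V_pair_measurable] by simp

lemma R_compose_measurable [measurable (raw)]:
  assumes "f \<in> N \<rightarrow>\<^sub>M borel" "g \<in> N \<rightarrow>\<^sub>M M"
  shows "(\<lambda>x. R (max 0 (f x)) (g x)) \<in> borel_measurable N"
  using measurable_compose[OF measurable_Pair[OF assms] R_pair_measurable] by simp

lemma V_0: "AE \<omega> in M. V 0 \<omega> = 0"
  using levy by (simp add: levy_process_def)

lemma increments_indep:
  "0 \<le> t 0 \<Longrightarrow> mono t \<Longrightarrow> indep_vars (\<lambda>_. borel) (\<lambda>i \<omega>. V (t (Suc i)) \<omega> - V (t i) \<omega>) {..<n :: nat}"
  using levy by (simp add: levy_process_def)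

lemma increments_stationary:
  "s \<ge> 0 \<Longrightarrow> h \<ge> 0 \<Longrightarrow> distr M borel (\<lambda>\<omega>. V (s + h) \<omega> - V s \<omega>) = distr M borel (V h)"
  using levy by (simp add: levy_process_def)

lemma nn_integral_increment:
  assumes "s \<ge> 0" "h \<ge> 0" and [measurable]: "\<phi> \<in> borel_measurable borel"
  shows "(\<integral>\<^sup>+\<omega>. \<phi> (V (s + h) \<omega> - V s \<omega>) \<partial>M) = (\<integral>\<^sup>+\<omega>. \<phi> (V h \<omega>) \<partial>M)"
proof -
  have [measurable]: "V s \<in> borel_measurable M" "V (s + h) \<in> borel_measurable M" "V h \<in> borel_measurable M"
    using assms by (auto intro: V_measurable)
  have "(\<integral>\<^sup>+\<omega>. \<phi> (V (s + h) \<omega> - V s \<omega>) \<partial>M) = (\<integral>\<^sup>+v. \<phi> v \<partial>distr M borel (\<lambda>\<omega>. V (s + h) \<omega> - V s \<omega>))"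
    by (subst nn_integral_distr) auto
  also have "\<dots> = (\<integral>\<^sup>+\<omega>. \<phi> (V h \<omega>) \<partial>M)"
    unfolding increments_stationary[OF assms(1,2)] by (subst nn_integral_distr) auto
  finally show ?thesis .
qed

text \<open>The simple Markov property at time t k, for events of finitely many coordinates. The
  last increment is independent of the earlier ones, whose partial sums are the values of V at t 0,
  ..., t k, and stationarity turns it into a copy of V s.\<close>

lemma markov_increments:
  fixes t :: "nat \<Rightarrow> real"
  assumes t: "mono t" "0 \<le> t 0" and s: "s \<ge> 0"
    and B: "\<And>j. B j \<in> sets borel" and [measurable]: "\<phi> \<in> borel_measurable borel"
  shows "(\<integral>\<^sup>+\<omega>. indicator {\<omega>. \<forall>j\<le>k. V (t j) \<omega> \<in> B j} \<omega> * \<phi> (V (t k + s) \<omega>) \<partial>M) =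
    (\<integral>\<^sup>+\<omega>. indicator {\<omega>. \<forall>j\<le>k. V (t j) \<omega> \<in> B j} \<omega> * (\<integral>\<^sup>+\<omega>'. \<phi> (V (t k) \<omega> + V s \<omega>') \<partial>M) \<partial>M)"
proof -
  have [measurable]: "\<And>j. B j \<in> sets borel" by fact
  have tpos: "t j \<ge> 0" for j using t(2) monoD[OF t(1), of 0 j] by simp
  \<comment> \<open>The grid is preceded by 0, so that partial sums of increments give V itself, and
    followed by t k + s; afterwards it stays constant, which keeps it monotone.\<close>
  define t' where "t' i = (if i = 0 then 0 else if i \<le> Suc k then t (i - 1) else t k + s)" for i
  define \<xi> where "\<xi> i \<omega> = V (t' (Suc i)) \<omega> - V (t' i) \<omega>" for i \<omega>
  have t'pos: "t' j \<ge> 0" for j using tpos s by (simp add: t'_def)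
  have [measurable]: "\<xi> i \<in> borel_measurable M" for i
    unfolding \<xi>_def by (intro borel_measurable_diff V_measurable t'pos)
  have [measurable]: "V s \<in> borel_measurable M" using s by (rule V_measurable)
  have mono: "mono t'"
    unfolding mono_iff_le_Suc
  proof
    fix n show "t' n \<le> t' (Suc n)"
      using tpos s monoD[OF t(1), of "n - 1" n] by (auto simp: t'_def not_less_eq_eq le_Suc_eq)
  qed
  have "indep_vars (\<lambda>_. borel) \<xi> {..<Suc (Suc k)}"
    unfolding \<xi>_def by (rule increments_indep[OF _ mono]) (simp add: t'_def)
  then have "indep_var (PiM {..k} (\<lambda>_. borel)) (\<lambda>\<omega>. restrict (\<lambda>i. \<xi> i \<omega>) {..k})
      (PiM {Suc k} (\<lambda>_. borel)) (\<lambda>\<omega>. restrict (\<lambda>i. \<xi> i \<omega>) {Suc k})"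
    by (rule indep_var_restrict) auto
  note ind = this
  define P where "P = PiM {..k} (\<lambda>_. borel :: real measure)"
  define U where "U \<omega> = restrict (\<lambda>i. \<xi> i \<omega>) {..k}" for \<omega>
  have U [measurable]: "U \<in> M \<rightarrow>\<^sub>M P" unfolding U_def P_def by measurable
  define Q where "Q = PiM {Suc k} (\<lambda>_. borel :: real measure)"
  define Y where "Y \<omega> = restrict (\<lambda>i. \<xi> i \<omega>) {Suc k}" for \<omega>
  have Y [measurable]: "Y \<in> M \<rightarrow>\<^sub>M Q" unfolding Y_def Q_def by measurable
  have Yk: "Y \<omega> (Suc k) = \<xi> (Suc k) \<omega>" for \<omega> by (simp add: Y_def)
  have [measurable]: "(\<lambda>y. y (Suc k)) \<in> borel_measurable Q"
    unfolding Q_def by (intro measurable_component_singleton) auto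
  have ind': "distr M (P \<Otimes>\<^sub>M Q) (\<lambda>\<omega>. (U \<omega>, Y \<omega>)) = distr M P U \<Otimes>\<^sub>M distr M Q Y"
    using ind unfolding indep_var_distribution_eq P_def Q_def U_def Y_def by simp
  define S where "S j u = (\<Sum>i\<le>j. u i)" for j :: nat and u :: "nat \<Rightarrow> real"
  have S [measurable]: "S j \<in> borel_measurable P" if "j \<le> k" for j
    unfolding S_def P_def using that
    by (intro borel_measurable_sum measurable_component_singleton) auto
  \<comment> \<open>Almost everywhere only, because V 0 = 0 is imposed only almost surely.\<close>
  have SU: "AE \<omega> in M. \<forall>j\<le>k. V (t j) \<omega> = S j (U \<omega>)"
    using V_0
  proof eventually_elim
    case (elim \<omega>)
    show ?case
    proof (intro allI impI)
      fix j assume j: "j \<le> k"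
      have "S j (U \<omega>) = (\<Sum>i<Suc j. V (t' (Suc i)) \<omega> - V (t' i) \<omega>)"
        unfolding S_def U_def \<xi>_def lessThan_Suc_atMost using j by (intro sum.cong) auto
      also have "\<dots> = V (t' (Suc j)) \<omega> - V (t' 0) \<omega>" by (rule sum_lessThan_telescope)
      finally show "V (t j) \<omega> = S j (U \<omega>)" using elim j by (simp add: t'_def)
    qed
  qed
  define D where "D u = (indicator {u. \<forall>j\<le>k. S j u \<in> B j} u :: ennreal)" for u
  have [measurable]: "S k \<in> borel_measurable P" by (rule S) simp
  have [measurable]: "D \<in> borel_measurable P"
  proof -
    have "{u \<in> space P. \<forall>j\<in>{..k}. S j u \<in> B j} \<in> sets P"
    proof (rule sets.sets_Collect_finite_All)
      fix j assume "j \<in> {..k}"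
      then have [measurable]: "S j \<in> borel_measurable P" by (intro S) auto
      show "{u \<in> space P. S j u \<in> B j} \<in> sets P" by measurable
    qed simp
    then show ?thesis unfolding D_def
      by (subst measurable_cong[where g="indicator {u \<in> space P. \<forall>j\<in>{..k}. S j u \<in> B j}"])
        (auto simp: indicator_def)
  qed
  have \<xi>k: "\<xi> (Suc k) \<omega> = V (t k + s) \<omega> - V (t k) \<omega>" for \<omega> by (simp add: \<xi>_def t'_def)
  have "(\<integral>\<^sup>+\<omega>. indicator {\<omega>. \<forall>j\<le>k. V (t j) \<omega> \<in> B j} \<omega> * \<phi> (V (t k + s) \<omega>) \<partial>M) =
      (\<integral>\<^sup>+\<omega>. D (U \<omega>) * \<phi> (S k (U \<omega>) + \<xi> (Suc k) \<omega>) \<partial>M)"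
    using SU by (intro nn_integral_cong_AE, eventually_elim) (auto simp: D_def \<xi>k indicator_def)
  also have "\<dots> = (\<integral>\<^sup>+p. D (fst p) * \<phi> (S k (fst p) + snd p (Suc k)) \<partial>distr M (P \<Otimes>\<^sub>M Q) (\<lambda>\<omega>. (U \<omega>, Y \<omega>)))"
    by (subst nn_integral_distr) (auto simp: Yk)
  also have "\<dots> = (\<integral>\<^sup>+u. \<integral>\<^sup>+v. D u * \<phi> (S k u + v (Suc k)) \<partial>distr M Q Y \<partial>distr M P U)"
  proof -
    interpret d: prob_space "distr M Q Y" by (rule prob_space_distr) measurable
    show ?thesis unfolding ind' by (subst d.nn_integral_fst[symmetric]) auto
  qed
  also have "\<dots> = (\<integral>\<^sup>+\<omega>. \<integral>\<^sup>+v. D (U \<omega>) * \<phi> (S k (U \<omega>) + v (Suc k)) \<partial>distr M Q Y \<partial>M)"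
  proof -
    interpret d: prob_space "distr M Q Y" by (rule prob_space_distr) measurable
    show ?thesis by (subst nn_integral_distr) auto
  qed
  also have "\<dots> = (\<integral>\<^sup>+\<omega>. D (U \<omega>) * (\<integral>\<^sup>+\<omega>'. \<phi> (S k (U \<omega>) + \<xi> (Suc k) \<omega>') \<partial>M) \<partial>M)"
    by (intro nn_integral_cong) (simp add: nn_integral_distr nn_integral_cmult Yk)
  also have "\<dots> = (\<integral>\<^sup>+\<omega>. D (U \<omega>) * (\<integral>\<^sup>+\<omega>'. \<phi> (S k (U \<omega>) + V s \<omega>') \<partial>M) \<partial>M)"
    unfolding \<xi>k by (intro nn_integral_cong arg_cong2[where f=times] refl
        nn_integral_increment[OF tpos s, where \<phi>="\<lambda>v. \<phi> (S k (U _) + v)"]) measurable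
  also have "\<dots> = (\<integral>\<^sup>+\<omega>. indicator {\<omega>. \<forall>j\<le>k. V (t j) \<omega> \<in> B j} \<omega> * (\<integral>\<^sup>+\<omega>'. \<phi> (V (t k) \<omega> + V s \<omega>') \<partial>M) \<partial>M)"
    using SU by (intro nn_integral_cong_AE, eventually_elim) (auto simp: D_def indicator_def)
  finally show ?thesis .
qed

section \<open>Grid events and optional stopping along a grid\<close>

lemma grid_event_measurable:
  assumes "\<And>j. j \<le> k \<Longrightarrow> t j \<ge> 0" "\<And>j. B j \<in> sets borel"
  shows "indicator {\<omega>. \<forall>j\<le>(k::nat). V (t j) \<omega> \<in> B j} \<in> borel_measurable M"
proof -
  have "{\<omega> \<in> space M. \<forall>j\<in>{..k}. V (t j) \<omega> \<in> B j} \<in> sets M"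
  proof (rule sets.sets_Collect_finite_All)
    fix j assume "j \<in> {..k}"
    then have [measurable]: "V (t j) \<in> borel_measurable M" by (intro V_measurable assms) auto
    have [measurable]: "B j \<in> sets borel" by fact
    show "{\<omega> \<in> space M. V (t j) \<omega> \<in> B j} \<in> sets M" by measurable
  qed simp
  then show ?thesis
    by (subst measurable_cong[where g="indicator {\<omega> \<in> space M. \<forall>j\<in>{..k}. V (t j) \<omega> \<in> B j}"])
      (auto simp: indicator_def)
qed

text \<open>Written as a single conjunction over the grid times up to k of membership in Borel sets,
  the shape to which \<open>markov_grid\<close> applies.\<close>

definition first_hit :: "real \<Rightarrow> real \<Rightarrow> nat \<Rightarrow> 'a set" where
  "first_hit a \<delta> k = {\<omega>. \<forall>j\<le>k. V (real j * \<delta>) \<omega> \<in> (if j < k then {..<a} else {a..})}"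

definition no_hit :: "real \<Rightarrow> real \<Rightarrow> nat \<Rightarrow> 'a set" where
  "no_hit a \<delta> k = {\<omega>. \<forall>j\<le>k. V (real j * \<delta>) \<omega> \<in> {..<a}}"

lemma first_hit_measurable: "\<delta> \<ge> 0 \<Longrightarrow> indicator (first_hit a \<delta> k) \<in> borel_measurable M"
  unfolding first_hit_def by (intro grid_event_measurable) auto

lemma no_hit_measurable: "\<delta> \<ge> 0 \<Longrightarrow> indicator (no_hit a \<delta> k) \<in> borel_measurable M"
  unfolding no_hit_def by (intro grid_event_measurable) auto

lemma disjoint_first_hit: "disjoint_family (first_hit a \<delta>)"
proof -
  have "first_hit a \<delta> i \<inter> first_hit a \<delta> j = {}" if "i < j" for i j
  proof -
    have "\<omega> \<notin> first_hit a \<delta> j" if "\<omega> \<in> first_hit a \<delta> i" for \<omega>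
    proof
      assume "\<omega> \<in> first_hit a \<delta> j"
      then have "V (real i * \<delta>) \<omega> < a" using \<open>i < j\<close> by (auto simp: first_hit_def dest!: spec[of _ i])
      moreover have "V (real i * \<delta>) \<omega> \<ge> a" using that by (auto simp: first_hit_def dest!: spec[of _ i])
      ultimately show False by simp
    qed
    then show ?thesis by blast
  qed
  then show ?thesis unfolding disjoint_family_on_def by (metis Int_commute linorder_neqE_nat)
qed

lemma no_hit_split:
  "(indicator (no_hit a \<delta> n) \<omega> :: ennreal) = indicator (no_hit a \<delta> (Suc n)) \<omega> + indicator (first_hit a \<delta> (Suc n)) \<omega>"
  by (auto simp: no_hit_def first_hit_def indicator_def le_Suc_eq not_less)

lemma grid_mono: "\<delta> \<ge> 0 \<Longrightarrow> mono (\<lambda>j. real j * \<delta>)"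
  by (auto intro!: monoI mult_right_mono)

lemma markov_grid:
  assumes "\<delta> \<ge> 0" "s \<ge> 0" "\<And>j. B j \<in> sets borel" "\<phi> \<in> borel_measurable borel"
  shows "(\<integral>\<^sup>+\<omega>. indicator {\<omega>. \<forall>j\<le>k. V (real j * \<delta>) \<omega> \<in> B j} \<omega> * \<phi> (V (real k * \<delta> + s) \<omega>) \<partial>M) =
    (\<integral>\<^sup>+\<omega>. indicator {\<omega>. \<forall>j\<le>k. V (real j * \<delta>) \<omega> \<in> B j} \<omega> * (\<integral>\<^sup>+\<omega>'. \<phi> (V (real k * \<delta>) \<omega> + V s \<omega>') \<partial>M) \<partial>M)"
  using markov_increments[OF grid_mono[OF assms(1)] _ assms(2-4)] by simp

text \<open>The event is known at the k-th grid time, and the remaining n - k steps form one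
  increment, to which the hypothesis on F applies at the current position.\<close>

lemma submartingale_step:
  assumes sub: "\<And>z s. s \<ge> 0 \<Longrightarrow> F z \<le> (\<integral>\<^sup>+\<omega>. F (z + V s \<omega>) \<partial>M)" and F: "F \<in> borel_measurable borel"
    and "\<delta> \<ge> 0" "k \<le> n" "\<And>j. B j \<in> sets borel"
  shows "(\<integral>\<^sup>+\<omega>. indicator {\<omega>. \<forall>j\<le>k. V (real j * \<delta>) \<omega> \<in> B j} \<omega> * F (V (real k * \<delta>) \<omega>) \<partial>M) \<le>
    (\<integral>\<^sup>+\<omega>. indicator {\<omega>. \<forall>j\<le>k. V (real j * \<delta>) \<omega> \<in> B j} \<omega> * F (V (real n * \<delta>) \<omega>) \<partial>M)"
proof -
  have n: "real n * \<delta> = real k * \<delta> + real (n - k) * \<delta>" using assms by (simp add: of_nat_diff algebra_simps)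
  show ?thesis unfolding n using assms
    by (subst markov_grid) (auto intro!: nn_integral_mono mult_left_mono sub)
qed

lemma supermartingale_step:
  assumes sup: "\<And>z s. s \<ge> 0 \<Longrightarrow> F z \<ge> (\<integral>\<^sup>+\<omega>. F (z + V s \<omega>) \<partial>M)" and F: "F \<in> borel_measurable borel"
    and "\<delta> \<ge> 0" "k \<le> n" "\<And>j. B j \<in> sets borel"
  shows "(\<integral>\<^sup>+\<omega>. indicator {\<omega>. \<forall>j\<le>k. V (real j * \<delta>) \<omega> \<in> B j} \<omega> * F (V (real k * \<delta>) \<omega>) \<partial>M) \<ge>
    (\<integral>\<^sup>+\<omega>. indicator {\<omega>. \<forall>j\<le>k. V (real j * \<delta>) \<omega> \<in> B j} \<omega> * F (V (real n * \<delta>) \<omega>) \<partial>M)"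
proof -
  have n: "real n * \<delta> = real k * \<delta> + real (n - k) * \<delta>" using assms by (simp add: of_nat_diff algebra_simps)
  show ?thesis unfolding n using assms
    by (subst markov_grid) (auto intro!: nn_integral_mono mult_left_mono sup)
qed

lemma nn_integral_no_hit_split:
  assumes F: "F \<in> borel_measurable borel" and d: "\<delta> \<ge> 0"
  shows "(\<integral>\<^sup>+\<omega>. indicator (no_hit a \<delta> n) \<omega> * F (V (real (Suc n) * \<delta>) \<omega>) \<partial>M) =
    (\<integral>\<^sup>+\<omega>. indicator (no_hit a \<delta> (Suc n)) \<omega> * F (V (real (Suc n) * \<delta>) \<omega>) \<partial>M) +
    (\<integral>\<^sup>+\<omega>. indicator (first_hit a \<delta> (Suc n)) \<omega> * F (V (real (Suc n) * \<delta>) \<omega>) \<partial>M)"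
proof -
  have [measurable]: "V (real (Suc n) * \<delta>) \<in> borel_measurable M" "F \<in> borel_measurable borel"
    "indicator (first_hit a \<delta> (Suc n)) \<in> borel_measurable M" "indicator (no_hit a \<delta> (Suc n)) \<in> borel_measurable M"
    using d F by (auto intro!: V_measurable no_hit_measurable first_hit_measurable)
  show ?thesis unfolding no_hit_split[of a \<delta> n] distrib_right by (subst nn_integral_add) (auto simp del: of_nat_Suc)
qed

lemma first_hit_0:
  assumes F: "F \<in> borel_measurable borel"
  shows "(\<integral>\<^sup>+\<omega>. indicator (first_hit a \<delta> 0) \<omega> * F (V (real 0 * \<delta>) \<omega>) \<partial>M) +
    (\<integral>\<^sup>+\<omega>. indicator (no_hit a \<delta> 0) \<omega> * F (V (real 0 * \<delta>) \<omega>) \<partial>M) = F 0"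
proof -
  have a: "(\<integral>\<^sup>+\<omega>. indicator (first_hit a \<delta> 0) \<omega> * F (V (real 0 * \<delta>) \<omega>) \<partial>M) = (\<integral>\<^sup>+\<omega>. indicator {..0} a * F 0 \<partial>M)"
    by (rule nn_integral_cong_AE) (use V_0 in eventually_elim, auto simp: first_hit_def indicator_def)
  have b: "(\<integral>\<^sup>+\<omega>. indicator (no_hit a \<delta> 0) \<omega> * F (V (real 0 * \<delta>) \<omega>) \<partial>M) = (\<integral>\<^sup>+\<omega>. indicator {0<..} a * F 0 \<partial>M)"
    by (rule nn_integral_cong_AE) (use V_0 in eventually_elim, auto simp: no_hit_def indicator_def)
  show ?thesis unfolding a b by (auto simp: indicator_def emeasure_space_1)
qed

text \<open>Optional stopping by induction: the mass that has not reached a after n steps is moved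
  one step forward by the submartingale inequality, then split according to whether it reaches a
  there.\<close>

lemma submartingale_first_hit:
  assumes sub: "\<And>z s. s \<ge> 0 \<Longrightarrow> F z \<le> (\<integral>\<^sup>+\<omega>. F (z + V s \<omega>) \<partial>M)" and F: "F \<in> borel_measurable borel" and d: "\<delta> \<ge> 0"
  shows "F 0 \<le> (\<Sum>k\<le>n. \<integral>\<^sup>+\<omega>. indicator (first_hit a \<delta> k) \<omega> * F (V (real k * \<delta>) \<omega>) \<partial>M) +
    (\<integral>\<^sup>+\<omega>. indicator (no_hit a \<delta> n) \<omega> * F (V (real n * \<delta>) \<omega>) \<partial>M)"
proof (induction n)
  case 0
  then show ?case using first_hit_0[OF F, of a \<delta>] by simp
next
  case (Suc n)
  have "(\<integral>\<^sup>+\<omega>. indicator (no_hit a \<delta> n) \<omega> * F (V (real n * \<delta>) \<omega>) \<partial>M) \<le>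
      (\<integral>\<^sup>+\<omega>. indicator (no_hit a \<delta> n) \<omega> * F (V (real (Suc n) * \<delta>) \<omega>) \<partial>M)"
    unfolding no_hit_def by (rule submartingale_step[OF sub F d]) auto
  note this[unfolded nn_integral_no_hit_split[OF F d]]
  note order_trans[OF Suc add_left_mono[OF this]]
  then show ?case unfolding sum.atMost_Suc by (simp only: ac_simps)
qed

lemma supermartingale_first_hit:
  assumes sup: "\<And>z s. s \<ge> 0 \<Longrightarrow> F z \<ge> (\<integral>\<^sup>+\<omega>. F (z + V s \<omega>) \<partial>M)" and F: "F \<in> borel_measurable borel" and d: "\<delta> \<ge> 0"
  shows "F 0 \<ge> (\<Sum>k\<le>n. \<integral>\<^sup>+\<omega>. indicator (first_hit a \<delta> k) \<omega> * F (V (real k * \<delta>) \<omega>) \<partial>M) +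
    (\<integral>\<^sup>+\<omega>. indicator (no_hit a \<delta> n) \<omega> * F (V (real n * \<delta>) \<omega>) \<partial>M)"
proof (induction n)
  case 0
  then show ?case using first_hit_0[OF F, of a \<delta>] by simp
next
  case (Suc n)
  have "(\<integral>\<^sup>+\<omega>. indicator (no_hit a \<delta> n) \<omega> * F (V (real (Suc n) * \<delta>) \<omega>) \<partial>M) \<le>
    (\<integral>\<^sup>+\<omega>. indicator (no_hit a \<delta> n) \<omega> * F (V (real n * \<delta>) \<omega>) \<partial>M)"
    unfolding no_hit_def by (rule supermartingale_step[OF sup F d]) auto
  note this[unfolded nn_integral_no_hit_split[OF F d]]
  from order_trans[OF add_left_mono[OF this] Suc]
  show ?case unfolding sum.atMost_Suc by (simp only: ac_simps)
qed

end

section \<open>First passage upwards\<close>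

locale spectrally_negative = levy +
  assumes no_pos_jumps: "AE \<omega> in M. \<forall>t>0. V t \<omega> - Lim (at_left t) (\<lambda>s. V s \<omega>) \<le> 0"
begin

definition overshoot :: "real \<Rightarrow> real \<Rightarrow> real \<Rightarrow> nat \<Rightarrow> 'a set" where
  "overshoot a e \<delta> k = {\<omega>. \<forall>j\<le>k. V (real j * \<delta>) \<omega> \<in> (if j < k then {..<a} else {a + e<..})}"

lemma overshoot_measurable: "\<delta> \<ge> 0 \<Longrightarrow> indicator (overshoot a e \<delta> k) \<in> borel_measurable M"
  unfolding overshoot_def by (intro grid_event_measurable) auto

lemma overshoot_subset: "e > 0 \<Longrightarrow> overshoot a e \<delta> k \<subseteq> first_hit a \<delta> k"
  unfolding overshoot_def first_hit_def by (fastforce split: if_splits)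

text \<open>On [0, N] the path cannot rise by more than e within some time d > 0, so a mesh below d
  admits no step from below a to above a + e. For k = 0 the path sits at 0 < a.\<close>

lemma overshoot_vanishes:
  assumes "a > 0" "e > 0"
  shows "AE \<omega> in M. \<forall>\<^sub>F n in sequentially. \<omega> \<notin> (\<Union>k\<le>Suc n. overshoot a e (real N / real (Suc n)) k)"
  using V_0 no_pos_jumps AE_space
proof eventually_elim
  case (elim \<omega>)
  obtain d where d: "d > 0"
    "\<And>s u. 0 \<le> s \<Longrightarrow> s \<le> u \<Longrightarrow> u \<le> real N \<Longrightarrow> u \<le> s + d \<Longrightarrow> V u \<omega> \<le> V s \<omega> + e"
  proof (rule cadlag_no_pos_jump_increment[OF cadlag_V[OF elim(3)] _ assms(2), of "real N"])
    show "V t \<omega> \<le> Lim (at_left t) (\<lambda>s. V s \<omega>)" if "t > 0" for t using elim(2) that by auto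
  qed (use that in auto)
  have "(\<lambda>n. real N * inverse (real (Suc n))) \<longlonglongrightarrow> real N * 0"
    by (intro tendsto_intros LIMSEQ_inverse_real_of_nat)
  then have "\<forall>\<^sub>F n in sequentially. real N * inverse (real (Suc n)) < d"
    using d(1) by (intro order_tendstoD) auto
  then show ?case
  proof eventually_elim
    case (elim n)
    define \<delta> where "\<delta> = real N / real (Suc n)"
    have \<delta>: "\<delta> \<ge> 0" "\<delta> < d" "real (Suc n) * \<delta> = real N"
      using elim by (auto simp: \<delta>_def divide_inverse)
    have "\<omega> \<notin> overshoot a e \<delta> k" if k: "k \<le> Suc n" for k
    proof
      assume o: "\<omega> \<in> overshoot a e \<delta> k"
      then have gt: "V (real k * \<delta>) \<omega> > a + e" by (auto simp: overshoot_def dest!: spec[of _ k])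
      show False
      proof (cases k)
        case 0
        then show False using gt assms \<open>V 0 \<omega> = 0\<close> by simp
      next
        case (Suc j)
        then have "V (real j * \<delta>) \<omega> < a" using o by (auto simp: overshoot_def dest!: spec[of _ j])
        moreover have "V (real k * \<delta>) \<omega> \<le> V (real j * \<delta>) \<omega> + e"
        proof (rule d(2))
          show "real k * \<delta> \<le> real N" unfolding \<delta>(3)[symmetric] using k \<delta>(1) by (intro mult_right_mono) auto
        qed (use \<delta> Suc in \<open>auto simp: algebra_simps\<close>)
        ultimately show False using gt by linarith
      qed
    qed
    then show ?case unfolding \<delta>_def by blast
  qed
qed

text \<open>Optional stopping at the first grid time above a, or at N. Passages landing in
  [a, a + e] contribute at most F (a + e) times the probability of passing. What remains are
  overshoots and paths below a at time N, both evaluated at N so that they can be made small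
  later.\<close>

lemma first_passage_grid_bound:
  fixes F :: "real \<Rightarrow> ennreal"
  assumes F: "mono F" and Fm [measurable]: "F \<in> borel_measurable borel"
    and sub: "\<And>z s. s \<ge> 0 \<Longrightarrow> F z \<le> (\<integral>\<^sup>+\<omega>. F (z + V s \<omega>) \<partial>M)"
    and a: "a > 0" and e: "e > 0"
    and p: "emeasure M {\<omega>\<in>space M. \<exists>k\<le>Suc n. V (real k * (real N / real (Suc n))) \<omega> \<ge> a} \<le> p"
  shows "F 0 \<le> F (a + e) * p +
    (\<integral>\<^sup>+\<omega>. indicator (\<Union>k\<le>Suc n. overshoot a e (real N / real (Suc n)) k) \<omega> * F (V (real N) \<omega>) \<partial>M) +
    (\<integral>\<^sup>+\<omega>. indicator {..<a} (V (real N) \<omega>) * F (V (real N) \<omega>) \<partial>M)"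
proof -
  define \<delta> where "\<delta> = real N / real (Suc n)"
  have \<delta>: "\<delta> \<ge> 0" "real (Suc n) * \<delta> = real N" by (auto simp: \<delta>_def)
  have [measurable]: "V (real N) \<in> borel_measurable M" by (rule V_measurable) simp
  have [measurable]: "V (real k * \<delta>) \<in> borel_measurable M" for k by (rule V_measurable) (simp add: \<delta>)
  have [measurable]: "indicator (first_hit a \<delta> k) \<in> borel_measurable M" "indicator (overshoot a e \<delta> k) \<in> borel_measurable M" for k
    using \<delta> by (auto intro: first_hit_measurable overshoot_measurable)
  have "(\<integral>\<^sup>+\<omega>. indicator (first_hit a \<delta> k) \<omega> * F (V (real k * \<delta>) \<omega>) \<partial>M) \<le>
      (\<integral>\<^sup>+\<omega>. F (a + e) * indicator (first_hit a \<delta> k) \<omega> \<partial>M) +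
      (\<integral>\<^sup>+\<omega>. indicator (overshoot a e \<delta> k) \<omega> * F (V (real N) \<omega>) \<partial>M)" if k: "k \<le> Suc n" for k
  proof -
    have "(\<integral>\<^sup>+\<omega>. indicator (first_hit a \<delta> k) \<omega> * F (V (real k * \<delta>) \<omega>) \<partial>M) \<le>
       (\<integral>\<^sup>+\<omega>. F (a + e) * indicator (first_hit a \<delta> k) \<omega> + indicator (overshoot a e \<delta> k) \<omega> * F (V (real k * \<delta>) \<omega>) \<partial>M)"
    proof (rule nn_integral_mono)
      fix \<omega>
      show "indicator (first_hit a \<delta> k) \<omega> * F (V (real k * \<delta>) \<omega>) \<le>
        F (a + e) * indicator (first_hit a \<delta> k) \<omega> + indicator (overshoot a e \<delta> k) \<omega> * F (V (real k * \<delta>) \<omega>)"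
      proof (cases "V (real k * \<delta>) \<omega> \<le> a + e")
        case True
        then show ?thesis using monoD[OF F True] by (auto simp: indicator_def intro: add_increasing2)
      next
        case False
        have "\<omega> \<in> overshoot a e \<delta> k" if h: "\<omega> \<in> first_hit a \<delta> k"
          unfolding overshoot_def
        proof (intro CollectI allI impI)
          fix j assume "j \<le> k"
          then show "V (real j * \<delta>) \<omega> \<in> (if j < k then {..<a} else {a + e<..})"
            using h False unfolding first_hit_def by (cases "j = k") (auto dest: spec[of _ j])
        qed
        then show ?thesis by (auto simp: indicator_def intro: add_increasing)
      qed
    qed
    also have "\<dots> = (\<integral>\<^sup>+\<omega>. F (a + e) * indicator (first_hit a \<delta> k) \<omega> \<partial>M) +
      (\<integral>\<^sup>+\<omega>. indicator (overshoot a e \<delta> k) \<omega> * F (V (real k * \<delta>) \<omega>) \<partial>M)"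
      by (subst nn_integral_add) auto
    \<comment> \<open>Moved from the passage time to N, the overshoot terms are dominated by the
      single function F (V N), whatever the mesh.\<close>
    also have "(\<integral>\<^sup>+\<omega>. indicator (overshoot a e \<delta> k) \<omega> * F (V (real k * \<delta>) \<omega>) \<partial>M) \<le>
       (\<integral>\<^sup>+\<omega>. indicator (overshoot a e \<delta> k) \<omega> * F (V (real (Suc n) * \<delta>) \<omega>) \<partial>M)"
      unfolding overshoot_def by (rule submartingale_step[OF sub Fm \<delta>(1) k]) auto
    finally show ?thesis unfolding \<delta>(2) by (simp add: add_left_mono)
  qed
  then have "(\<Sum>k\<le>Suc n. \<integral>\<^sup>+\<omega>. indicator (first_hit a \<delta> k) \<omega> * F (V (real k * \<delta>) \<omega>) \<partial>M) \<le>
    (\<Sum>k\<le>Suc n. (\<integral>\<^sup>+\<omega>. F (a + e) * indicator (first_hit a \<delta> k) \<omega> \<partial>M) +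
      (\<integral>\<^sup>+\<omega>. indicator (overshoot a e \<delta> k) \<omega> * F (V (real N) \<omega>) \<partial>M))"
    by (intro sum_mono) auto
  also have "\<dots> = (\<integral>\<^sup>+\<omega>. (\<Sum>k\<le>Suc n. F (a + e) * indicator (first_hit a \<delta> k) \<omega>) \<partial>M) +
      (\<integral>\<^sup>+\<omega>. (\<Sum>k\<le>Suc n. indicator (overshoot a e \<delta> k) \<omega> * F (V (real N) \<omega>)) \<partial>M)"
    unfolding sum.distrib by (subst (1 2) nn_integral_sum) auto
  also have "(\<lambda>\<omega>. \<Sum>k\<le>Suc n. indicator (overshoot a e \<delta> k) \<omega> * F (V (real N) \<omega>)) =
      (\<lambda>\<omega>. indicator (\<Union>k\<le>Suc n. overshoot a e \<delta> k) \<omega> * F (V (real N) \<omega>))"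
  proof -
    have "disjoint_family_on (overshoot a e \<delta>) {..Suc n}"
      using disjoint_first_hit[of a \<delta>] overshoot_subset[OF e, of a \<delta>]
      unfolding disjoint_family_on_def by blast
    then show ?thesis by (subst indicator_UN_disjoint) (simp_all only: sum_distrib_right finite_atMost)
  qed
  also have "(\<integral>\<^sup>+\<omega>. (\<Sum>k\<le>Suc n. F (a + e) * indicator (first_hit a \<delta> k) \<omega>) \<partial>M) \<le> F (a + e) * p"
  proof -
    let ?A = "{\<omega>\<in>space M. \<exists>k\<in>{..Suc n}. V (real k * \<delta>) \<omega> \<ge> a}"
    have [measurable]: "?A \<in> sets M"
      by (rule sets.sets_Collect_finite_Ex) auto
    have dis: "disjoint_family_on (first_hit a \<delta>) {..Suc n}"
      using disjoint_first_hit unfolding disjoint_family_on_def by blast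
    have "(\<integral>\<^sup>+\<omega>. (\<Sum>k\<le>Suc n. F (a + e) * indicator (first_hit a \<delta> k) \<omega>) \<partial>M) \<le> (\<integral>\<^sup>+\<omega>. F (a + e) * indicator ?A \<omega> \<partial>M)"
    proof (rule nn_integral_mono)
      fix \<omega> assume w: "\<omega> \<in> space M"
      have "\<omega> \<in> ?A" if "\<omega> \<in> first_hit a \<delta> k" "k \<le> Suc n" for k
        using that w by (auto simp: first_hit_def dest!: spec[of _ k])
      then have "(\<Union>k\<le>Suc n. first_hit a \<delta> k) \<inter> {\<omega>} \<subseteq> ?A" by auto
      then have "(indicator (\<Union>k\<le>Suc n. first_hit a \<delta> k) \<omega> :: ennreal) \<le> indicator ?A \<omega>"
        by (auto simp: indicator_def)
      then show "(\<Sum>k\<le>Suc n. F (a + e) * indicator (first_hit a \<delta> k) \<omega>) \<le> F (a + e) * indicator ?A \<omega>"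
        by (subst (asm) indicator_UN_disjoint[OF _ dis])
          (auto simp: sum_distrib_left[symmetric] simp del: sum.atMost_Suc intro!: mult_left_mono)
    qed
    also have "\<dots> = F (a + e) * emeasure M ?A" by (rule nn_integral_cmult_indicator) measurable
    also have "emeasure M ?A \<le> p" using p by (simp add: \<delta>_def Bex_def)
    finally show ?thesis by (simp add: mult_left_mono)
  qed
  finally have 1: "(\<Sum>k\<le>Suc n. \<integral>\<^sup>+\<omega>. indicator (first_hit a \<delta> k) \<omega> * F (V (real k * \<delta>) \<omega>) \<partial>M) \<le>
    F (a + e) * p + (\<integral>\<^sup>+\<omega>. indicator (\<Union>k\<le>Suc n. overshoot a e \<delta> k) \<omega> * F (V (real N) \<omega>) \<partial>M)"
    by (simp add: add_right_mono)
  have 2: "(\<integral>\<^sup>+\<omega>. indicator (no_hit a \<delta> (Suc n)) \<omega> * F (V (real (Suc n) * \<delta>) \<omega>) \<partial>M) \<le>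
    (\<integral>\<^sup>+\<omega>. indicator {..<a} (V (real N) \<omega>) * F (V (real N) \<omega>) \<partial>M)"
    unfolding \<delta>(2) 
  proof (intro nn_integral_mono mult_right_mono)
    fix \<omega>
    show "(indicator (no_hit a \<delta> (Suc n)) \<omega> :: ennreal) \<le> indicator {..<a} (V (real N) \<omega>)"
      using \<delta>(2) by (auto simp: no_hit_def indicator_def dest!: spec[of _ "Suc n"])
  qed simp
  show ?thesis
    using order_trans[OF submartingale_first_hit[where F=F and n="Suc n" and a=a, OF sub Fm \<delta>(1)] add_mono[OF 1 2]]
    unfolding \<delta>_def .
qed

text \<open>Absence of positive jumps makes \<open>V\<close> equal to \<open>a\<close> when it first passes above \<open>a\<close>, whatever
  happens afterwards being negligible because \<open>V\<close> drifts to \<open>-\<infinity>\<close>.\<close>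

lemma first_passage_bound:
  fixes F :: "real \<Rightarrow> real"
  assumes F: "mono F" "\<And>z. F z \<ge> 0" and rc: "(F \<longlongrightarrow> F a) (at_right a)" and bot: "(F \<longlongrightarrow> 0) at_bot"
    and sub: "\<And>z s. s \<ge> 0 \<Longrightarrow> ennreal (F z) \<le> (\<integral>\<^sup>+\<omega>. ennreal (F (z + V s \<omega>)) \<partial>M)"
    and fin: "\<And>s. s \<ge> 0 \<Longrightarrow> (\<integral>\<^sup>+\<omega>. ennreal (F (V s \<omega>)) \<partial>M) < \<infinity>"
    and drift: "drifts_to_minus_infinity M V"
    and a: "a > 0"
    and p: "\<And>N n. emeasure M {\<omega>\<in>space M. \<exists>k\<le>Suc n. V (real k * (real N / real (Suc n))) \<omega> \<ge> a} \<le> p"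
    and p1: "p < \<infinity>"
  shows "ennreal (F 0) \<le> ennreal (F a) * p"
proof -
  define F' where "F' z = ennreal (F z)" for z
  have F': "mono F'" unfolding F'_def using F by (auto intro!: monoI ennreal_leI simp: monoD)
  have F'm [measurable]: "F' \<in> borel_measurable borel"
    unfolding F'_def by (intro measurable_compose[OF borel_measurable_mono[OF F(1)]]) measurable
  have [measurable]: "V (real N) \<in> borel_measurable M" for N by (rule V_measurable) simp
  define r where "r N = (\<integral>\<^sup>+\<omega>. indicator {..<a} (V (real N) \<omega>) * F' (V (real N) \<omega>) \<partial>M)" for N
  \<comment> \<open>The mesh tends to 0 with e and N fixed: overshoots disappear almost surely,
    under the integrable bound F' (V N).\<close>
  have 1: "F' 0 \<le> F' (a + e) * p + r N" if e: "e > 0" for e N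
  proof -
    define h where "h n \<omega> = indicator (\<Union>k\<le>Suc n. overshoot a e (real N / real (Suc n)) k) \<omega> * F' (V (real N) \<omega>)" for n \<omega>
    have [measurable]: "h n \<in> borel_measurable M" for n
    proof -
      have "disjoint_family_on (overshoot a e (real N / real (Suc n))) {..Suc n}"
        using disjoint_first_hit[of a "real N / real (Suc n)"] overshoot_subset[OF e, of a "real N / real (Suc n)"]
        unfolding disjoint_family_on_def by blast
      then have "h n = (\<lambda>\<omega>. (\<Sum>k\<le>Suc n. indicator (overshoot a e (real N / real (Suc n)) k) \<omega>) * F' (V (real N) \<omega>))"
        unfolding h_def by (subst indicator_UN_disjoint) auto
      also have "\<dots> \<in> borel_measurable M"
        by (intro borel_measurable_times_ennreal borel_measurable_sum overshoot_measurable) auto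
      finally show ?thesis .
    qed
    have lim: "(\<lambda>n. \<integral>\<^sup>+\<omega>. h n \<omega> \<partial>M) \<longlonglongrightarrow> (\<integral>\<^sup>+\<omega>. 0 \<partial>M)"
    proof (rule nn_integral_dominated_convergence[where w="\<lambda>\<omega>. F' (V (real N) \<omega>)"])
      show "AE \<omega> in M. h n \<omega> \<le> F' (V (real N) \<omega>)" for n
        by (auto simp: h_def indicator_def)
      show "(\<integral>\<^sup>+\<omega>. F' (V (real N) \<omega>) \<partial>M) < \<infinity>" using fin[of "real N"] by (simp add: F'_def)
      show "AE \<omega> in M. (\<lambda>n. h n \<omega>) \<longlonglongrightarrow> 0"
        using overshoot_vanishes[OF a e, of N]
      proof eventually_elim
        case (elim \<omega>)
        then have "\<forall>\<^sub>F n in sequentially. h n \<omega> = 0"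
          by eventually_elim (auto simp: h_def)
        then show ?case by (simp add: tendsto_eventually)
      qed
    qed auto
    have "(\<lambda>n. F' (a + e) * p + (\<integral>\<^sup>+\<omega>. h n \<omega> \<partial>M) + r N) \<longlonglongrightarrow> F' (a + e) * p + (\<integral>\<^sup>+\<omega>. 0 \<partial>M) + r N"
      by (intro tendsto_intros lim)
    then have "(\<lambda>n. F' (a + e) * p + (\<integral>\<^sup>+\<omega>. h n \<omega> \<partial>M) + r N) \<longlonglongrightarrow> F' (a + e) * p + r N" by simp
    then show ?thesis
    proof (rule LIMSEQ_le_const, intro exI allI impI)
      fix n
      show "F' 0 \<le> F' (a + e) * p + (\<integral>\<^sup>+\<omega>. h n \<omega> \<partial>M) + r N"
        unfolding r_def h_def
        by (rule first_passage_grid_bound[OF F' F'm _ a e p]) (use sub in \<open>auto simp: F'_def\<close>)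
    qed
  qed
  \<comment> \<open>N tends to infinity: on V N < a the integrand is at most F' a, and it tends to 0
    because V drifts to -\<infinity>.\<close>
  have "r \<longlonglongrightarrow> (\<integral>\<^sup>+\<omega>. 0 \<partial>M)" unfolding r_def
  proof (rule nn_integral_dominated_convergence[where w="\<lambda>\<omega>. F' a"])
    show "AE \<omega> in M. indicator {..<a} (V (real N) \<omega>) * F' (V (real N) \<omega>) \<le> F' a" for N
      using monoD[OF F'] by (intro AE_I2) (auto simp: indicator_def)
    show "AE \<omega> in M. (\<lambda>N. indicator {..<a} (V (real N) \<omega>) * F' (V (real N) \<omega>)) \<longlonglongrightarrow> 0"
      using drift unfolding drifts_to_minus_infinity_def
    proof eventually_elim
      case (elim \<omega>)
      have "filterlim (\<lambda>N. V (real N) \<omega>) at_bot sequentially"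
        using elim by (rule filterlim_compose) (rule filterlim_real_sequentially)
      then have "((\<lambda>N. F (V (real N) \<omega>)) \<longlongrightarrow> 0) sequentially"
        by (rule filterlim_compose[OF bot])
      then have lim: "((\<lambda>N. F' (V (real N) \<omega>)) \<longlongrightarrow> 0) sequentially"
        unfolding F'_def by (simp add: tendsto_ennrealI flip: ennreal_0)
      show ?case
        by (rule tendsto_sandwich[OF _ _ tendsto_const lim]) (auto simp: indicator_def)
    qed
    show "(\<lambda>\<omega>. indicator {..<a} (V (real N) \<omega>) * F' (V (real N) \<omega>)) \<in> borel_measurable M" for N
      by measurable
  qed (auto simp: F'_def emeasure_space_1)
  then have r0: "r \<longlonglongrightarrow> 0" by simp
  have 2: "F' 0 \<le> F' (a + e) * p" if e: "e > 0" for e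
  proof -
    have "(\<lambda>N. F' (a + e) * p + r N) \<longlonglongrightarrow> F' (a + e) * p + 0" by (intro tendsto_intros r0)
    then show ?thesis using 1[OF e] by (intro LIMSEQ_le_const) auto
  qed
  \<comment> \<open>Finally e tends to 0 by right continuity of F at a; multiplication by p is
    continuous on the extended half-line because p is finite.\<close>
  have "((\<lambda>z. p * F' z) \<longlongrightarrow> p * F' a) (at_right a)"
    unfolding F'_def using p1 by (intro ennreal_tendsto_cmult tendsto_ennrealI rc) auto
  then have "((\<lambda>z. F' z * p) \<longlongrightarrow> F' a * p) (at_right a)" by (simp add: mult.commute)
  then have "F' 0 \<le> F' a * p"
  proof (rule tendsto_lowerbound)
    show "\<forall>\<^sub>F z in at_right a. F' 0 \<le> F' z * p"
      unfolding eventually_at_right_field using 2[of "_ - a"] by (intro exI[of _ "a + 1"]) auto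
  qed simp
  then show ?thesis by (simp add: F'_def)
qed

end

section \<open>Reflection, and processes with monotone paths\<close>

lemma cadlag_uminus: "cadlag f \<Longrightarrow> cadlag (\<lambda>t. - f t)"
  unfolding cadlag_def by (blast intro: continuous_minus tendsto_minus)

lemma levy_process_uminus:
  assumes "levy_process M V"
  shows "levy_process M (\<lambda>t \<omega>. - V t \<omega>)"
proof -
  interpret levy M V by (rule levy.intro) fact
  have "indep_vars (\<lambda>_. borel) (\<lambda>i \<omega>. - V (t (Suc i)) \<omega> - - V (t i) \<omega>) {..<n}"
    if "0 \<le> t 0" "mono t" for t :: "nat \<Rightarrow> real" and n
  proof -
    have "indep_vars (\<lambda>_. borel) (\<lambda>i \<omega>. - (V (t (Suc i)) \<omega> - V (t i) \<omega>)) {..<n}"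
      by (rule indep_vars_compose2[OF increments_indep[OF that], where Y="\<lambda>_. uminus"]) auto
    then show ?thesis by simp
  qed
  moreover have "distr M borel (\<lambda>\<omega>. - V (s + h) \<omega> - - V s \<omega>) = distr M borel (\<lambda>\<omega>. - V h \<omega>)"
    if "s \<ge> 0" "h \<ge> 0" for s h
  proof -
    have [measurable]: "V s \<in> borel_measurable M" "V (s + h) \<in> borel_measurable M" "V h \<in> borel_measurable M"
      using that by (auto intro: V_measurable)
    have "distr (distr M borel (\<lambda>\<omega>. V (s + h) \<omega> - V s \<omega>)) borel uminus = distr (distr M borel (V h)) borel uminus"
      using increments_stationary[OF that] by simp
    then show ?thesis by (simp add: distr_distr o_def)
  qed
  moreover have "cadlag_process M (\<lambda>t \<omega>. - V t \<omega>)"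
    using cadlag_process_V unfolding cadlag_process_def by (auto intro: cadlag_uminus)
  ultimately show ?thesis using V_0 unfolding levy_process_def by auto
qed

lemma cadlag_mono_if_mono_rat:
  assumes f: "cadlag f"
    and mono: "\<And>s t. s \<in> \<rat> \<Longrightarrow> t \<in> \<rat> \<Longrightarrow> 0 \<le> s \<Longrightarrow> s \<le> t \<Longrightarrow> f s \<le> f t"
  shows "mono_on {0..} f"
proof (rule mono_onI)
  fix s t :: real assume st: "s \<in> {0..}" "t \<in> {0..}" "s \<le> t"
  define g where "g n u = real (Suc (nat \<lfloor>real (Suc n) * u\<rfloor>)) / real (Suc n)" for n u
  have lim: "(\<lambda>n. f (g n u)) \<longlonglongrightarrow> f u" if "u \<ge> 0" for u
    unfolding g_def by (rule cadlag_tendsto_right[OF f that grid_approx_right(1)[OF that]])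
      (use grid_approx_right(2)[OF that] less_imp_le in blast)
  have "g n s \<le> g n t" for n
    unfolding g_def using st by (intro divide_right_mono of_nat_mono Suc_leI le_imp_less_Suc nat_mono floor_mono mult_left_mono) auto
  then have "f (g n s) \<le> f (g n t)" for n
    by (intro mono) (auto simp: g_def simp del: of_nat_Suc)
  then show "f s \<le> f t" using lim[of s] lim[of t] st by (intro LIMSEQ_le[OF lim lim]) auto
qed

context levy
begin

lemma AE_increment:
  assumes "s \<ge> 0" "h \<ge> 0" and [measurable]: "Measurable.pred borel P" and "AE \<omega> in M. P (V h \<omega>)"
  shows "AE \<omega> in M. P (V (s + h) \<omega> - V s \<omega>)"
proof -
  have [measurable]: "V s \<in> borel_measurable M" "V (s + h) \<in> borel_measurable M" "V h \<in> borel_measurable M"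
    using assms by (auto intro: V_measurable)
  have "AE v in distr M borel (V h). P v" using assms(4) by (subst AE_distr_iff) auto
  then have "AE v in distr M borel (\<lambda>\<omega>. V (s + h) \<omega> - V s \<omega>). P v"
    unfolding increments_stationary[OF assms(1,2)] .
  then show ?thesis by (subst (asm) AE_distr_iff) auto
qed

text \<open>Increments over countably many rational pairs share one null set; right continuity
  extends monotonicity to real times.\<close>

lemma nondecreasing_if_nonneg:
  assumes "\<And>h. h > 0 \<Longrightarrow> AE \<omega> in M. V h \<omega> \<ge> 0"
  shows "AE \<omega> in M. mono_on {0..} (\<lambda>t. V t \<omega>)"
proof -
  have "AE \<omega> in M. 0 \<le> fst p \<longrightarrow> fst p \<le> snd p \<longrightarrow> V (fst p) \<omega> \<le> V (snd p) \<omega>" for p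
  proof (cases "0 \<le> fst p \<and> fst p < snd p")
    case True
    then have "AE \<omega> in M. V (fst p + (snd p - fst p)) \<omega> - V (fst p) \<omega> \<ge> 0"
      by (intro AE_increment assms) auto
    then show ?thesis by eventually_elim simp
  next
    case False
    then show ?thesis by (cases "fst p = snd p") auto
  qed
  then have "AE \<omega> in M. \<forall>p\<in>\<rat> \<times> \<rat>. 0 \<le> fst p \<longrightarrow> fst p \<le> snd p \<longrightarrow> V (fst p) \<omega> \<le> V (snd p) \<omega>"
    by (subst AE_ball_countable) (auto intro: countable_rat)
  then show ?thesis using AE_space
    by eventually_elim (rule cadlag_mono_if_mono_rat, auto intro: cadlag_V)
qed

end

section \<open>The Laplace exponent and its zero \<kappa>\<close>

locale levy_laplace = spectrally_negative +
  fixes \<Psi> :: "real \<Rightarrow> real"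
  assumes laplace: "laplace_exponent M V \<Psi>"
    and not_neg_subordinator: "\<not> subordinator M (\<lambda>t \<omega>. - V t \<omega>)"
begin

lemma expectation_exp: "t \<ge> 0 \<Longrightarrow> q \<ge> 0 \<Longrightarrow> expectation (\<lambda>\<omega>. exp (q * V t \<omega>)) = exp (t * \<Psi> q)"
  using laplace by (simp add: laplace_exponent_def)

lemma integrable_exp: "t \<ge> 0 \<Longrightarrow> q \<ge> 0 \<Longrightarrow> integrable M (\<lambda>\<omega>. exp (q * V t \<omega>))"
  using expectation_exp[of t q] not_integrable_integral_eq by fastforce

lemma nn_integral_exp:
  assumes "t \<ge> 0" "q \<ge> 0"
  shows "(\<integral>\<^sup>+\<omega>. ennreal (exp (q * (z + V t \<omega>))) \<partial>M) = ennreal (exp (q * z) * exp (t * \<Psi> q))"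
proof -
  have "(\<integral>\<^sup>+\<omega>. ennreal (exp (q * (z + V t \<omega>))) \<partial>M) = (\<integral>\<^sup>+\<omega>. ennreal (exp (q * z)) * ennreal (exp (q * V t \<omega>)) \<partial>M)"
    by (simp add: distrib_left exp_add ennreal_mult)
  also have "\<dots> = ennreal (exp (q * z)) * (\<integral>\<^sup>+\<omega>. ennreal (exp (q * V t \<omega>)) \<partial>M)"
    using integrable_exp[OF assms] by (intro nn_integral_cmult) auto
  also have "(\<integral>\<^sup>+\<omega>. ennreal (exp (q * V t \<omega>)) \<partial>M) = ennreal (exp (t * \<Psi> q))"
    using expectation_exp[OF assms] by (subst nn_integral_eq_integral[OF integrable_exp[OF assms]]) auto
  finally show ?thesis by (simp add: ennreal_mult)
qed

lemma \<Psi>_0: "\<Psi> 0 = 0"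
  using expectation_exp[of 1 0] by (simp add: prob_space)

text \<open>\<Psi> q is the logarithm of E exp (q V 1). For q bounded by B the integrand is at most
  1 + exp (B V 1), the two terms covering the two signs of V 1.\<close>

lemma \<Psi>_continuous: "continuous_on {0..} \<Psi>"
proof -
  define E where "E q = expectation (\<lambda>\<omega>. exp (q * V 1 \<omega>))" for q
  have V1 [measurable]: "V 1 \<in> borel_measurable M" by (rule V_measurable) simp
  have "continuous_on {0..} E"
    unfolding continuous_on_sequentially
  proof (intro ballI allI impI, elim conjE)
    fix u :: "nat \<Rightarrow> real" and q :: real assume q: "q \<in> {0..}" and u: "\<forall>n. u n \<in> {0..}" "u \<longlonglongrightarrow> q"
    obtain B where B: "\<And>n. \<bar>u n\<bar> \<le> B" "B > 0"
      using convergent_imp_Bseq[of u] u(2) by (auto simp: convergent_def Bseq_def)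
    show "(E \<circ> u) \<longlonglongrightarrow> E q"
      unfolding o_def E_def
    proof (rule integral_dominated_convergence[where w="\<lambda>\<omega>. 1 + exp (B * V 1 \<omega>)"])
      show "integrable M (\<lambda>\<omega>. 1 + exp (B * V 1 \<omega>))" using integrable_exp[of 1 B] B by auto
      show "AE \<omega> in M. (\<lambda>n. exp (u n * V 1 \<omega>)) \<longlonglongrightarrow> exp (q * V 1 \<omega>)"
        by (intro AE_I2 tendsto_intros u)
      show "AE \<omega> in M. norm (exp (u n * V 1 \<omega>)) \<le> 1 + exp (B * V 1 \<omega>)" for n
      proof (intro AE_I2)
        fix \<omega>
        have "u n \<ge> 0" "u n \<le> B" using u B(1)[of n] by auto
        then show "norm (exp (u n * V 1 \<omega>)) \<le> 1 + exp (B * V 1 \<omega>)"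
          by (cases "V 1 \<omega> \<ge> 0") (auto intro: add_increasing add_increasing2 mult_right_mono simp: mult_nonneg_nonpos)
      qed
    qed auto
  qed
  then have "continuous_on {0..} (\<lambda>q. ln (E q))"
    by (intro continuous_intros) (auto simp: E_def expectation_exp)
  then show ?thesis
    by (rule continuous_on_cong[THEN iffD1, rotated 2]) (auto simp: E_def expectation_exp)
qed

text \<open>If V were almost surely nonpositive at every positive time, -V would have nonnegative
  increments and be a subordinator.\<close>

lemma prob_pos_value: "\<exists>t>0. \<not> (AE \<omega> in M. V t \<omega> \<le> 0)"
proof (rule ccontr)
  assume "\<not> ?thesis"
  then have h: "\<And>h. h > 0 \<Longrightarrow> AE \<omega> in M. 0 \<le> - V h \<omega>" by auto
  interpret m: levy M "\<lambda>t \<omega>. - V t \<omega>" by (rule levy.intro levy_process_uminus levy)+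
  have "subordinator M (\<lambda>t \<omega>. - V t \<omega>)"
    unfolding subordinator_def using m.nondecreasing_if_nonneg[OF h] m.levy by auto
  then show False using not_neg_subordinator by simp
qed

text \<open>V t is at least some e > 0 with positive probability \<pi>, so E exp (q V t) is at least
  \<pi> exp (q e), which exceeds 1 for large q.\<close>

lemma \<Psi>_pos_eventually: "\<forall>\<^sub>F q in at_top. \<Psi> q > 0"
proof -
  obtain t where t: "t > 0" "\<not> (AE \<omega> in M. V t \<omega> \<le> 0)" using prob_pos_value by blast
  have [measurable]: "V t \<in> borel_measurable M" using t by (intro V_measurable) simp
  have "\<exists>e>0. \<not> (AE \<omega> in M. V t \<omega> < e)"
  proof (rule ccontr)
    assume "\<not> ?thesis"
    then have "AE \<omega> in M. \<forall>n. V t \<omega> < inverse (real (Suc n))"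
      by (subst AE_all_countable) auto
    then have "AE \<omega> in M. V t \<omega> \<le> 0"
    proof eventually_elim
      case (elim \<omega>)
      then show ?case using LIMSEQ_inverse_real_of_nat by (intro LIMSEQ_le_const) (auto intro: less_imp_le)
    qed
    then show False using t by simp
  qed
  then obtain e where e: "e > 0" "\<not> (AE \<omega> in M. V t \<omega> < e)" by blast
  define \<pi> where "\<pi> = prob {\<omega> \<in> space M. V t \<omega> \<ge> e}"
  have "\<pi> \<noteq> 0"
  proof
    assume "\<pi> = 0"
    then have "{\<omega> \<in> space M. V t \<omega> \<ge> e} \<in> null_sets M" by (auto simp: \<pi>_def null_sets_def emeasure_eq_measure)
    then show False using e by (auto simp: AE_iff_null not_less)
  qed
  then have \<pi>: "\<pi> > 0" by (simp add: \<pi>_def less_le measure_nonneg)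
  have "(LIM q at_top. exp (q * e) * \<pi> :> at_top)"
    using e \<pi> by (intro filterlim_at_top_mult_tendsto_pos[OF tendsto_const \<pi>] filterlim_compose[OF exp_at_top]
      filterlim_at_top_mult_tendsto_pos[OF tendsto_const e(1)] filterlim_ident)
  then have "\<forall>\<^sub>F q in at_top. exp (q * e) * \<pi> > 1" by (simp add: filterlim_at_top_dense)
  then show ?thesis using eventually_ge_at_top[of 0]
  proof eventually_elim
    case (elim q)
    have "exp (q * e) * \<pi> = expectation (\<lambda>\<omega>. exp (q * e) * indicator {\<omega> \<in> space M. V t \<omega> \<ge> e} \<omega>)"
      by (simp add: \<pi>_def)
    also have "\<dots> \<le> expectation (\<lambda>\<omega>. exp (q * V t \<omega>))"
      using elim t integrable_exp[of t q]
      by (intro integral_mono integrable_mult_right integrable_real_indicator) (auto simp: indicator_def mult_left_mono emeasure_eq_measure)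
    also have "\<dots> = exp (t * \<Psi> q)" using elim t by (intro expectation_exp) auto
    finally have "1 < exp (t * \<Psi> q)" using elim(1) by linarith
    then have "0 < t * \<Psi> q" by simp
    then show ?case using t by (simp add: zero_less_mult_iff)
  qed
qed

text \<open>If \<Psi> were nonnegative on the positive axis, exp (q V) would be a submartingale for
  every q > 0, and first passage would give 1 \<le> exp (q a) P(V reaches a). As q tends to 0, V
  would reach every level almost surely, contrary to the drift.\<close>

lemma drift_neg_exponent:
  assumes drift: "drifts_to_minus_infinity M V"
  shows "\<exists>q>0. \<Psi> q < 0"
proof (rule ccontr)
  assume "\<not> ?thesis"
  then have \<Psi>: "\<And>q. q > 0 \<Longrightarrow> \<Psi> q \<ge> 0" by (metis not_less)
  have *: "AE \<omega> in M. \<exists>r\<in>\<rat> \<inter> {0..}. V r \<omega> \<ge> a" if a: "a > 0" for a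
  proof -
    \<comment> \<open>Rational times keep A measurable, and all grid times k N / (n + 1) are
      rational.\<close>
    define A where "A = {\<omega>\<in>space M. \<exists>r\<in>\<rat> \<inter> {0..}. V r \<omega> \<ge> a}"
    have A [measurable]: "A \<in> sets M"
      unfolding A_def
    proof (rule sets.sets_Collect_countable_Ex')
      show "countable (\<rat> \<inter> {0..} :: real set)" by (intro countable_Int1 countable_rat)
      fix r :: real assume "r \<in> \<rat> \<inter> {0..}"
      then have [measurable]: "V r \<in> borel_measurable M" by (intro V_measurable) auto
      show "{\<omega> \<in> space M. V r \<omega> \<ge> a} \<in> sets M" by measurable
    qed
    have "1 \<le> exp (q * a) * prob A" if q: "q > 0" for q
    proof -
      have "ennreal (exp (q * 0)) \<le> ennreal (exp (q * a)) * emeasure M A"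
      proof (rule first_passage_bound[OF _ _ _ _ _ _ drift a, where F="\<lambda>z. exp (q * z)"])
        show "mono (\<lambda>z. exp (q * z))" using q by (auto intro!: monoI)
        show "((\<lambda>z. exp (q * z)) \<longlongrightarrow> 0) at_bot"
          using q by (intro filterlim_compose[OF exp_at_bot] filterlim_tendsto_pos_mult_at_bot[OF tendsto_const q] filterlim_ident)
        show "ennreal (exp (q * z)) \<le> (\<integral>\<^sup>+\<omega>. ennreal (exp (q * (z + V s \<omega>))) \<partial>M)" if "s \<ge> 0" for z s
          using \<Psi>[OF q] q that by (subst nn_integral_exp) (auto intro!: ennreal_leI)
        show "(\<integral>\<^sup>+\<omega>. ennreal (exp (q * V s \<omega>)) \<partial>M) < \<infinity>" if "s \<ge> 0" for s
          using nn_integral_exp[of s q 0] that q by simp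
        show "emeasure M {\<omega> \<in> space M. \<exists>k\<le>Suc n. a \<le> V (real k * (real N / real (Suc n))) \<omega>} \<le> emeasure M A" for N n
          by (intro emeasure_mono A) (force simp: A_def)
      qed (auto intro!: tendsto_intros simp: emeasure_eq_measure)
      then have "ennreal 1 \<le> ennreal (exp (q * a) * prob A)"
        by (simp add: emeasure_eq_measure ennreal_mult)
      then show ?thesis by (simp add: ennreal_le_iff del: ennreal_1)
    qed
    then have "\<forall>\<^sub>F q in at_right 0. 1 \<le> exp (q * a) * prob A"
      unfolding eventually_at_right_field by (intro exI[of _ 1]) auto
    moreover have "((\<lambda>q. exp (q * a) * prob A) \<longlongrightarrow> exp (0 * a) * prob A) (at_right 0)"
      by (intro tendsto_intros)
    ultimately have "1 \<le> exp (0 * a) * prob A"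
      by (intro tendsto_lowerbound[of _ _ "at_right 0"]) auto
    then have "prob A = 1" using prob_le_1[of A] by simp
    then have "AE \<omega> in M. \<omega> \<in> A" by (simp add: prob_eq_1)
    then show ?thesis by eventually_elim (simp add: A_def)
  qed
  have "AE \<omega> in M. \<forall>n. \<exists>r\<in>\<rat> \<inter> {0..}. V r \<omega> \<ge> real (Suc n)"
    by (subst AE_all_countable) (auto intro: *)
  then have "AE \<omega> in M. False"
    using drift[unfolded drifts_to_minus_infinity_def] AE_space
  proof eventually_elim
    case (elim \<omega>)
    have "\<forall>\<^sub>F t in at_top. V t \<omega> \<le> 0" using elim(2) by (simp add: filterlim_at_bot)
    then obtain T where T: "\<And>t. t \<ge> T \<Longrightarrow> V t \<omega> \<le> 0" by (auto simp: eventually_at_top_linorder)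
    obtain B where B: "\<And>s. 0 \<le> s \<Longrightarrow> s \<le> T \<Longrightarrow> \<bar>V s \<omega>\<bar> \<le> B" using cadlag_bounded[OF cadlag_V[OF elim(3)]] by blast
    obtain n where n: "real n > B" using reals_Archimedean2 by blast
    obtain r where r: "r \<ge> 0" "V r \<omega> \<ge> real (Suc n)" using elim(1) by auto
    show False
    proof (cases "r \<le> T")
      case True
      then show False using B[of r] r n by auto
    next
      case False
      then show False using T[of r] r by auto
    qed
  qed
  then show False by simp
qed

text \<open>A negative value and eventual positivity give a zero by continuity, and the zeros in [0,
  \<infinity>[ form a closed set, so their infimum is again a zero. Consequently exp (\<kappa> V) is
  a martingale.\<close>

lemma kappa_nonneg_zero: "kappa M V \<Psi> \<ge> 0 \<and> \<Psi> (kappa M V \<Psi>) = 0"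
proof (cases "drifts_to_minus_infinity M V")
  case False
  then show ?thesis by (simp add: kappa_def \<Psi>_0)
next
  case True
  define S where "S = {q. q > 0 \<and> \<Psi> q = 0}"
  obtain q1 where q1: "q1 > 0" "\<Psi> q1 < 0" using drift_neg_exponent[OF True] by blast
  have "\<forall>\<^sub>F q in at_top. \<Psi> q > 0 \<and> q \<ge> q1"
    by (intro eventually_conj \<Psi>_pos_eventually eventually_ge_at_top)
  then obtain q2 where q2: "\<Psi> q2 > 0" "q2 \<ge> q1"
    by (auto dest: eventually_happens)
  have "continuous_on {q1..q2} \<Psi>" using q1 by (intro continuous_on_subset[OF \<Psi>_continuous]) auto
  then obtain q where q: "q \<ge> q1" "\<Psi> q = 0" using IVT'[of \<Psi> q1 0 q2] q1 q2 by auto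
  have "q \<in> S" using q q1 by (simp add: S_def)
  then have S: "S \<noteq> {}" "bdd_below S" by (auto simp: S_def intro: bdd_belowI[of _ 0])
  have "closed {q \<in> {0..}. \<Psi> q \<in> {0}}"
    using continuous_closed_preimage[OF \<Psi>_continuous closed_atLeast, of "{0}"] by (simp add: vimage_def Int_def)
  then have "closure S \<subseteq> {q \<in> {0..}. \<Psi> q \<in> {0}}" by (rule closure_minimal[rotated]) (auto simp: S_def)
  moreover have "Inf S \<in> closure S" by (rule closure_contains_Inf[OF S])
  ultimately show ?thesis using True by (auto simp: kappa_def S_def)
qed

lemmas kappa_nonneg = kappa_nonneg_zero[THEN conjunct1]

text \<open>Doob's maximal inequality for the martingale exp (\<kappa> V): at the first grid time
  above a it is at least exp (\<kappa> a). The bound is the same for all grids, as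
  \<open>first_passage_bound\<close> requires of p.\<close>

lemma grid_max_tail:
  assumes a: "a > 0"
  shows "emeasure M {\<omega>\<in>space M. \<exists>k\<le>Suc n. V (real k * (real N / real (Suc n))) \<omega> \<ge> a} \<le> ennreal (exp (- kappa M V \<Psi> * a))"
proof -
  define \<delta> where "\<delta> = real N / real (Suc n)"
  have \<delta>: "\<delta> \<ge> 0" by (simp add: \<delta>_def)
  define c where "c = kappa M V \<Psi>"
  have c: "c \<ge> 0" "\<Psi> c = 0" using kappa_nonneg_zero by (auto simp: c_def)
  define F where "F z = ennreal (exp (c * z))" for z
  have F [measurable]: "F \<in> borel_measurable borel" unfolding F_def by measurable
  have [measurable]: "indicator (first_hit a \<delta> k) \<in> borel_measurable M" for k by (rule first_hit_measurable[OF \<delta>])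
  have [measurable]: "V (real k * \<delta>) \<in> borel_measurable M" for k by (rule V_measurable) (simp add: \<delta>)
  have [measurable]: "first_hit a \<delta> k \<inter> space M \<in> sets M" for k
  proof -
    have "{\<omega> \<in> space M. (indicator (first_hit a \<delta> k) \<omega> :: ennreal) = 1} \<in> sets M" by measurable
    also have "{\<omega> \<in> space M. (indicator (first_hit a \<delta> k) \<omega> :: ennreal) = 1} = first_hit a \<delta> k \<inter> space M"
      by (auto simp: indicator_def split: if_splits)
    finally show ?thesis .
  qed
  let ?A = "{\<omega>\<in>space M. \<exists>k\<le>Suc n. V (real k * \<delta>) \<omega> \<ge> a}"
  have sub: "?A \<subseteq> (\<Union>k\<le>Suc n. first_hit a \<delta> k \<inter> space M)"
  proof
    fix \<omega> assume w: "\<omega> \<in> ?A"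
    define k where "k = (LEAST k. V (real k * \<delta>) \<omega> \<ge> a)"
    obtain k' where k': "k' \<le> Suc n" "V (real k' * \<delta>) \<omega> \<ge> a" using w by auto
    have "V (real k * \<delta>) \<omega> \<ge> a" unfolding k_def by (rule LeastI[of _ k']) (rule k')
    moreover have "V (real j * \<delta>) \<omega> < a" if "j < k" for j
      using not_less_Least[OF that[unfolded k_def]] by simp
    moreover have "k \<le> k'" unfolding k_def by (rule Least_le) (rule k')
    ultimately have "\<omega> \<in> first_hit a \<delta> k" "k \<le> Suc n"
      using k' by (auto simp: first_hit_def le_less)
    then show "\<omega> \<in> (\<Union>k\<le>Suc n. first_hit a \<delta> k \<inter> space M)" using w by blast
  qed
  have "ennreal (exp (c * a)) * emeasure M ?A \<le> ennreal (exp (c * a)) * (\<Sum>k\<le>Suc n. emeasure M (first_hit a \<delta> k \<inter> space M))"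
    by (intro mult_left_mono order_trans[OF emeasure_mono[OF sub]] emeasure_subadditive_finite sets.finite_UN) auto
  also have "\<dots> = (\<Sum>k\<le>Suc n. \<integral>\<^sup>+\<omega>. ennreal (exp (c * a)) * indicator (first_hit a \<delta> k \<inter> space M) \<omega> \<partial>M)"
    by (simp add: sum_distrib_left nn_integral_cmult_indicator del: sum.atMost_Suc)
  also have "\<dots> \<le> (\<Sum>k\<le>Suc n. \<integral>\<^sup>+\<omega>. indicator (first_hit a \<delta> k) \<omega> * F (V (real k * \<delta>) \<omega>) \<partial>M)"
    using c by (intro sum_mono nn_integral_mono)
      (auto simp: indicator_def F_def first_hit_def intro!: ennreal_leI mult_left_mono split: if_splits)
  also have "\<dots> \<le> (\<Sum>k\<le>Suc n. \<integral>\<^sup>+\<omega>. indicator (first_hit a \<delta> k) \<omega> * F (V (real k * \<delta>) \<omega>) \<partial>M) +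
      (\<integral>\<^sup>+\<omega>. indicator (no_hit a \<delta> (Suc n)) \<omega> * F (V (real (Suc n) * \<delta>) \<omega>) \<partial>M)" by simp
  also have "\<dots> \<le> F 0"
    by (rule supermartingale_first_hit[OF _ F \<delta>]) (use c in \<open>auto simp: F_def nn_integral_exp\<close>)
  finally have "ennreal (exp (c * a)) * emeasure M ?A \<le> 1" by (simp add: F_def)
  then have "ennreal (exp (- c * a)) * (ennreal (exp (c * a)) * emeasure M ?A) \<le> ennreal (exp (- c * a)) * 1"
    by (rule mult_left_mono) simp
  then show ?thesis
    by (simp add: \<delta>_def c_def mult.assoc[symmetric] ennreal_mult[symmetric] exp_add[symmetric])
qed

end

section \<open>The scale function\<close>

text \<open>\<open>conservative\<close> will come from the Feller semigroup, which has mass one and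
  equals \<open>p_up\<close> at positive points. It is the source of positivity and harmonicity of
  W.\<close>

locale levy_scale = levy_laplace +
  fixes W :: "real \<Rightarrow> real"
  assumes scale: "scale_function M V \<Psi> W"
    and conservative: "\<And>t x. t \<ge> 0 \<Longrightarrow> x > 0 \<Longrightarrow> prob_space (p_up M V W t x)"
begin

abbreviation \<kappa> :: real where "\<kappa> \<equiv> kappa M V \<Psi>"

text \<open>The value at the origin is 0 even where W 0 is positive. This matches killing as soon as
  the infimum fails to be positive, and makes \<open>Wp\<close> positive exactly on ]0,
  \<infinity>[.\<close>

definition Wp :: "real \<Rightarrow> real" where "Wp z = (if z > 0 then W z else 0)"

lemma R_measurable: "t \<ge> 0 \<Longrightarrow> R t \<in> borel_measurable M"
  using measurable_compose[OF measurable_Pair1' run_inf_measurable_pair[OF cadlag_process_V], of t] 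
  by simp

lemma R_le: "\<omega> \<in> space M \<Longrightarrow> 0 \<le> s \<Longrightarrow> s \<le> t \<Longrightarrow> R t \<omega> \<le> V s \<omega>"
  by (rule run_inf_le[OF cadlag_V])

lemma W_continuous: "continuous_on {0..} W" and W_mono: "mono_on {0..} W"
  using scale by (simp_all add: scale_function_def)

lemma W_laplace: "q > \<kappa> \<Longrightarrow> set_integrable lborel {0..} (\<lambda>x. exp (- q * x) * W x)"
    "q > \<kappa> \<Longrightarrow> (LINT x:{0..}|lborel. exp (- q * x) * W x) = 1 / \<Psi> q"
  using scale by (auto simp: scale_function_def)

text \<open>Division by 0 yields 0, so W x = 0 would make \<open>p_up\<close> the null measure
  instead of a probability.\<close>

lemma W_nonzero:
  assumes "x > 0" shows "W x \<noteq> 0"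
proof
  assume "W x = 0"
  then have "emeasure (p_up M V W 1 x) (space (p_up M V W 1 x)) = 0"
    by (simp add: p_up_def emeasure_density)
  moreover have "prob_space (p_up M V W 1 x)" using assms by (intro conservative) auto
  ultimately show False using prob_space.emeasure_space_1 by fastforce
qed

text \<open>Continuity without zeros leaves W one sign on ]0, \<infinity>[. A negative sign would
  make its Laplace transform nonpositive, whereas 1 / \<Psi> q is positive for large q.\<close>

lemma W_pos:
  assumes "x > 0" shows "W x > 0"
proof (rule ccontr)
  assume "\<not> W x > 0"
  then have neg: "W x < 0" using W_nonzero[OF assms] by simp
  have neg': "W y < 0" if y: "y > 0" for y
  proof (rule ccontr)
    assume "\<not> W y < 0"
    then have y0: "0 \<le> W y" by simp
    have "x \<le> y" using y0 neg mono_onD[OF W_mono, of y x] assms y by force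
    moreover have "continuous_on {x..y} W" using assms by (intro continuous_on_subset[OF W_continuous]) auto
    ultimately obtain z where "x \<le> z" "W z = 0" using IVT'[of W x 0 y] neg y0 by auto
    then show False using W_nonzero[of z] assms by auto
  qed
  have "W y \<le> 0" if "y \<ge> 0" for y
    using neg'[of "y + 1"] mono_onD[OF W_mono, of y "y + 1"] that by auto
  then have le: "(LINT x:{0..}|lborel. exp (- q * x) * W x) \<le> 0" for q
  proof -
    have "0 \<le> (\<integral>x. - (indicator {0..} x *\<^sub>R (exp (- q * x) * W x)) \<partial>lborel)"
      using \<open>\<And>y. y \<ge> 0 \<Longrightarrow> W y \<le> 0\<close>
      by (intro Bochner_Integration.integral_nonneg) (auto simp: indicator_def mult_nonneg_nonpos)
    then show ?thesis by (simp add: set_lebesgue_integral_def)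
  qed
  have "\<forall>\<^sub>F q in at_top. \<Psi> q > 0 \<and> q > \<kappa>"
    by (intro eventually_conj \<Psi>_pos_eventually eventually_gt_at_top)
  then obtain q where q: "\<Psi> q > 0" "q > \<kappa>" by (auto dest: eventually_happens)
  have "1 / \<Psi> q \<le> 0" using W_laplace(2)[OF q(2)] le[of q] by simp
  then show False using q by (simp add: divide_le_0_iff)
qed

lemma Wp_nonneg: "Wp z \<ge> 0"
  using W_pos[of z] by (simp add: Wp_def less_imp_le)

lemma Wp_pos: "z > 0 \<Longrightarrow> Wp z = W z"
  by (simp add: Wp_def)

lemma Wp_mono: "mono Wp"
proof (rule monoI)
  fix x y :: real assume "x \<le> y"
  then show "Wp x \<le> Wp y"
    using mono_onD[OF W_mono, of x y] Wp_nonneg[of y] by (auto simp: Wp_def)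
qed

lemma Wp_measurable [measurable]: "Wp \<in> borel_measurable borel"
  by (rule borel_measurable_mono[OF Wp_mono])

text \<open>On [0, \<infinity>[ the functions W and \<open>Wp\<close> differ at most at 0.
  Positivity of \<Psi> beyond \<kappa> is then read off: the transform of a function that is
  positive on ]0, \<infinity>[ cannot vanish.\<close>

lemma nn_integral_Wp_laplace:
  assumes q: "q > \<kappa>"
  shows "(\<integral>\<^sup>+y. ennreal (exp (- q * y) * Wp y) \<partial>lborel) = ennreal (1 / \<Psi> q)" and \<Psi>_pos: "\<Psi> q > 0"
proof -
  have ae: "AE y in lborel. indicator {0..} y *\<^sub>R (exp (- q * y) * W y) = exp (- q * y) * Wp y"
    using AE_lborel_singleton[of 0] by eventually_elim (auto simp: indicator_def Wp_def)
  have "integrable lborel (\<lambda>y. indicator {0..} y *\<^sub>R (exp (- q * y) * W y))"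
    using W_laplace(1)[OF q] by (simp add: set_integrable_def)
  then have int: "integrable lborel (\<lambda>y. exp (- q * y) * Wp y)"
    by (rule integrable_cong_AE_imp) (use ae in \<open>auto elim: eventually_mono\<close>)
  have "1 / \<Psi> q = (\<integral>y. exp (- q * y) * Wp y \<partial>lborel)"
    unfolding W_laplace(2)[OF q, symmetric] set_lebesgue_integral_def
    using W_laplace(1)[OF q] by (intro integral_cong_AE ae) (auto simp: set_integrable_def)
  then show eq: "(\<integral>\<^sup>+y. ennreal (exp (- q * y) * Wp y) \<partial>lborel) = ennreal (1 / \<Psi> q)"
    using nn_integral_eq_integral[OF int] Wp_nonneg by simp
  show "\<Psi> q > 0"
  proof (rule ccontr)
    assume "\<not> ?thesis"
    \<comment> \<open>\<open>ennreal\<close> sends negative numbers to 0 and 1 / 0 is 0, so \<Psi> q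
      < 0 and \<Psi> q = 0 are covered alike.\<close>
    then have "ennreal (1 / \<Psi> q) = 0" by (simp add: ennreal_eq_0_iff divide_nonneg_nonpos)
    then have "AE y in lborel. ennreal (exp (- q * y) * Wp y) = 0"
      unfolding eq[symmetric] by (subst (asm) nn_integral_0_iff_AE) auto
    then have "AE y in lborel. y \<le> (0::real)"
    proof eventually_elim
      case (elim y)
      then show ?case using W_pos[of y] by (cases "y > 0") (auto simp: ennreal_eq_0_iff Wp_pos mult_le_0_iff)
    qed
    then have "emeasure lborel {y \<in> space lborel. \<not> y \<le> (0::real)} = 0"
      by (subst (asm) AE_iff_measurable[OF _ refl]) auto
    moreover have "emeasure lborel {0<..<1::real} \<le> emeasure lborel {y \<in> space lborel. \<not> y \<le> (0::real)}"
      by (rule emeasure_mono) auto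
    ultimately show False by simp
  qed
qed

definition C :: real where "C = 1 / \<Psi> (\<kappa> + 1)"

lemma C_pos: "C > 0"
  using \<Psi>_pos[of "\<kappa> + 1"] by (simp add: C_def)

text \<open>A nondecreasing function with finite Laplace transform at \<beta> grows at most like exp
  (\<beta> z), since on [z, z + 1] the integrand is at least exp (- \<beta> (z + 1)) W z. The bound
  serves to integrate Wp (z + V s).\<close>

lemma Wp_exp_bound: "\<exists>c\<ge>0. \<forall>z. Wp z \<le> c * exp ((\<kappa> + 1) * z)"
proof -
  define \<beta> where "\<beta> = \<kappa> + 1"
  have \<beta>: "\<beta> > 0" using kappa_nonneg by (simp add: \<beta>_def)
  have "Wp z \<le> (C * exp \<beta>) * exp (\<beta> * z)" for z
  proof (cases "z > 0")
    case True
    have "ennreal (exp (- \<beta> * (z + 1)) * W z) = (\<integral>\<^sup>+y. ennreal (exp (- \<beta> * (z + 1)) * W z) * indicator {z..z+1} y \<partial>lborel)"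
      by (subst nn_integral_cmult_indicator) auto
    also have "\<dots> \<le> (\<integral>\<^sup>+y. ennreal (exp (- \<beta> * y) * Wp y) \<partial>lborel)"
    proof (intro nn_integral_mono)
      fix y
      show "ennreal (exp (- \<beta> * (z + 1)) * W z) * indicator {z..z + 1} y \<le> ennreal (exp (- \<beta> * y) * Wp y)"
      proof (cases "y \<in> {z..z+1}")
        case y: True
        then have "exp (- \<beta> * (z + 1)) \<le> exp (- \<beta> * y)" "Wp z \<le> Wp y" using \<beta> monoD[OF Wp_mono] by auto
        then have "exp (- \<beta> * (z + 1)) * Wp z \<le> exp (- \<beta> * y) * Wp y"
          using Wp_nonneg by (intro mult_mono) auto
        then show ?thesis using y True by (simp add: Wp_pos ennreal_leI)
      qed simp
    qed
    also have "\<dots> = ennreal C" unfolding C_def using nn_integral_Wp_laplace[of \<beta>] by (simp add: \<beta>_def)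
    finally have "exp (- \<beta> * (z + 1)) * W z \<le> C" using C_pos by (subst (asm) ennreal_le_iff) auto
    then have "exp (\<beta> * (z + 1)) * (exp (- \<beta> * (z + 1)) * W z) \<le> exp (\<beta> * (z + 1)) * C"
      by (rule mult_left_mono) simp
    then have "(exp (\<beta> * (z + 1)) * exp (- \<beta> * (z + 1))) * W z \<le> exp (\<beta> * (z + 1)) * C"
      by (simp only: mult.assoc)
    then have "W z \<le> exp (\<beta> * (z + 1)) * C" by (simp add: exp_add[symmetric])
    then show ?thesis using True by (simp add: Wp_pos exp_add distrib_left mult_ac)
  next
    case False
    then show ?thesis using C_pos by (simp add: Wp_def)
  qed
  then show ?thesis unfolding \<beta>_def using C_pos by (intro exI[of _ "C * exp (\<kappa> + 1)"]) auto
qed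

lemma Wp_integral_finite:
  assumes "s \<ge> 0" shows "(\<integral>\<^sup>+\<omega>. ennreal (Wp (z + V s \<omega>)) \<partial>M) < \<infinity>"
proof -
  obtain c where c: "c \<ge> 0" "\<And>z. Wp z \<le> c * exp ((\<kappa> + 1) * z)" using Wp_exp_bound by blast
  have [measurable]: "V s \<in> borel_measurable M" using assms by (rule V_measurable)
  have k: "\<kappa> + 1 \<ge> 0" using kappa_nonneg by simp
  have "(\<integral>\<^sup>+\<omega>. ennreal (Wp (z + V s \<omega>)) \<partial>M) \<le> (\<integral>\<^sup>+\<omega>. ennreal c * ennreal (exp ((\<kappa> + 1) * (z + V s \<omega>))) \<partial>M)"
    using c by (intro nn_integral_mono) (auto simp: ennreal_mult[symmetric] intro!: ennreal_leI)
  also have "\<dots> = ennreal c * ennreal (exp ((\<kappa> + 1) * z) * exp (s * \<Psi> (\<kappa> + 1)))"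
    by (subst nn_integral_cmult) (auto simp: nn_integral_exp[OF assms k])
  also have "\<dots> < \<infinity>" by (simp add: ennreal_mult_less_top)
  finally show ?thesis .
qed

text \<open>Doob's h-transform as an expectation over V: \<open>Wp\<close> absorbs the indicator in
  the density, and the killing event is expressed by the running infimum R.\<close>

lemma nn_integral_p_up:
  assumes t: "t \<ge> 0" and h [measurable]: "h \<in> borel_measurable borel"
  shows "(\<integral>\<^sup>+y. h y \<partial>p_up M V W t x) =
    (\<integral>\<^sup>+\<omega>. indicator {0<..} (x + R t \<omega>) * (ennreal (Wp (x + V t \<omega>) / W x) * h (x + V t \<omega>)) \<partial>M)"
proof -
  have [measurable]: "V t \<in> borel_measurable M" "R t \<in> borel_measurable M"
    using t by (auto intro: V_measurable R_measurable)
  let ?A = "{\<omega> \<in> space M. (INF s\<in>{0..t}. x + V s \<omega>) > 0}"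
  have A: "?A = {\<omega> \<in> space M. x + R t \<omega> > 0}"
    using run_inf_add[OF cadlag_V t] by auto
  have "(\<lambda>y. ennreal (W y / W x) * indicator {0<..} y) = (\<lambda>y. ennreal (Wp y / W x))"
    by (auto simp: Wp_def indicator_def)
  then have "(\<integral>\<^sup>+y. h y \<partial>p_up M V W t x) = (\<integral>\<^sup>+y. ennreal (Wp y / W x) * h y \<partial>killed_law M V t x)"
    unfolding p_up_def by (simp only:) (rule nn_integral_density, auto simp: killed_law_def)
  also have "\<dots> = (\<integral>\<^sup>+\<omega>. ennreal (Wp (x + V t \<omega>) / W x) * h (x + V t \<omega>) \<partial>density M (indicator ?A))"
    unfolding killed_law_def by (rule nn_integral_distr) auto
  also have "\<dots> = (\<integral>\<^sup>+\<omega>. indicator ?A \<omega> * (ennreal (Wp (x + V t \<omega>) / W x) * h (x + V t \<omega>)) \<partial>M)"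
    unfolding A by (subst nn_integral_density) auto
  also have "\<dots> = (\<integral>\<^sup>+\<omega>. indicator {0<..} (x + R t \<omega>) * (ennreal (Wp (x + V t \<omega>) / W x) * h (x + V t \<omega>)) \<partial>M)"
    unfolding A by (intro nn_integral_cong) (auto simp: indicator_def)
  finally show ?thesis .
qed

lemma Wp_harmonic:
  assumes t: "t \<ge> 0" and x: "x > 0"
  shows "(\<integral>\<^sup>+\<omega>. indicator {0<..} (x + R t \<omega>) * ennreal (Wp (x + V t \<omega>)) \<partial>M) = ennreal (W x)"
proof -
  have [measurable]: "V t \<in> borel_measurable M" "R t \<in> borel_measurable M"
    using t by (auto intro: V_measurable R_measurable)
  interpret p: prob_space "p_up M V W t x" by (rule conservative[OF t x])
  have "1 = (\<integral>\<^sup>+y. 1 \<partial>p_up M V W t x)" using p.emeasure_space_1 by simp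
  also have "\<dots> = (\<integral>\<^sup>+\<omega>. indicator {0<..} (x + R t \<omega>) * ennreal (Wp (x + V t \<omega>) / W x) \<partial>M)"
    by (subst nn_integral_p_up[OF t]) auto
  also have "\<dots> = (\<integral>\<^sup>+\<omega>. (indicator {0<..} (x + R t \<omega>) * ennreal (Wp (x + V t \<omega>))) / ennreal (W x) \<partial>M)"
    using W_pos[OF x] Wp_nonneg by (simp add: divide_ennreal[symmetric] ennreal_times_divide)
  also have "\<dots> = (\<integral>\<^sup>+\<omega>. indicator {0<..} (x + R t \<omega>) * ennreal (Wp (x + V t \<omega>)) \<partial>M) / ennreal (W x)"
    by (rule nn_integral_divide) measurable
  finally have 1: "1 = (\<integral>\<^sup>+\<omega>. indicator {0<..} (x + R t \<omega>) * ennreal (Wp (x + V t \<omega>)) \<partial>M) / ennreal (W x)" .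
  have "I = ennreal (W x)" if "1 = I / ennreal (W x)" for I
  proof -
    have "I = (I * ennreal (W x)) / ennreal (W x)"
      using W_pos[OF x] by (intro ennreal_mult_divide_eq[symmetric]) (auto simp: ennreal_eq_0_iff)
    also have "\<dots> = ennreal (W x) * (I / ennreal (W x))" by (simp add: ennreal_times_divide mult.commute)
    finally show ?thesis using that by simp
  qed
  from this[OF 1] show ?thesis .
qed

text \<open>Harmonicity with the killing indicator dropped; for z \<le> 0 the left side is
  0.\<close>

lemma Wp_submartingale:
  assumes s: "s \<ge> 0" shows "ennreal (Wp z) \<le> (\<integral>\<^sup>+\<omega>. ennreal (Wp (z + V s \<omega>)) \<partial>M)"
proof (cases "z > 0")
  case True
  have "ennreal (Wp z) = (\<integral>\<^sup>+\<omega>. indicator {0<..} (z + R s \<omega>) * ennreal (Wp (z + V s \<omega>)) \<partial>M)"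
    using Wp_harmonic[OF s True] True by (simp add: Wp_pos)
  also have "\<dots> \<le> (\<integral>\<^sup>+\<omega>. ennreal (Wp (z + V s \<omega>)) \<partial>M)"
    by (intro nn_integral_mono) (auto simp: indicator_def)
  finally show ?thesis .
qed (simp add: Wp_def)

lemma Wp_growth:
  assumes xy: "0 < x" "x \<le> y"
  shows "Wp x \<le> exp (- \<kappa> * (y - x)) * Wp y"
\<comment> \<open>Outside the drifting case \<kappa> is 0 and monotonicity of W suffices; x = y is
  set apart because first passage requires a positive distance.\<close>
proof (cases "drifts_to_minus_infinity M V \<and> x < y")
  case False
  then show ?thesis using monoD[OF Wp_mono xy(2)] xy by (auto simp: kappa_def)
next
  case True
  then have a: "y - x > 0" by simp
  \<comment> \<open>First passage over y - x for the function Wp (x + z) of z; the probability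
    factor p is Doob's bound exp (- \<kappa> (y - x)).\<close>
  have "ennreal (Wp (x + 0)) \<le> ennreal (Wp (x + (y - x))) * ennreal (exp (- \<kappa> * (y - x)))"
  proof (rule first_passage_bound[OF _ _ _ _ _ _ _ a grid_max_tail[OF a], where F="\<lambda>z. Wp (x + z)"])
    show "mono (\<lambda>z. Wp (x + z))" using Wp_mono by (auto simp: mono_def)
    show "((\<lambda>z. Wp (x + z)) \<longlongrightarrow> Wp (x + (y - x))) (at_right (y - x))"
    proof -
      have "isCont W y" using xy continuous_on_interior[OF W_continuous, of y] by simp
      then have "(W \<longlongrightarrow> W y) (at_right y)"
        unfolding isCont_def by (rule tendsto_mono[rotated]) (simp add: at_le)
      moreover have "filterlim (\<lambda>z. x + z) (at_right y) (at_right (y - x))"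
        unfolding at_right_to_0[of "y - x"] at_right_to_0[of y] filterlim_filtermap
        by (simp add: filterlim_def filtermap_filtermap add.assoc)
      ultimately have "((\<lambda>z. W (x + z)) \<longlongrightarrow> W (x + (y - x))) (at_right (y - x))"
        by (simp add: filterlim_compose)
      moreover have "\<forall>\<^sub>F z in at_right (y - x). W (x + z) = Wp (x + z)"
        unfolding eventually_at_right_field using xy by (intro exI[of _ "y - x + 1"]) (auto simp: Wp_def)
      ultimately have "((\<lambda>z. Wp (x + z)) \<longlongrightarrow> W (x + (y - x))) (at_right (y - x))"
        by (rule Lim_transform_eventually)
      then show ?thesis using xy by (simp add: Wp_def)
    qed
    have "\<forall>\<^sub>F z in at_bot. Wp (x + z) = 0"
      using eventually_le_at_bot[of "- x"] by eventually_elim (auto simp: Wp_def)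
    then show "((\<lambda>z. Wp (x + z)) \<longlongrightarrow> 0) at_bot" by (rule tendsto_eventually)
    show "ennreal (Wp (x + z)) \<le> (\<integral>\<^sup>+\<omega>. ennreal (Wp (x + (z + V s \<omega>))) \<partial>M)" if "s \<ge> 0" for z s
      using Wp_submartingale[OF that, of "x + z"] by (simp add: add.assoc)
  qed (use True Wp_nonneg Wp_integral_finite in auto)
  then show ?thesis using Wp_nonneg
    by (simp add: ennreal_mult[symmetric] ennreal_le_iff mult.commute)
qed

end

section \<open>The potential of the conditioned process\<close>

context levy_scale
begin

text \<open>\<open>W\<close> solves \<open>L W = \<delta>\<^sub>0\<close> for the generator \<open>L\<close> of \<open>V\<close>: both sides below are integrals against
  measures with the Laplace transform \<open>exp (t \<Psi> q) / \<Psi> q\<close>.\<close>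

lemma W_evolution:
  assumes t: "t \<ge> 0" and \<phi> [measurable]: "\<phi> \<in> borel_measurable borel"
  shows "(\<integral>\<^sup>+z. \<integral>\<^sup>+\<omega>. ennreal (Wp z) * \<phi> (z - V t \<omega>) \<partial>M \<partial>lborel) =
    (\<integral>\<^sup>+z. ennreal (Wp z) * \<phi> z \<partial>lborel) +
    (\<integral>\<^sup>+s. indicator {0..t} s * (\<integral>\<^sup>+\<omega>. \<phi> (- V (max 0 s) \<omega>) \<partial>M) \<partial>lborel)"
proof -
  have [measurable]: "V t \<in> borel_measurable M" using t by (rule V_measurable)
  define \<nu>1 where "\<nu>1 = distr (density (lborel \<Otimes>\<^sub>M M) (\<lambda>p. ennreal (Wp (fst p)))) borel (\<lambda>p. fst p - V t (snd p))"
  \<comment> \<open>A sum of two measures coded as one image measure: positive first coordinates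
    carry W(z) dz, while a first coordinate in [-t, 0] is minus the time s at which -V s is
    sampled.\<close>
  define \<nu>2 where "\<nu>2 = distr (density (lborel \<Otimes>\<^sub>M M) (\<lambda>p. if fst p > 0 then ennreal (Wp (fst p)) else indicator {-t..0} (fst p)))
     borel (\<lambda>p. if fst p > 0 then fst p else - V (max 0 (- fst p)) (snd p))"
  have i1: "(\<integral>\<^sup>+x. \<psi> x \<partial>\<nu>1) = (\<integral>\<^sup>+z. \<integral>\<^sup>+\<omega>. ennreal (Wp z) * \<psi> (z - V t \<omega>) \<partial>M \<partial>lborel)"
    if [measurable]: "\<psi> \<in> borel_measurable borel" for \<psi>
    unfolding \<nu>1_def by (simp add: nn_integral_distr nn_integral_density nn_integral_fst[symmetric])
  have i2: "(\<integral>\<^sup>+x. \<psi> x \<partial>\<nu>2) = (\<integral>\<^sup>+z. ennreal (Wp z) * \<psi> z \<partial>lborel) +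
    (\<integral>\<^sup>+s. indicator {0..t} s * (\<integral>\<^sup>+\<omega>. \<psi> (- V (max 0 s) \<omega>) \<partial>M) \<partial>lborel)"
    if [measurable]: "\<psi> \<in> borel_measurable borel" for \<psi>
  proof -
    have "(\<integral>\<^sup>+x. \<psi> x \<partial>\<nu>2) = (\<integral>\<^sup>+s. \<integral>\<^sup>+\<omega>. (if s > 0 then ennreal (Wp s) else indicator {-t..0} s) *
       \<psi> (if s > 0 then s else - V (max 0 (- s)) \<omega>) \<partial>M \<partial>lborel)"
      unfolding \<nu>2_def
      apply (subst nn_integral_distr, measurable)
      apply (subst nn_integral_density, measurable)
      apply (subst nn_integral_fst[symmetric], measurable)
      apply (simp only: fst_conv snd_conv)
      done
    also have "\<dots> = (\<integral>\<^sup>+s. ennreal (Wp s) * \<psi> s + indicator {-t..0} s * (\<integral>\<^sup>+\<omega>. \<psi> (- V (max 0 (- s)) \<omega>) \<partial>M) \<partial>lborel)"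
    proof (rule nn_integral_cong)
      fix s :: real
      show "(\<integral>\<^sup>+\<omega>. (if s > 0 then ennreal (Wp s) else indicator {-t..0} s) *
         \<psi> (if s > 0 then s else - V (max 0 (- s)) \<omega>) \<partial>M) =
        ennreal (Wp s) * \<psi> s + indicator {-t..0} s * (\<integral>\<^sup>+\<omega>. \<psi> (- V (max 0 (- s)) \<omega>) \<partial>M)"
      proof (cases "s > 0")
        case False
        have "(\<integral>\<^sup>+\<omega>. indicator {-t..0} s * \<psi> (- V (max 0 (- s)) \<omega>) \<partial>M) =
          indicator {-t..0} s * (\<integral>\<^sup>+\<omega>. \<psi> (- V (max 0 (- s)) \<omega>) \<partial>M)"
          by (rule nn_integral_cmult) measurable
        then show ?thesis using False by (simp add: Wp_def)
      qed (simp add: emeasure_space_1)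
    qed
    also have "\<dots> = (\<integral>\<^sup>+z. ennreal (Wp z) * \<psi> z \<partial>lborel) +
       (\<integral>\<^sup>+s. indicator {-t..0} s * (\<integral>\<^sup>+\<omega>. \<psi> (- V (max 0 (- s)) \<omega>) \<partial>M) \<partial>lborel)"
      by (rule nn_integral_add) measurable
    also have "(\<integral>\<^sup>+s. indicator {-t..0} s * (\<integral>\<^sup>+\<omega>. \<psi> (- V (max 0 (- s)) \<omega>) \<partial>M) \<partial>lborel) =
      (\<integral>\<^sup>+s. indicator {0..t} s * (\<integral>\<^sup>+\<omega>. \<psi> (- V (max 0 s) \<omega>) \<partial>M) \<partial>lborel)"
      by (subst nn_integral_real_affine[where c="-1" and t=0])
        (auto simp: indicator_def intro!: nn_integral_cong)
    finally show ?thesis .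
  qed
  have "\<nu>1 = \<nu>2"
  \<comment> \<open>On this strip q = - r runs through ]\<kappa>, \<kappa> + 1[, where the transform
    of W is finite.\<close>
  proof (rule measure_eq_if_exp_integrals_eq[of _ _ "- (\<kappa> + 1)" "- \<kappa>"])
    show "sets \<nu>1 = sets borel" "sets \<nu>2 = sets borel" by (simp_all add: \<nu>1_def \<nu>2_def)
    fix r assume "- (\<kappa> + 1) < r" "r < - \<kappa>"
    define q where "q = - r"
    have q: "q > \<kappa>" "q \<ge> 0" using \<open>r < - \<kappa>\<close> kappa_nonneg by (auto simp: q_def)
    note \<Psi> = \<Psi>_pos[OF q(1)]
    have nn: "(\<integral>\<^sup>+\<omega>. ennreal (exp (r * (z - V s \<omega>))) \<partial>M) = ennreal (exp (- q * z) * exp (s * \<Psi> q))" if "s \<ge> 0" for s z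
      using nn_integral_exp[OF that q(2), of "- z"] by (simp add: q_def algebra_simps)
    have W: "(\<integral>\<^sup>+z. ennreal (Wp z) * ennreal (exp (r * z)) \<partial>lborel) = ennreal (1 / \<Psi> q)"
      using nn_integral_Wp_laplace[OF q(1)] Wp_nonneg by (simp add: q_def ennreal_mult[symmetric] mult.commute)
    have "(\<integral>\<^sup>+x. ennreal (exp (r * x)) \<partial>\<nu>1) = (\<integral>\<^sup>+z. ennreal (exp (t * \<Psi> q)) * (ennreal (Wp z) * ennreal (exp (r * z))) \<partial>lborel)"
      by (subst i1) (auto simp: nn_integral_cmult nn[OF t] q_def ennreal_mult mult_ac)
    also have "\<dots> = ennreal (exp (t * \<Psi> q)) * ennreal (1 / \<Psi> q)"
      by (subst nn_integral_cmult) (auto simp: W)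
    finally have e1: "(\<integral>\<^sup>+x. ennreal (exp (r * x)) \<partial>\<nu>1) = ennreal (exp (t * \<Psi> q) / \<Psi> q)"
      using \<Psi> by (simp add: ennreal_mult[symmetric])
    have "(\<integral>\<^sup>+s. indicator {0..t} s * (\<integral>\<^sup>+\<omega>. ennreal (exp (r * - V (max 0 s) \<omega>)) \<partial>M) \<partial>lborel) =
        (\<integral>\<^sup>+s. ennreal (exp (s * \<Psi> q)) * indicator {0..t} s \<partial>lborel)"
      using nn[of _ 0] by (intro nn_integral_cong) (auto simp: indicator_def)
    \<comment> \<open>The time integral contributes (exp (t \<Psi> q) - 1) / \<Psi> q; the missing 1
      / \<Psi> q is the transform of W.\<close>
    also have "\<dots> = ennreal (exp (t * \<Psi> q) / \<Psi> q - exp (0 * \<Psi> q) / \<Psi> q)"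
      using \<Psi> t by (intro nn_integral_FTC_Icc[where F="\<lambda>s. exp (s * \<Psi> q) / \<Psi> q"])
        (auto intro!: derivative_eq_intros)
    finally have "(\<integral>\<^sup>+x. ennreal (exp (r * x)) \<partial>\<nu>2) = ennreal (1 / \<Psi> q) + ennreal (exp (t * \<Psi> q) / \<Psi> q - exp (0 * \<Psi> q) / \<Psi> q)"
      by (subst i2) (auto simp: W)
    also have "\<dots> = ennreal (exp (t * \<Psi> q) / \<Psi> q)"
      using \<Psi> t by (subst ennreal_plus[symmetric]) (auto simp: divide_right_mono)
    finally have e2: "(\<integral>\<^sup>+x. ennreal (exp (r * x)) \<partial>\<nu>2) = ennreal (exp (t * \<Psi> q) / \<Psi> q)" .
    show "(\<integral>\<^sup>+x. ennreal (exp (r * x)) \<partial>\<nu>1) = (\<integral>\<^sup>+x. ennreal (exp (r * x)) \<partial>\<nu>2)" unfolding e1 e2 ..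
    show "(\<integral>\<^sup>+x. ennreal (exp (r * x)) \<partial>\<nu>1) < \<infinity>" unfolding e1 by simp
  qed auto
  then show ?thesis using i1[OF \<phi>] i2[OF \<phi>] by simp
qed

section \<open>The convolution H and its Dynkin formula\<close>

definition g :: "real \<Rightarrow> ennreal" where "g y = ennreal (exp (- y) * Wp y)"

definition H :: "real \<Rightarrow> ennreal" where "H x = (\<integral>\<^sup>+z. ennreal (Wp z) * g (x - z) \<partial>lborel)"

lemma g_measurable [measurable]: "g \<in> borel_measurable borel"
  unfolding g_def by measurable

lemma H_measurable [measurable]: "H \<in> borel_measurable borel"
  unfolding H_def by measurable

text \<open>\<open>W_evolution\<close> tested against \<open>\<lambda>y. g (x - y)\<close>: the
  integrated form of L H = g, obtained without applying the generator to H.\<close>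

lemma H_evolution:
  assumes t: "t \<ge> 0"
  shows "(\<integral>\<^sup>+\<omega>. H (x + V t \<omega>) \<partial>M) = H x + (\<integral>\<^sup>+s. indicator {0..t} s * (\<integral>\<^sup>+\<omega>. g (x + V (max 0 s) \<omega>) \<partial>M) \<partial>lborel)"
proof -
  have [measurable]: "V t \<in> borel_measurable M" using t by (rule V_measurable)
  interpret P: pair_sigma_finite lborel M ..
  have "(\<integral>\<^sup>+\<omega>. H (x + V t \<omega>) \<partial>M) = (\<integral>\<^sup>+z. \<integral>\<^sup>+\<omega>. ennreal (Wp z) * g (x + V t \<omega> - z) \<partial>M \<partial>lborel)"
    unfolding H_def by (rule P.Fubini') measurable
  also have "\<dots> = (\<integral>\<^sup>+z. \<integral>\<^sup>+\<omega>. ennreal (Wp z) * (\<lambda>y. g (x - y)) (z - V t \<omega>) \<partial>M \<partial>lborel)"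
    by (simp add: algebra_simps)
  finally show ?thesis unfolding H_def by (subst (asm) W_evolution[OF t]) simp_all
qed

text \<open>For 0 < z < x the growth bound replaces W z by exp (- \<kappa> (x - z)) W x, which pulls
  W x out of the convolution. With the factor exp (- (x - z)) of g, what remains is the transform of
  W at \<kappa> + 1.\<close>

lemma H_le: "H x \<le> ennreal C * ennreal (Wp x)"
proof -
  have "H x \<le> (\<integral>\<^sup>+z. ennreal (Wp x) * ennreal (exp (- (\<kappa> + 1) * (x - z)) * Wp (x - z)) \<partial>lborel)"
    unfolding H_def
  proof (rule nn_integral_mono)
    fix z
    show "ennreal (Wp z) * g (x - z) \<le> ennreal (Wp x) * ennreal (exp (- (\<kappa> + 1) * (x - z)) * Wp (x - z))"
    proof (cases "0 < z \<and> z < x")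
      case True
      have "Wp z * (exp (- (x - z)) * Wp (x - z)) \<le> (exp (- \<kappa> * (x - z)) * Wp x) * (exp (- (x - z)) * Wp (x - z))"
        using True Wp_nonneg by (intro mult_right_mono Wp_growth) auto
      also have "\<dots> = Wp x * ((exp (- \<kappa> * (x - z)) * exp (- (x - z))) * Wp (x - z))" by simp
      also have "exp (- \<kappa> * (x - z)) * exp (- (x - z)) = exp (- (\<kappa> + 1) * (x - z))"
        by (simp add: exp_add[symmetric] algebra_simps)
      finally show ?thesis unfolding g_def using Wp_nonneg by (simp add: ennreal_mult[symmetric] ennreal_leI)
    next
      case False
      then have "Wp z = 0 \<or> Wp (x - z) = 0" by (auto simp: Wp_def)
      then show ?thesis by (auto simp: g_def)
    qed
  qed
  also have "\<dots> = ennreal (Wp x) * (\<integral>\<^sup>+z. ennreal (exp (- (\<kappa> + 1) * (x - z)) * Wp (x - z)) \<partial>lborel)"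
    by (rule nn_integral_cmult) measurable
  also have "(\<integral>\<^sup>+z. ennreal (exp (- (\<kappa> + 1) * (x - z)) * Wp (x - z)) \<partial>lborel) = (\<integral>\<^sup>+y. ennreal (exp (- (\<kappa> + 1) * y) * Wp y) \<partial>lborel)"
    by (subst (2) nn_integral_real_affine[where c="-1" and t=x]) auto
  also have "\<dots> = ennreal C" unfolding C_def by (rule nn_integral_Wp_laplace) simp
  finally show ?thesis by (simp add: mult.commute)
qed

section \<open>Killing along grids and the potential bound\<close>

definition grid_pos :: "real \<Rightarrow> real \<Rightarrow> nat \<Rightarrow> 'a set" where
  "grid_pos x \<delta> k = {\<omega>. \<forall>j\<le>k. V (real j * \<delta>) \<omega> \<in> {- x<..}}"

lemma grid_pos_measurable: "\<delta> \<ge> 0 \<Longrightarrow> indicator (grid_pos x \<delta> k) \<in> borel_measurable M"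
  unfolding grid_pos_def by (intro grid_event_measurable) auto

text \<open>Killing along a grid: \<open>H\<close> vanishes on \<open>]-\<infinity>, 0]\<close>, so nothing is lost at the killing time.\<close>

lemma H_grid_killed:
  assumes \<delta>: "\<delta> \<ge> 0" and x: "x > 0"
  shows "H x + (\<Sum>k<n. \<integral>\<^sup>+s. indicator {0..\<delta>} s *
      (\<integral>\<^sup>+\<omega>. indicator (grid_pos x \<delta> k) \<omega> * g (x + V (real k * \<delta> + max 0 s) \<omega>) \<partial>M) \<partial>lborel)
    = (\<integral>\<^sup>+\<omega>. indicator (grid_pos x \<delta> n) \<omega> * H (x + V (real n * \<delta>) \<omega>) \<partial>M)"
proof (induction n)
  case 0
  have "(\<integral>\<^sup>+\<omega>. indicator (grid_pos x \<delta> 0) \<omega> * H (x + V (real 0 * \<delta>) \<omega>) \<partial>M) = (\<integral>\<^sup>+\<omega>. H x \<partial>M)"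
    by (rule nn_integral_cong_AE) (use V_0 in eventually_elim, use x in \<open>auto simp: grid_pos_def\<close>)
  then show ?case by (simp add: emeasure_space_1)
next
  case (Suc n)
  have [measurable]: "V (real n * \<delta>) \<in> borel_measurable M" "V (real (Suc n) * \<delta>) \<in> borel_measurable M"
    "indicator (grid_pos x \<delta> n) \<in> borel_measurable M"
    using \<delta> by (auto intro!: V_measurable grid_pos_measurable)
  interpret P: pair_sigma_finite lborel M ..
  have "indicator (grid_pos x \<delta> (Suc n)) \<omega> * H (x + V (real (Suc n) * \<delta>) \<omega>) =
     indicator (grid_pos x \<delta> n) \<omega> * H (x + V (real n * \<delta> + \<delta>) \<omega>)" for \<omega>
  proof (cases "V (real (Suc n) * \<delta>) \<omega> > - x")
    case True
    then show ?thesis by (auto simp: grid_pos_def indicator_def le_Suc_eq distrib_right add.commute)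
  next
    case False
    then have "Wp (x + V (real (Suc n) * \<delta>) \<omega>) = 0" by (simp add: Wp_def)
    then have "H (x + V (real (Suc n) * \<delta>) \<omega>) = 0" using H_le[of "x + V (real (Suc n) * \<delta>) \<omega>"] by simp
    moreover have "real (Suc n) * \<delta> = real n * \<delta> + \<delta>" by (simp add: distrib_right)
    ultimately show ?thesis by simp
  qed
  then have "(\<integral>\<^sup>+\<omega>. indicator (grid_pos x \<delta> (Suc n)) \<omega> * H (x + V (real (Suc n) * \<delta>) \<omega>) \<partial>M) =
     (\<integral>\<^sup>+\<omega>. indicator (grid_pos x \<delta> n) \<omega> * H (x + V (real n * \<delta> + \<delta>) \<omega>) \<partial>M)" by simp
  \<comment> \<open>The Markov property at n \<delta> allows \<open>H_evolution\<close> to start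
    from the position reached there; on the g-term it is later used backwards.\<close>
  also have "\<dots> = (\<integral>\<^sup>+\<omega>. indicator (grid_pos x \<delta> n) \<omega> * (\<integral>\<^sup>+\<omega>'. H (x + (V (real n * \<delta>) \<omega> + V \<delta> \<omega>')) \<partial>M) \<partial>M)"
    unfolding grid_pos_def by (rule markov_grid[OF \<delta> \<delta>, where \<phi>="\<lambda>v. H (x + v)"]) auto
  also have "\<dots> = (\<integral>\<^sup>+\<omega>. indicator (grid_pos x \<delta> n) \<omega> * H (x + V (real n * \<delta>) \<omega>) +
     (\<integral>\<^sup>+s. indicator (grid_pos x \<delta> n) \<omega> * (indicator {0..\<delta>} s * (\<integral>\<^sup>+\<omega>'. g (x + V (real n * \<delta>) \<omega> + V (max 0 s) \<omega>') \<partial>M)) \<partial>lborel) \<partial>M)"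
  proof (rule nn_integral_cong)
    fix \<omega> assume w [measurable]: "\<omega> \<in> space M"
    show "indicator (grid_pos x \<delta> n) \<omega> * (\<integral>\<^sup>+\<omega>'. H (x + (V (real n * \<delta>) \<omega> + V \<delta> \<omega>')) \<partial>M) =
      indicator (grid_pos x \<delta> n) \<omega> * H (x + V (real n * \<delta>) \<omega>) +
     (\<integral>\<^sup>+s. indicator (grid_pos x \<delta> n) \<omega> * (indicator {0..\<delta>} s * (\<integral>\<^sup>+\<omega>'. g (x + V (real n * \<delta>) \<omega> + V (max 0 s) \<omega>') \<partial>M)) \<partial>lborel)"
      unfolding add.assoc[symmetric] H_evolution[OF \<delta>] distrib_left
      by (subst nn_integral_cmult) auto
  qed
  also have "\<dots> = (\<integral>\<^sup>+\<omega>. indicator (grid_pos x \<delta> n) \<omega> * H (x + V (real n * \<delta>) \<omega>) \<partial>M) +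
     (\<integral>\<^sup>+\<omega>. \<integral>\<^sup>+s. indicator (grid_pos x \<delta> n) \<omega> * (indicator {0..\<delta>} s * (\<integral>\<^sup>+\<omega>'. g (x + V (real n * \<delta>) \<omega> + V (max 0 s) \<omega>') \<partial>M)) \<partial>lborel \<partial>M)"
    by (rule nn_integral_add) measurable
  also have "(\<integral>\<^sup>+\<omega>. \<integral>\<^sup>+s. indicator (grid_pos x \<delta> n) \<omega> * (indicator {0..\<delta>} s * (\<integral>\<^sup>+\<omega>'. g (x + V (real n * \<delta>) \<omega> + V (max 0 s) \<omega>') \<partial>M)) \<partial>lborel \<partial>M) =
     (\<integral>\<^sup>+s. \<integral>\<^sup>+\<omega>. indicator (grid_pos x \<delta> n) \<omega> * (indicator {0..\<delta>} s * (\<integral>\<^sup>+\<omega>'. g (x + V (real n * \<delta>) \<omega> + V (max 0 s) \<omega>') \<partial>M)) \<partial>M \<partial>lborel)"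
    by (rule P.Fubini') measurable
  also have "\<dots> = (\<integral>\<^sup>+s. indicator {0..\<delta>} s * (\<integral>\<^sup>+\<omega>. indicator (grid_pos x \<delta> n) \<omega> * g (x + V (real n * \<delta> + max 0 s) \<omega>) \<partial>M) \<partial>lborel)"
  proof (rule nn_integral_cong)
    fix s :: real
    have "(\<integral>\<^sup>+\<omega>. indicator (grid_pos x \<delta> n) \<omega> * g (x + V (real n * \<delta> + max 0 s) \<omega>) \<partial>M) =
      (\<integral>\<^sup>+\<omega>. indicator (grid_pos x \<delta> n) \<omega> * (\<integral>\<^sup>+\<omega>'. g (x + (V (real n * \<delta>) \<omega> + V (max 0 s) \<omega>')) \<partial>M) \<partial>M)"
      unfolding grid_pos_def by (rule markov_grid[OF \<delta> _, where \<phi>="\<lambda>v. g (x + v)"]) auto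
    then show "(\<integral>\<^sup>+\<omega>. indicator (grid_pos x \<delta> n) \<omega> * (indicator {0..\<delta>} s * (\<integral>\<^sup>+\<omega>'. g (x + V (real n * \<delta>) \<omega> + V (max 0 s) \<omega>') \<partial>M)) \<partial>M) =
       indicator {0..\<delta>} s * (\<integral>\<^sup>+\<omega>. indicator (grid_pos x \<delta> n) \<omega> * g (x + V (real n * \<delta> + max 0 s) \<omega>) \<partial>M)"
      by (simp add: add.assoc indicator_def mult.commute)
  qed
  finally show ?case using Suc by (simp add: add.assoc[symmetric])
qed

definition killed_g :: "real \<Rightarrow> real \<Rightarrow> ennreal" where
  "killed_g x s = (\<integral>\<^sup>+\<omega>. indicator {0<..} (x + R (max 0 s) \<omega>) * g (x + V (max 0 s) \<omega>) \<partial>M)"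

lemma killed_g_measurable [measurable]: "(\<lambda>p. killed_g (fst p) (snd p)) \<in> borel_measurable (borel \<Otimes>\<^sub>M borel)"
  unfolding killed_g_def by measurable

lemma killed_g_measurable' [measurable]: "killed_g x \<in> borel_measurable borel"
  using measurable_compose[OF measurable_Pair1' killed_g_measurable, of x] by simp

text \<open>Survival up to a + s forces positivity at all grid points up to a = n \<delta>, so grid
  killing in place of continuous killing only increases each cell. Cells overlap in endpoints, which
  is harmless in an upper bound.\<close>

lemma killed_g_grid:
  assumes \<delta>: "\<delta> \<ge> 0" and x: "x > 0"
  shows "(\<integral>\<^sup>+s. indicator {0..real n * \<delta>} s * killed_g x s \<partial>lborel) \<le>
    (\<Sum>k<n. \<integral>\<^sup>+s. indicator {0..\<delta>} s *
      (\<integral>\<^sup>+\<omega>. indicator (grid_pos x \<delta> k) \<omega> * g (x + V (real k * \<delta> + max 0 s) \<omega>) \<partial>M) \<partial>lborel)"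
proof (induction n)
  case 0
  have "(\<integral>\<^sup>+s. indicator {0..real 0 * \<delta>} s * killed_g x s \<partial>lborel) = (\<integral>\<^sup>+(s::real). 0 \<partial>lborel)"
    by (rule nn_integral_cong_AE) (use AE_lborel_singleton[of 0] in eventually_elim, auto simp: indicator_def)
  then show ?case by simp
next
  case (Suc n)
  define a where "a = real n * \<delta>"
  have a: "a \<ge> 0" using \<delta> by (simp add: a_def)
  have Sn: "real (Suc n) * \<delta> = a + \<delta>" by (simp add: a_def distrib_right)
  have "(\<integral>\<^sup>+s. indicator {0..real (Suc n) * \<delta>} s * killed_g x s \<partial>lborel) \<le>
     (\<integral>\<^sup>+s. indicator {0..a} s * killed_g x s + indicator {a..a + \<delta>} s * killed_g x s \<partial>lborel)"
    unfolding Sn by (intro nn_integral_mono) (auto simp: indicator_def)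
  also have "\<dots> = (\<integral>\<^sup>+s. indicator {0..a} s * killed_g x s \<partial>lborel) + (\<integral>\<^sup>+s. indicator {a..a + \<delta>} s * killed_g x s \<partial>lborel)"
    by (rule nn_integral_add) measurable
  also have "(\<integral>\<^sup>+s. indicator {a..a + \<delta>} s * killed_g x s \<partial>lborel) = (\<integral>\<^sup>+s. indicator {0..\<delta>} s * killed_g x (a + s) \<partial>lborel)"
    by (subst nn_integral_real_affine[where c=1 and t=a]) (auto simp: indicator_def intro!: nn_integral_cong)
  also have "\<dots> \<le> (\<integral>\<^sup>+s. indicator {0..\<delta>} s *
      (\<integral>\<^sup>+\<omega>. indicator (grid_pos x \<delta> n) \<omega> * g (x + V (real n * \<delta> + max 0 s) \<omega>) \<partial>M) \<partial>lborel)"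
  proof (rule nn_integral_mono)
    fix s :: real
    show "indicator {0..\<delta>} s * killed_g x (a + s) \<le> indicator {0..\<delta>} s *
      (\<integral>\<^sup>+\<omega>. indicator (grid_pos x \<delta> n) \<omega> * g (x + V (real n * \<delta> + max 0 s) \<omega>) \<partial>M)"
    proof (cases "s \<in> {0..\<delta>}")
      case True
      have "killed_g x (a + s) \<le> (\<integral>\<^sup>+\<omega>. indicator (grid_pos x \<delta> n) \<omega> * g (x + V (real n * \<delta> + max 0 s) \<omega>) \<partial>M)"
        unfolding killed_g_def
      proof (rule nn_integral_mono)
        fix \<omega> assume w: "\<omega> \<in> space M"
        have eq: "max 0 (a + s) = a + s" "max 0 s = s" using a True by auto
        have "\<omega> \<in> grid_pos x \<delta> n" if pos: "x + R (a + s) \<omega> > 0"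
          unfolding grid_pos_def
        proof (intro CollectI allI impI)
          fix j assume "j \<le> n"
          then have "real j * \<delta> \<le> a" unfolding a_def using \<delta> by (intro mult_right_mono) auto
          then have "R (a + s) \<omega> \<le> V (real j * \<delta>) \<omega>" using True \<delta> by (intro R_le[OF w]) auto
          then show "V (real j * \<delta>) \<omega> \<in> {- x<..}" using pos by auto
        qed
        then show "indicator {0<..} (x + R (max 0 (a + s)) \<omega>) * g (x + V (max 0 (a + s)) \<omega>) \<le>
          indicator (grid_pos x \<delta> n) \<omega> * g (x + V (real n * \<delta> + max 0 s) \<omega>)"
          unfolding eq a_def[symmetric] by (auto simp: indicator_def)
      qed
      then show ?thesis using True by simp
    qed simp
  qed
  finally show ?case using Suc unfolding a_def sum.lessThan_Suc
    by (meson add_mono order_refl order_trans)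
qed

text \<open>Survival on a grid is weaker than survival in continuous time. If x + e + R t is
  nonpositive, the path is strictly below -x at some time; fine grids detect this, so such paths
  drop out in the limit. All others survive from x + e, where harmonicity gives W (x + e). The shift
  e avoids deciding about paths whose infimum is exactly 0.\<close>

lemma grid_pos_W_limit:
  assumes t: "t \<ge> 0" and x: "x > 0" and e: "e > 0"
  shows "\<forall>r>0. \<exists>n. (\<integral>\<^sup>+\<omega>. indicator (grid_pos x (t / real (Suc n)) (Suc n)) \<omega> * ennreal (Wp (x + V t \<omega>)) \<partial>M) \<le> ennreal (W (x + e)) + ennreal r"
proof (intro allI impI)
  fix r :: real assume r: "r > 0"
  have [measurable]: "V t \<in> borel_measurable M" "R t \<in> borel_measurable M" using t by (auto intro: V_measurable R_measurable)
  have [measurable]: "indicator (grid_pos x (t / real (Suc n)) (Suc n)) \<in> borel_measurable M" for n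
    using t by (intro grid_pos_measurable) auto
  define h where "h n \<omega> = indicator (grid_pos x (t / real (Suc n)) (Suc n)) \<omega> * (indicator {..0} (x + e + R t \<omega>) * ennreal (Wp (x + V t \<omega>)))" for n \<omega>
  have [measurable]: "h n \<in> borel_measurable M" for n unfolding h_def by measurable
  have "(\<lambda>n. \<integral>\<^sup>+\<omega>. h n \<omega> \<partial>M) \<longlonglongrightarrow> (\<integral>\<^sup>+\<omega>. 0 \<partial>M)"
  proof (rule nn_integral_dominated_convergence[where w="\<lambda>\<omega>. ennreal (Wp (x + V t \<omega>))"])
    show "AE \<omega> in M. h n \<omega> \<le> ennreal (Wp (x + V t \<omega>))" for n by (auto simp: h_def indicator_def)
    show "(\<integral>\<^sup>+\<omega>. ennreal (Wp (x + V t \<omega>)) \<partial>M) < \<infinity>" using t by (rule Wp_integral_finite)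
    show "AE \<omega> in M. (\<lambda>n. h n \<omega>) \<longlonglongrightarrow> 0"
    proof (rule AE_I2)
      fix \<omega> assume w: "\<omega> \<in> space M"
      show "(\<lambda>n. h n \<omega>) \<longlonglongrightarrow> 0"
      proof (cases "x + e + R t \<omega> \<le> 0")
        case False
        then show ?thesis by (simp add: h_def)
      next
        case True
        have "\<exists>s. 0 \<le> s \<and> s \<le> t \<and> V s \<omega> < - x"
        proof (rule ccontr)
          assume "\<not> ?thesis"
          then have "- x \<le> R t \<omega>" by (intro run_inf_ge[OF t]) auto
          then show False using True e by simp
        qed
        then obtain s where s: "0 \<le> s" "s \<le> t" "V s \<omega> < - x" by blast
        have "\<forall>\<^sub>F n in sequentially. \<exists>k\<le>Suc n. V (real k * (t / real (Suc n))) \<omega> \<in> {..< - x}"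
          by (rule cadlag_grid_hit[OF cadlag_V[OF w] s(1,2)]) (use s in auto)
        then have "\<forall>\<^sub>F n in sequentially. h n \<omega> = 0"
        proof eventually_elim
          case (elim n)
          then have "\<omega> \<notin> grid_pos x (t / real (Suc n)) (Suc n)" by (force simp: grid_pos_def)
          then show ?case by (simp add: h_def)
        qed
        then show ?thesis by (rule tendsto_eventually)
      qed
    qed
  qed auto
  then have "\<forall>\<^sub>F n in sequentially. (\<integral>\<^sup>+\<omega>. h n \<omega> \<partial>M) < ennreal r"
    using r by (intro order_tendstoD) auto
  then obtain n where n: "(\<integral>\<^sup>+\<omega>. h n \<omega> \<partial>M) < ennreal r" using eventually_happens'[OF sequentially_bot] by blast
  have "(\<integral>\<^sup>+\<omega>. indicator (grid_pos x (t / real (Suc n)) (Suc n)) \<omega> * ennreal (Wp (x + V t \<omega>)) \<partial>M) \<le>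
    (\<integral>\<^sup>+\<omega>. indicator {0<..} (x + e + R t \<omega>) * ennreal (Wp (x + e + V t \<omega>)) + h n \<omega> \<partial>M)"
  proof (rule nn_integral_mono)
    fix \<omega>
    have "ennreal (Wp (x + V t \<omega>)) \<le> ennreal (Wp (x + e + V t \<omega>))"
      using e by (intro ennreal_leI monoD[OF Wp_mono]) simp
    then show "indicator (grid_pos x (t / real (Suc n)) (Suc n)) \<omega> * ennreal (Wp (x + V t \<omega>)) \<le>
      indicator {0<..} (x + e + R t \<omega>) * ennreal (Wp (x + e + V t \<omega>)) + h n \<omega>"
      by (cases "x + e + R t \<omega> > 0") (auto simp: h_def indicator_def)
  qed
  also have "\<dots> = (\<integral>\<^sup>+\<omega>. indicator {0<..} (x + e + R t \<omega>) * ennreal (Wp (x + e + V t \<omega>)) \<partial>M) + (\<integral>\<^sup>+\<omega>. h n \<omega> \<partial>M)"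
    by (rule nn_integral_add) measurable
  also have "\<dots> \<le> ennreal (W (x + e)) + ennreal r"
    using Wp_harmonic[OF t, of "x + e"] x e n by (intro add_mono) (auto simp: less_imp_le)
  finally show "\<exists>n. (\<integral>\<^sup>+\<omega>. indicator (grid_pos x (t / real (Suc n)) (Suc n)) \<omega> * ennreal (Wp (x + V t \<omega>)) \<partial>M) \<le> ennreal (W (x + e)) + ennreal r" by blast
qed

lemma killed_g_potential:
  assumes x: "x > 0"
  shows "(\<integral>\<^sup>+s. indicator {0..} s * killed_g x s \<partial>lborel) \<le> ennreal (C * W x)"
proof -
  have fin: "(\<integral>\<^sup>+s. indicator {0..t} s * killed_g x s \<partial>lborel) \<le> ennreal (C * W x)" if t: "t \<ge> 0" for t
  proof -
    let ?I = "\<integral>\<^sup>+s. indicator {0..t} s * killed_g x s \<partial>lborel"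
    have 1: "?I \<le> ennreal (C * (W (x + e) + r))" if e: "e > 0" and r: "r > 0" for e r
    proof -
      obtain n where n: "(\<integral>\<^sup>+\<omega>. indicator (grid_pos x (t / real (Suc n)) (Suc n)) \<omega> * ennreal (Wp (x + V t \<omega>)) \<partial>M) \<le> ennreal (W (x + e)) + ennreal r"
        using grid_pos_W_limit[OF t x e] r by blast
      define \<delta> where "\<delta> = t / real (Suc n)"
      have \<delta>: "\<delta> \<ge> 0" "real (Suc n) * \<delta> = t" using t by (auto simp: \<delta>_def)
      have [measurable]: "V t \<in> borel_measurable M" "indicator (grid_pos x \<delta> (Suc n)) \<in> borel_measurable M"
        using t \<delta> by (auto intro: V_measurable grid_pos_measurable)
      have "?I \<le> (\<Sum>k<Suc n. \<integral>\<^sup>+s. indicator {0..\<delta>} s *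
          (\<integral>\<^sup>+\<omega>. indicator (grid_pos x \<delta> k) \<omega> * g (x + V (real k * \<delta> + max 0 s) \<omega>) \<partial>M) \<partial>lborel)"
        using killed_g_grid[OF \<delta>(1) x, of "Suc n"] unfolding \<delta>(2) .
      \<comment> \<open>Adding the nonnegative H x completes the left side of
        \<open>H_grid_killed\<close>.\<close>
      also have "\<dots> \<le> H x + \<dots>" by simp
      also have "\<dots> = (\<integral>\<^sup>+\<omega>. indicator (grid_pos x \<delta> (Suc n)) \<omega> * H (x + V t \<omega>) \<partial>M)"
        unfolding H_grid_killed[OF \<delta>(1) x] \<delta>(2) ..
      also have "\<dots> \<le> (\<integral>\<^sup>+\<omega>. ennreal C * (indicator (grid_pos x \<delta> (Suc n)) \<omega> * ennreal (Wp (x + V t \<omega>))) \<partial>M)"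
        using H_le by (intro nn_integral_mono) (auto simp: indicator_def)
      also have "\<dots> = ennreal C * (\<integral>\<^sup>+\<omega>. indicator (grid_pos x \<delta> (Suc n)) \<omega> * ennreal (Wp (x + V t \<omega>)) \<partial>M)"
        by (rule nn_integral_cmult) measurable
      also have "\<dots> \<le> ennreal C * (ennreal (W (x + e)) + ennreal r)"
        using n by (intro mult_left_mono) (auto simp: \<delta>_def)
      also have "\<dots> = ennreal (C * (W (x + e) + r))"
        using C_pos W_pos[of "x + e"] x e r by (simp add: ennreal_mult ennreal_plus[symmetric] del: ennreal_plus)
      finally show ?thesis .
    qed
    \<comment> \<open>Shift and error are sent to 0 together, using continuity of W at x.\<close>
    have "((\<lambda>e. ennreal (C * (W (x + e) + e))) \<longlongrightarrow> ennreal (C * (W (x + 0) + 0))) (at_right 0)"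
    proof -
      have "isCont W x" using x continuous_on_interior[OF W_continuous, of x] by simp
      moreover have "((\<lambda>e. x + e) \<longlongrightarrow> x) (at_right 0)" by (rule tendsto_eq_intros refl | simp)+
      ultimately have "((\<lambda>e. W (x + e)) \<longlongrightarrow> W (x + 0)) (at_right 0)"
        by (simp add: isCont_tendsto_compose)
      then show ?thesis by (intro tendsto_intros tendsto_ennrealI)
    qed
    then have "?I \<le> ennreal (C * (W (x + 0) + 0))"
      by (rule tendsto_lowerbound) (auto simp: eventually_at_right_field intro!: exI[of _ 1] 1)
    then show ?thesis by simp
  qed
  have "(\<integral>\<^sup>+s. (SUP n. indicator {0..real n} s * killed_g x s) \<partial>lborel) = (SUP n. \<integral>\<^sup>+s. indicator {0..real n} s * killed_g x s \<partial>lborel)"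
    by (rule nn_integral_monotone_convergence_SUP) (auto simp: incseq_def le_fun_def indicator_def)
  also have "\<dots> \<le> ennreal (C * W x)" by (intro SUP_least fin) simp
  also have "(\<lambda>s. SUP n. indicator {0..real n} s * killed_g x s) = (\<lambda>s. indicator {0..} s * killed_g x s)"
  proof
    fix s
    show "(SUP n. indicator {0..real n} s * killed_g x s) = indicator {0..} s * killed_g x s"
    proof (rule antisym)
      show "(SUP n. indicator {0..real n} s * killed_g x s) \<le> indicator {0..} s * killed_g x s"
        by (intro SUP_least) (auto simp: indicator_def)
      obtain n where "s \<le> real n" using real_arch_simple by blast
      then show "indicator {0..} s * killed_g x s \<le> (SUP n. indicator {0..real n} s * killed_g x s)"
        by (intro SUP_upper2[of n]) (auto simp: indicator_def)
    qed
  qed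
  finally show ?thesis .
qed

lemma p_up_potential:
  assumes x: "x > 0"
  shows "(\<integral>\<^sup>+t. indicator {0..} t * (\<integral>\<^sup>+y. ennreal (exp (- y)) \<partial>p_up M V W (max 0 t) x) \<partial>lborel) \<le> ennreal C"
proof -
  have Wx: "W x > 0" using x by (rule W_pos)
  have "(\<integral>\<^sup>+y. ennreal (exp (- y)) \<partial>p_up M V W (max 0 t) x) = killed_g x t / ennreal (W x)" for t
  proof -
    have "(\<integral>\<^sup>+y. ennreal (exp (- y)) \<partial>p_up M V W (max 0 t) x) =
      (\<integral>\<^sup>+\<omega>. (indicator {0<..} (x + R (max 0 t) \<omega>) * g (x + V (max 0 t) \<omega>)) / ennreal (W x) \<partial>M)"
    proof (subst nn_integral_p_up)
      have eq: "ennreal (Wp z / W x) * ennreal (exp (- z)) = g z / ennreal (W x)" for z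
        unfolding g_def using Wx Wp_nonneg by (simp add: divide_ennreal ennreal_mult[symmetric] mult.commute)
      then show "(\<integral>\<^sup>+\<omega>. indicator {0<..} (x + R (max 0 t) \<omega>) * (ennreal (Wp (x + V (max 0 t) \<omega>) / W x) * ennreal (exp (- (x + V (max 0 t) \<omega>)))) \<partial>M) =
        (\<integral>\<^sup>+\<omega>. (indicator {0<..} (x + R (max 0 t) \<omega>) * g (x + V (max 0 t) \<omega>)) / ennreal (W x) \<partial>M)"
        by (simp only: eq ennreal_times_divide)
    qed auto
    also have "\<dots> = killed_g x t / ennreal (W x)"
      unfolding killed_g_def by (rule nn_integral_divide) measurable
    finally show ?thesis .
  qed
  then have "(\<integral>\<^sup>+t. indicator {0..} t * (\<integral>\<^sup>+y. ennreal (exp (- y)) \<partial>p_up M V W (max 0 t) x) \<partial>lborel) =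
    (\<integral>\<^sup>+t. (indicator {0..} t * killed_g x t) / ennreal (W x) \<partial>lborel)"
    by (simp add: ennreal_times_divide)
  also have "\<dots> = (\<integral>\<^sup>+t. indicator {0..} t * killed_g x t \<partial>lborel) / ennreal (W x)"
    by (rule nn_integral_divide) measurable
  also have "\<dots> \<le> ennreal (C * W x) / ennreal (W x)"
    by (rule divide_right_mono_ennreal) (rule killed_g_potential[OF x])
  also have "\<dots> = ennreal C" using Wx C_pos by (simp add: divide_ennreal)
  finally show ?thesis .
qed

end

section \<open>Additive functionals of Markov processes\<close>

text \<open>For an indicator the extended conditional expectation is at most 1 and the negative part
  is 0, so the real version loses nothing. This brings the real-valued Markov property into
  nonnegative integrals with unbounded weights.\<close>

lemma (in sigma_finite_subalgebra) nn_integral_real_cond_exp_indicator: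
  assumes Z [measurable]: "Z \<in> borel_measurable F" and A [measurable]: "A \<in> sets M"
  shows "(\<integral>\<^sup>+x. Z x * ennreal (real_cond_exp M F (indicator A) x) \<partial>M) = (\<integral>\<^sup>+x. Z x * indicator A x \<partial>M)"
proof -
  have [measurable]: "Z \<in> borel_measurable M" by (rule measurable_from_subalg[OF subalg Z])
  have "AE x in M. nn_cond_exp M F (\<lambda>x. ennreal (indicator A x)) x \<le> nn_cond_exp M F (\<lambda>x. 1) x"
    by (rule nn_cond_exp_mono) (auto simp: indicator_def)
  moreover have "AE x in M. 1 = nn_cond_exp M F (\<lambda>x. 1) x" "AE x in M. 0 = nn_cond_exp M F (\<lambda>x. 0) x"
    by (rule nn_cond_exp_F_meas, simp)+
  ultimately have "AE x in M. ennreal (real_cond_exp M F (indicator A) x) = nn_cond_exp M F (\<lambda>x. ennreal (indicator A x)) x"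
  proof eventually_elim
    case (elim x)
    have "(\<lambda>x. ennreal (- indicator A x)) = (\<lambda>x. 0)" by (auto simp: indicator_def ennreal_neg)
    moreover have "nn_cond_exp M F (\<lambda>x. ennreal (indicator A x)) x < top"
      using elim by (simp add: le_less_trans[of _ 1])
    ultimately show ?case using elim by (simp add: real_cond_exp_def)
  qed
  then have "(\<integral>\<^sup>+x. Z x * ennreal (real_cond_exp M F (indicator A) x) \<partial>M) = (\<integral>\<^sup>+x. Z x * nn_cond_exp M F (\<lambda>x. ennreal (indicator A x)) x \<partial>M)"
    by (intro nn_integral_cong_AE) (auto elim: eventually_mono)
  also have "\<dots> = (\<integral>\<^sup>+x. Z x * ennreal (indicator A x) \<partial>M)"
    by (rule nn_cond_exp_intg) auto
  finally show ?thesis by (simp add: ennreal_indicator)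
qed

text \<open>Formally the derivative of J^(n+1) is -(n+1) f J^n. Since J may be infinite and f is
  merely measurable, the proof is an induction with Fubini that never subtracts.\<close>

lemma power_of_tail_integral:
  fixes f :: "real \<Rightarrow> ennreal"
  assumes f [measurable]: "f \<in> borel_measurable borel"
  defines "J \<equiv> \<lambda>s. \<integral>\<^sup>+r. indicator {s..} r * f r \<partial>lborel"
  shows "J s ^ Suc n = of_nat (Suc n) * (\<integral>\<^sup>+r. indicator {s..} r * f r * J r ^ n \<partial>lborel)"
proof (induction n arbitrary: s)
  case 0
  then show ?case by (simp add: J_def)
next
  case (Suc n)
  have ind2 [measurable]: "(\<lambda>p :: real \<times> real. indicator {fst p..} (snd p) :: ennreal) \<in> borel_measurable (borel \<Otimes>\<^sub>M borel)"
  proof -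
    have "(\<lambda>p :: real \<times> real. indicator {fst p..} (snd p) :: ennreal) = indicator {p :: real \<times> real. fst p \<le> snd p}"
      by (auto simp: indicator_def)
    then show ?thesis by simp
  qed
  have [measurable]: "(\<lambda>p :: real \<times> real. indicator {snd p..} (fst p) :: ennreal) \<in> borel_measurable (borel \<Otimes>\<^sub>M borel)"
  proof -
    have "(\<lambda>p :: real \<times> real. indicator {snd p..} (fst p) :: ennreal) = indicator {p :: real \<times> real. snd p \<le> fst p}"
      by (auto simp: indicator_def)
    then show ?thesis by simp
  qed
  have [measurable]: "J \<in> borel_measurable borel" unfolding J_def by measurable
  define A where "A n s = (\<integral>\<^sup>+r. indicator {s..} r * f r * J r ^ n \<partial>lborel)" for n s
  \<comment> \<open>The integral of f r f u (J u)^n over s \<le> r \<le> u. By the induction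
    hypothesis and Fubini, A (Suc n) s is n + 1 times B; added to B it factorises as J s times A n
    s.\<close>
  define B where "B = (\<integral>\<^sup>+u. indicator {s..} u * f u * J u ^ n * (\<integral>\<^sup>+r. indicator {s..u} r * f r \<partial>lborel) \<partial>lborel)"
  have ind3 [measurable]: "(\<lambda>u. \<integral>\<^sup>+r. indicator {s..u} r * f r \<partial>lborel) \<in> borel_measurable borel"
  proof -
    have "(\<lambda>p. indicator {s..fst p} (snd p) :: ennreal) = indicator {p :: real \<times> real. s \<le> snd p \<and> snd p \<le> fst p}"
      by (auto simp: indicator_def)
    then have [measurable]: "(\<lambda>p :: real \<times> real. indicator {s..fst p} (snd p) :: ennreal) \<in> borel_measurable (borel \<Otimes>\<^sub>M borel)"
      by simp
    show ?thesis by measurable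
  qed
  have "A (Suc n) s = (\<integral>\<^sup>+r. indicator {s..} r * f r * (of_nat (Suc n) * A n r) \<partial>lborel)"
    unfolding A_def Suc.IH[symmetric] ..
  also have "\<dots> = (\<integral>\<^sup>+r. \<integral>\<^sup>+u. of_nat (Suc n) * (indicator {s..} r * f r * (indicator {r..} u * f u * J u ^ n)) \<partial>lborel \<partial>lborel)"
  proof (rule nn_integral_cong)
    fix r
    have "indicator {s..} r * f r * (of_nat (Suc n) * A n r) =
      of_nat (Suc n) * (indicator {s..} r * f r) * (\<integral>\<^sup>+u. indicator {r..} u * f u * J u ^ n \<partial>lborel)"
      unfolding A_def by (simp only: mult_ac)
    also have "\<dots> = (\<integral>\<^sup>+u. of_nat (Suc n) * (indicator {s..} r * f r) * (indicator {r..} u * f u * J u ^ n) \<partial>lborel)"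
      by (rule nn_integral_cmult[symmetric]) measurable
    finally show "indicator {s..} r * f r * (of_nat (Suc n) * A n r) =
      (\<integral>\<^sup>+u. of_nat (Suc n) * (indicator {s..} r * f r * (indicator {r..} u * f u * J u ^ n)) \<partial>lborel)"
      by (simp only: mult.assoc)
  qed
  also have "\<dots> = (\<integral>\<^sup>+u. \<integral>\<^sup>+r. of_nat (Suc n) * (indicator {s..} r * f r * (indicator {r..} u * f u * J u ^ n)) \<partial>lborel \<partial>lborel)"
    by (rule lborel_pair.Fubini') measurable
  also have "\<dots> = (\<integral>\<^sup>+u. of_nat (Suc n) * (indicator {s..} u * f u * J u ^ n * (\<integral>\<^sup>+r. indicator {s..u} r * f r \<partial>lborel)) \<partial>lborel)"
  proof (rule nn_integral_cong)
    fix u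
    have "(\<integral>\<^sup>+r. of_nat (Suc n) * (indicator {s..} r * f r * (indicator {r..} u * f u * J u ^ n)) \<partial>lborel) =
      (\<integral>\<^sup>+r. of_nat (Suc n) * (indicator {s..} u * f u * J u ^ n) * (indicator {s..u} r * f r) \<partial>lborel)"
      by (intro nn_integral_cong) (auto simp: indicator_def mult_ac)
    also have "\<dots> = of_nat (Suc n) * (indicator {s..} u * f u * J u ^ n) * (\<integral>\<^sup>+r. indicator {s..u} r * f r \<partial>lborel)"
      by (rule nn_integral_cmult) measurable
    finally show "(\<integral>\<^sup>+r. of_nat (Suc n) * (indicator {s..} r * f r * (indicator {r..} u * f u * J u ^ n)) \<partial>lborel) =
      of_nat (Suc n) * (indicator {s..} u * f u * J u ^ n * (\<integral>\<^sup>+r. indicator {s..u} r * f r \<partial>lborel))"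
      by (simp only: mult.assoc)
  qed
  also have "\<dots> = of_nat (Suc n) * B"
    unfolding B_def by (rule nn_integral_cmult) measurable
  finally have AB: "A (Suc n) s = of_nat (Suc n) * B" .
  have "A (Suc n) s + B = (\<integral>\<^sup>+u. indicator {s..} u * f u * J u ^ n * J u + indicator {s..} u * f u * J u ^ n * (\<integral>\<^sup>+r. indicator {s..u} r * f r \<partial>lborel) \<partial>lborel)"
  proof -
    have "A (Suc n) s = (\<integral>\<^sup>+u. indicator {s..} u * f u * J u ^ n * J u \<partial>lborel)"
      unfolding A_def by (simp add: mult_ac)
    then show ?thesis unfolding B_def by (simp only:) (rule nn_integral_add[symmetric], measurable)
  qed
  also have "\<dots> = (\<integral>\<^sup>+u. J s * (indicator {s..} u * f u * J u ^ n) \<partial>lborel)"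
  proof (rule nn_integral_cong)
    fix u
    have "J u + (\<integral>\<^sup>+r. indicator {s..u} r * f r \<partial>lborel) = J s" if "u \<ge> s"
    proof -
      have "J u + (\<integral>\<^sup>+r. indicator {s..u} r * f r \<partial>lborel) = (\<integral>\<^sup>+r. indicator {u..} r * f r + indicator {s..u} r * f r \<partial>lborel)"
        unfolding J_def by (subst nn_integral_add) auto
      also have "\<dots> = J s" unfolding J_def
        by (rule nn_integral_cong_AE) (use AE_lborel_singleton[of u] in eventually_elim, use that in \<open>auto simp: indicator_def\<close>)
      finally show ?thesis .
    qed
    then show "indicator {s..} u * f u * J u ^ n * J u + indicator {s..} u * f u * J u ^ n * (\<integral>\<^sup>+r. indicator {s..u} r * f r \<partial>lborel) =
      J s * (indicator {s..} u * f u * J u ^ n)"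
      by (cases "u \<ge> s") (simp_all only: distrib_left[symmetric] mult.commute[of "J s"], simp)
  qed
  also have "\<dots> = J s * A n s" unfolding A_def by (rule nn_integral_cmult) measurable
  finally have S: "A (Suc n) s + B = J s * A n s" .
  \<comment> \<open>Of the n + 2 copies of A (Suc n) s one is traded for (n + 1) B; this replaces a
    subtraction that would fail for infinite values.\<close>
  have "of_nat (Suc (Suc n)) * A (Suc n) s = of_nat (Suc n) * (A (Suc n) s + B)"
    using AB by (simp add: distrib_left distrib_right add.commute)
  also have "\<dots> = J s * (of_nat (Suc n) * A n s)" unfolding S by (simp only: mult_ac)
  also have "\<dots> = J s ^ Suc (Suc n)" using Suc.IH[of s] unfolding A_def by simp
  finally show ?case unfolding A_def ..
qed

text \<open>Kernels are evaluated at \<open>max 0 x\<close> because a Feller semigroup is specified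
  only on [0, \<infinity>[. Along X the clipping is almost surely invisible.\<close>

locale cadlag_markov =
  fixes N :: "'b measure" and X :: "real \<Rightarrow> 'b \<Rightarrow> real" and P :: "real \<Rightarrow> real \<Rightarrow> real measure"
  assumes cadlag_process_X: "cadlag_process N X"
    and markov: "markov_process N X P"
    and X_nonneg: "AE \<omega> in N. \<forall>t\<ge>0. X t \<omega> \<ge> 0"
    and kernel: "\<And>t. t \<ge> 0 \<Longrightarrow> (\<lambda>x. P t (max 0 x)) \<in> borel \<rightarrow>\<^sub>M subprob_algebra borel"
begin

sublocale N: prob_space N
  using cadlag_process_X by (simp add: cadlag_process_def)

abbreviation \<F> :: "real \<Rightarrow> 'b measure" where "\<F> \<equiv> natural_filtration N X"

lemma X_measurable: "t \<ge> 0 \<Longrightarrow> X t \<in> borel_measurable N"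
  by (rule cadlag_processD(2)[OF cadlag_process_X])

lemma X_compose_measurable [measurable (raw)]:
  assumes "f \<in> L \<rightarrow>\<^sub>M borel" "g \<in> L \<rightarrow>\<^sub>M N"
  shows "(\<lambda>x. X (max 0 (f x)) (g x)) \<in> borel_measurable L"
  using measurable_compose[OF measurable_Pair[OF assms] cadlag_process_measurable_pair[OF cadlag_process_X]] by simp

section \<open>The natural filtration and the Markov property\<close>

lemma sets_filtration:
  "sets (\<F> s) = sigma_sets (space N) {X r -` B \<inter> space N | r B. 0 \<le> r \<and> r \<le> s \<and> B \<in> sets borel}"
  and space_filtration: "space (\<F> s) = space N"
  unfolding natural_filtration_def by (auto intro!: sets_measure_of space_measure_of)

lemma subalgebra_filtration: "subalgebra N (\<F> s)"
proof -
  have "sets (\<F> s) \<subseteq> sets N"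
    unfolding sets_filtration
  proof (rule sets.sigma_sets_subset)
    show "{X r -` B \<inter> space N | r B. 0 \<le> r \<and> r \<le> s \<and> B \<in> sets borel} \<subseteq> sets N"
      using X_measurable by (auto intro!: measurable_sets)
  qed
  then show ?thesis by (simp add: subalgebra_def space_filtration)
qed

lemma filtration_measurable: "Z \<in> borel_measurable (\<F> s) \<Longrightarrow> Z \<in> borel_measurable N"
  by (rule measurable_from_subalg[OF subalgebra_filtration])

lemma filtration_mono: "s \<le> t \<Longrightarrow> Z \<in> borel_measurable (\<F> s) \<Longrightarrow> Z \<in> borel_measurable (\<F> t)"
proof -
  assume "s \<le> t"
  then have "subalgebra (\<F> t) (\<F> s)"
    unfolding subalgebra_def space_filtration sets_filtration
    by (intro conjI refl sigma_sets_mono') (blast intro: order_trans)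
  then show "Z \<in> borel_measurable (\<F> s) \<Longrightarrow> Z \<in> borel_measurable (\<F> t)"
    by (rule measurable_from_subalg)
qed

lemma X_adapted: "0 \<le> r \<Longrightarrow> r \<le> s \<Longrightarrow> X r \<in> borel_measurable (\<F> s)"
proof (rule measurableI)
  fix B :: "real set" assume "0 \<le> r" "r \<le> s" "B \<in> sets borel"
  then show "X r -` B \<inter> space (\<F> s) \<in> sets (\<F> s)"
    unfolding sets_filtration space_filtration by (auto intro!: sigma_sets.Basic)
qed simp

lemma markov_indicator:
  assumes "s \<ge> 0" "t \<ge> 0" and Z: "Z \<in> borel_measurable (\<F> s)" and B: "B \<in> sets borel"
  shows "(\<integral>\<^sup>+\<omega>. Z \<omega> * indicator B (X (s + t) \<omega>) \<partial>N) = (\<integral>\<^sup>+\<omega>. Z \<omega> * emeasure (P t (max 0 (X s \<omega>))) B \<partial>N)"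
proof -
  interpret F: finite_measure_subalgebra N "\<F> s"
    by (intro finite_measure_subalgebra.intro finite_measure_subalgebra_axioms.intro
        subalgebra_filtration N.finite_measure_axioms)
  have [measurable]: "X (s + t) \<in> borel_measurable N" using assms by (intro X_measurable) simp
  let ?A = "X (s + t) -` B \<inter> space N"
  have A: "?A \<in> sets N" using B by measurable
  have [measurable]: "Z \<in> borel_measurable N" using Z by (rule filtration_measurable)
  have "AE \<omega> in N. real_cond_exp N (\<F> s) (\<lambda>\<omega>. indicator B (X (s + t) \<omega>)) \<omega> = real_cond_exp N (\<F> s) (indicator ?A) \<omega>"
    using B A by (intro F.real_cond_exp_cong) (auto simp: indicator_def)
  moreover have "AE \<omega> in N. real_cond_exp N (\<F> s) (\<lambda>\<omega>. indicator B (X (s + t) \<omega>)) \<omega> = measure (P t (X s \<omega>)) B"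
    using markov assms unfolding markov_process_def by blast
  ultimately have eq: "AE \<omega> in N. ennreal (real_cond_exp N (\<F> s) (indicator ?A) \<omega>) = emeasure (P t (max 0 (X s \<omega>))) B"
    using X_nonneg
  proof eventually_elim
    case (elim \<omega>)
    have "P t (max 0 (X s \<omega>)) \<in> space (subprob_algebra borel)"
      using measurable_space[OF kernel[OF assms(2)], of "X s \<omega>"] by simp
    then have "subprob_space (P t (max 0 (X s \<omega>)))" by (simp add: space_subprob_algebra)
    then interpret p: subprob_space "P t (max 0 (X s \<omega>))" .
    have "max 0 (X s \<omega>) = X s \<omega>" using elim assms by simp
    then show ?case using elim p.emeasure_eq_measure[of B] by simp
  qed
  have "(\<integral>\<^sup>+\<omega>. Z \<omega> * indicator B (X (s + t) \<omega>) \<partial>N) = (\<integral>\<^sup>+\<omega>. Z \<omega> * indicator ?A \<omega> \<partial>N)"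
    by (intro nn_integral_cong) (auto simp: indicator_def)
  also have "\<dots> = (\<integral>\<^sup>+\<omega>. Z \<omega> * ennreal (real_cond_exp N (\<F> s) (indicator ?A) \<omega>) \<partial>N)"
    by (rule F.nn_integral_real_cond_exp_indicator[OF Z A, symmetric])
  also have "\<dots> = (\<integral>\<^sup>+\<omega>. Z \<omega> * emeasure (P t (max 0 (X s \<omega>))) B \<partial>N)"
    by (rule nn_integral_cong_AE) (use eq in eventually_elim, simp)
  finally show ?thesis .
qed

lemma kernel_integral_measurable:
  assumes "t \<ge> 0" "h \<in> borel_measurable borel"
  shows "(\<lambda>x. \<integral>\<^sup>+y. h y \<partial>P t (max 0 x)) \<in> borel_measurable borel"
  using measurable_compose[OF kernel[OF assms(1)] nn_integral_measurable_subprob_algebra[OF assms(2)]] .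

lemma sets_kernel: "t \<ge> 0 \<Longrightarrow> sets (P t (max 0 x)) = sets borel"
  using measurable_space[OF kernel, of t x] by (simp add: space_subprob_algebra)

text \<open>Monotone class extension of \<open>markov_indicator\<close>. Z is an arbitrary
  nonnegative functional of the past, a generality on which the moment induction relies.\<close>

lemma markov_nn_integral:
  assumes st: "s \<ge> 0" "t \<ge> 0" and Z: "Z \<in> borel_measurable (\<F> s)" and h: "h \<in> borel_measurable borel"
  shows "(\<integral>\<^sup>+\<omega>. Z \<omega> * h (X (s + t) \<omega>) \<partial>N) = (\<integral>\<^sup>+\<omega>. Z \<omega> * (\<integral>\<^sup>+y. h y \<partial>P t (max 0 (X s \<omega>))) \<partial>N)"
  using h
proof induct
  case (cong f g)
  then have "f = g" by auto
  then show ?case using cong by simp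
next
  case (set B)
  then show ?case using markov_indicator[OF st Z, of B] sets_kernel[OF st(2)] by simp
next
  case (mult u c)
  have [measurable]: "Z \<in> borel_measurable N" "X (s + t) \<in> borel_measurable N" "X s \<in> borel_measurable N"
    "u \<in> borel_measurable borel"
    using Z st mult by (auto intro: filtration_measurable X_measurable)
  note [measurable] = measurable_compose[OF \<open>X s \<in> borel_measurable N\<close> kernel_integral_measurable[OF st(2) mult(2)]]
  have "(\<integral>\<^sup>+\<omega>. Z \<omega> * (c * u (X (s + t) \<omega>)) \<partial>N) = (\<integral>\<^sup>+\<omega>. c * (Z \<omega> * u (X (s + t) \<omega>)) \<partial>N)"
    by (simp only: mult_ac)
  also have "\<dots> = c * (\<integral>\<^sup>+\<omega>. Z \<omega> * (\<integral>\<^sup>+y. u y \<partial>P t (max 0 (X s \<omega>))) \<partial>N)"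
    unfolding mult(4)[symmetric] by (rule nn_integral_cmult) measurable
  also have "\<dots> = (\<integral>\<^sup>+\<omega>. c * (Z \<omega> * (\<integral>\<^sup>+y. u y \<partial>P t (max 0 (X s \<omega>)))) \<partial>N)"
    by (rule nn_integral_cmult[symmetric]) measurable
  also have "\<dots> = (\<integral>\<^sup>+\<omega>. Z \<omega> * (\<integral>\<^sup>+y. c * u y \<partial>P t (max 0 (X s \<omega>))) \<partial>N)"
    using mult(2) by (simp add: nn_integral_cmult measurable_cong_sets[OF sets_kernel[OF st(2)] refl] mult_ac)
  finally show ?case .
next
  case (add u v)
  have [measurable]: "Z \<in> borel_measurable N" "X (s + t) \<in> borel_measurable N" "X s \<in> borel_measurable N"
    "u \<in> borel_measurable borel" "v \<in> borel_measurable borel"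
    using Z st add by (auto intro: filtration_measurable X_measurable)
  note [measurable] = measurable_compose[OF \<open>X s \<in> borel_measurable N\<close> kernel_integral_measurable[OF st(2) add(1)]]
    measurable_compose[OF \<open>X s \<in> borel_measurable N\<close> kernel_integral_measurable[OF st(2) add(4)]]
  show ?case
    using add by (simp add: distrib_left nn_integral_add measurable_cong_sets[OF sets_kernel[OF st(2)] refl])
next
  case (seq U)
  have [measurable]: "Z \<in> borel_measurable N" "X (s + t) \<in> borel_measurable N" "X s \<in> borel_measurable N"
    "\<And>i. U i \<in> borel_measurable borel"
    using Z st seq by (auto intro: filtration_measurable X_measurable)
  note [measurable] = measurable_compose[OF \<open>X s \<in> borel_measurable N\<close> kernel_integral_measurable[OF st(2) seq(1)]]
  have inc: "U i x \<le> U j x" if "i \<le> j" for i j x using seq(4) that by (auto simp: incseq_def le_fun_def)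
  have SUP_at: "(SUP i. U i) x = (SUP i. U i x)" for x by (simp add: image_comp)
  have "(\<integral>\<^sup>+\<omega>. Z \<omega> * (SUP i. U i) (X (s + t) \<omega>) \<partial>N) = (\<integral>\<^sup>+\<omega>. (SUP i. Z \<omega> * U i (X (s + t) \<omega>)) \<partial>N)"
    by (simp only: SUP_at SUP_mult_left_ennreal)
  also have "\<dots> = (SUP i. \<integral>\<^sup>+\<omega>. Z \<omega> * U i (X (s + t) \<omega>) \<partial>N)"
    by (rule nn_integral_monotone_convergence_SUP) (auto simp: incseq_def le_fun_def intro!: mult_left_mono inc)
  also have "\<dots> = (SUP i. \<integral>\<^sup>+\<omega>. Z \<omega> * (\<integral>\<^sup>+y. U i y \<partial>P t (max 0 (X s \<omega>))) \<partial>N)"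
    unfolding seq(3) ..
  also have "\<dots> = (\<integral>\<^sup>+\<omega>. (SUP i. Z \<omega> * (\<integral>\<^sup>+y. U i y \<partial>P t (max 0 (X s \<omega>)))) \<partial>N)"
    by (rule nn_integral_monotone_convergence_SUP[symmetric])
      (auto simp: incseq_def le_fun_def intro!: mult_left_mono nn_integral_mono inc)
  also have "\<dots> = (\<integral>\<^sup>+\<omega>. Z \<omega> * (\<integral>\<^sup>+y. (SUP i. U i) y \<partial>P t (max 0 (X s \<omega>))) \<partial>N)"
  proof (rule nn_integral_cong)
    fix \<omega>
    have "(\<integral>\<^sup>+y. (SUP i. U i) y \<partial>P t (max 0 (X s \<omega>))) = (SUP i. \<integral>\<^sup>+y. U i y \<partial>P t (max 0 (X s \<omega>)))"
      unfolding SUP_at by (rule nn_integral_monotone_convergence_SUP)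
        (auto simp: measurable_cong_sets[OF sets_kernel[OF st(2)] refl] seq)
    then show "(SUP i. Z \<omega> * (\<integral>\<^sup>+y. U i y \<partial>P t (max 0 (X s \<omega>)))) = Z \<omega> * (\<integral>\<^sup>+y. (SUP i. U i) y \<partial>P t (max 0 (X s \<omega>)))"
      by (simp add: SUP_mult_left_ennreal)
  qed
  finally show ?case .
qed

section \<open>Additive functionals and their moments\<close>

definition J :: "(real \<Rightarrow> ennreal) \<Rightarrow> real \<Rightarrow> 'b \<Rightarrow> ennreal" where
  "J \<phi> s \<omega> = (\<integral>\<^sup>+r. indicator {s..} r * \<phi> (X (max 0 r) \<omega>) \<partial>lborel)"

lemma J_pair_measurable:
  assumes [measurable]: "\<phi> \<in> borel_measurable borel"
  shows "(\<lambda>p. J \<phi> (fst p) (snd p)) \<in> borel_measurable (borel \<Otimes>\<^sub>M N)"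
proof -
  have "(\<lambda>q. indicator {fst (fst q)..} (snd q) :: ennreal) = indicator {q :: (real \<times> 'b) \<times> real. fst (fst q) \<le> snd q}"
    by (auto simp: indicator_def)
  moreover have "indicator {q :: (real \<times> 'b) \<times> real. fst (fst q) \<le> snd q} \<in> borel_measurable ((borel \<Otimes>\<^sub>M N) \<Otimes>\<^sub>M borel)"
    by (subst measurable_cong[where g="indicator {q \<in> space ((borel \<Otimes>\<^sub>M N) \<Otimes>\<^sub>M borel). fst (fst q) \<le> snd q}"])
      (auto simp: indicator_def)
  ultimately have [measurable]: "(\<lambda>q :: (real \<times> 'b) \<times> real. indicator {fst (fst q)..} (snd q) :: ennreal) \<in> borel_measurable ((borel \<Otimes>\<^sub>M N) \<Otimes>\<^sub>M borel)"
    by simp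
  show ?thesis unfolding J_def by measurable
qed

lemma J_compose_measurable [measurable (raw)]:
  assumes "\<phi> \<in> borel_measurable borel" "f \<in> L \<rightarrow>\<^sub>M borel" "g \<in> L \<rightarrow>\<^sub>M N"
  shows "(\<lambda>x. J \<phi> (f x) (g x)) \<in> borel_measurable L"
  using measurable_compose[OF measurable_Pair[OF assms(2,3)] J_pair_measurable[OF assms(1)]] by simp

lemma J_power_integral:
  assumes [measurable]: "\<phi> \<in> borel_measurable borel" "Z \<in> borel_measurable N"
  shows "(\<integral>\<^sup>+\<omega>. Z \<omega> * J \<phi> s \<omega> ^ Suc n \<partial>N) =
    of_nat (Suc n) * (\<integral>\<^sup>+r. indicator {s..} r * (\<integral>\<^sup>+\<omega>. Z \<omega> * \<phi> (X (max 0 r) \<omega>) * J \<phi> r \<omega> ^ n \<partial>N) \<partial>lborel)"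
proof -
  interpret P: pair_sigma_finite lborel N ..
  have "(\<integral>\<^sup>+\<omega>. Z \<omega> * J \<phi> s \<omega> ^ Suc n \<partial>N) =
    (\<integral>\<^sup>+\<omega>. \<integral>\<^sup>+r. of_nat (Suc n) * (indicator {s..} r * (Z \<omega> * \<phi> (X (max 0 r) \<omega>) * J \<phi> r \<omega> ^ n)) \<partial>lborel \<partial>N)"
  proof (rule nn_integral_cong)
    fix \<omega> assume [measurable]: "\<omega> \<in> space N"
    have "J \<phi> s \<omega> ^ Suc n = of_nat (Suc n) * (\<integral>\<^sup>+r. indicator {s..} r * \<phi> (X (max 0 r) \<omega>) * J \<phi> r \<omega> ^ n \<partial>lborel)"
      unfolding J_def by (rule power_of_tail_integral) measurable
    then have "Z \<omega> * J \<phi> s \<omega> ^ Suc n = of_nat (Suc n) * Z \<omega> * (\<integral>\<^sup>+r. indicator {s..} r * \<phi> (X (max 0 r) \<omega>) * J \<phi> r \<omega> ^ n \<partial>lborel)"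
      by (simp only: mult_ac)
    also have "\<dots> = (\<integral>\<^sup>+r. of_nat (Suc n) * Z \<omega> * (indicator {s..} r * \<phi> (X (max 0 r) \<omega>) * J \<phi> r \<omega> ^ n) \<partial>lborel)"
      by (rule nn_integral_cmult[symmetric]) measurable
    finally show "Z \<omega> * J \<phi> s \<omega> ^ Suc n =
      (\<integral>\<^sup>+r. of_nat (Suc n) * (indicator {s..} r * (Z \<omega> * \<phi> (X (max 0 r) \<omega>) * J \<phi> r \<omega> ^ n)) \<partial>lborel)"
      by (simp only: mult_ac)
  qed
  also have "\<dots> = (\<integral>\<^sup>+r. \<integral>\<^sup>+\<omega>. of_nat (Suc n) * (indicator {s..} r * (Z \<omega> * \<phi> (X (max 0 r) \<omega>) * J \<phi> r \<omega> ^ n)) \<partial>N \<partial>lborel)"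
    by (rule P.Fubini') measurable
  also have "\<dots> = (\<integral>\<^sup>+r. of_nat (Suc n) * (indicator {s..} r * (\<integral>\<^sup>+\<omega>. Z \<omega> * \<phi> (X (max 0 r) \<omega>) * J \<phi> r \<omega> ^ n \<partial>N)) \<partial>lborel)"
    by (intro nn_integral_cong) (simp add: nn_integral_cmult del: of_nat_Suc)
  also have "\<dots> = of_nat (Suc n) * (\<integral>\<^sup>+r. indicator {s..} r * (\<integral>\<^sup>+\<omega>. Z \<omega> * \<phi> (X (max 0 r) \<omega>) * J \<phi> r \<omega> ^ n \<partial>N) \<partial>lborel)"
    by (rule nn_integral_cmult) measurable
  finally show ?thesis .
qed

lemma J_integral:
  assumes "\<phi> \<in> borel_measurable borel" "Z \<in> borel_measurable N"
  shows "(\<integral>\<^sup>+\<omega>. Z \<omega> * J \<phi> s \<omega> \<partial>N) =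
    (\<integral>\<^sup>+r. indicator {s..} r * (\<integral>\<^sup>+\<omega>. Z \<omega> * \<phi> (X (max 0 r) \<omega>) \<partial>N) \<partial>lborel)"
  using J_power_integral[OF assms, of s 0] by simp

text \<open>Khasminskii's lemma and its analogue for lower bounds.\<close>

lemma J_moment_upper:
  assumes \<phi> [measurable]: "\<phi> \<in> borel_measurable borel"
    and 1: "\<And>s Z. s \<ge> 0 \<Longrightarrow> Z \<in> borel_measurable (\<F> s) \<Longrightarrow> (\<integral>\<^sup>+\<omega>. Z \<omega> * J \<phi> s \<omega> \<partial>N) \<le> c * (\<integral>\<^sup>+\<omega>. Z \<omega> \<partial>N)"
    and "s \<ge> 0" "Z \<in> borel_measurable (\<F> s)"
  shows "(\<integral>\<^sup>+\<omega>. Z \<omega> * J \<phi> s \<omega> ^ n \<partial>N) \<le> fact n * c ^ n * (\<integral>\<^sup>+\<omega>. Z \<omega> \<partial>N)"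
  using assms(3,4)
proof (induction n arbitrary: s Z)
  case (Suc n)
  have Z [measurable]: "Z \<in> borel_measurable N" using Suc by (intro filtration_measurable)
  have "(\<integral>\<^sup>+\<omega>. Z \<omega> * J \<phi> s \<omega> ^ Suc n \<partial>N) =
     of_nat (Suc n) * (\<integral>\<^sup>+r. indicator {s..} r * (\<integral>\<^sup>+\<omega>. Z \<omega> * \<phi> (X (max 0 r) \<omega>) * J \<phi> r \<omega> ^ n \<partial>N) \<partial>lborel)"
    by (rule J_power_integral) measurable
  also have "\<dots> \<le> of_nat (Suc n) * (\<integral>\<^sup>+r. (fact n * c ^ n) * (indicator {s..} r * (\<integral>\<^sup>+\<omega>. Z \<omega> * \<phi> (X (max 0 r) \<omega>) \<partial>N)) \<partial>lborel)"
  proof (intro mult_left_mono nn_integral_mono)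
    fix r :: real
    show "indicator {s..} r * (\<integral>\<^sup>+\<omega>. Z \<omega> * \<phi> (X (max 0 r) \<omega>) * J \<phi> r \<omega> ^ n \<partial>N) \<le>
      (fact n * c ^ n) * (indicator {s..} r * (\<integral>\<^sup>+\<omega>. Z \<omega> * \<phi> (X (max 0 r) \<omega>) \<partial>N))"
    proof (cases "s \<le> r")
      case True
      \<comment> \<open>The induction hypothesis is used at time r with the new weight Z \<phi>(X
        r), which belongs to the past of r.\<close>
      have [measurable]: "Z \<in> borel_measurable (\<F> r)" "X (max 0 r) \<in> borel_measurable (\<F> r)"
        using filtration_mono[OF True Suc.prems(2)] Suc.prems(1) True by (auto intro: X_adapted)
      have "(\<integral>\<^sup>+\<omega>. Z \<omega> * \<phi> (X (max 0 r) \<omega>) * J \<phi> r \<omega> ^ n \<partial>N) \<le> fact n * c ^ n * (\<integral>\<^sup>+\<omega>. Z \<omega> * \<phi> (X (max 0 r) \<omega>) \<partial>N)"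
        using Suc.prems True by (intro Suc.IH) measurable
      then show ?thesis using True by simp
    qed simp
  qed simp
  also have "\<dots> = of_nat (Suc n) * (fact n * c ^ n * (\<integral>\<^sup>+\<omega>. Z \<omega> * J \<phi> s \<omega> \<partial>N))"
    unfolding J_integral[OF \<phi> Z] by (subst nn_integral_cmult) auto
  also have "\<dots> \<le> of_nat (Suc n) * (fact n * c ^ n * (c * (\<integral>\<^sup>+\<omega>. Z \<omega> \<partial>N)))"
    by (intro mult_left_mono 1 Suc.prems) auto
  finally show ?case by (simp add: mult_ac)
qed simp

text \<open>The first-order bound is available only for weights carried by X s in K. The induction
  stays within such weights: \<phi> vanishes outside K, so the new weight Z \<phi>(X r) is carried
  by X r in K.\<close>

lemma J_moment_lower:
  assumes \<phi> [measurable]: "\<phi> \<in> borel_measurable borel" and K: "\<And>y. y \<notin> K \<Longrightarrow> \<phi> y = 0"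
    and 1: "\<And>s Z. s \<ge> 0 \<Longrightarrow> Z \<in> borel_measurable (\<F> s) \<Longrightarrow> (\<And>\<omega>. X s \<omega> \<notin> K \<Longrightarrow> Z \<omega> = 0) \<Longrightarrow>
      (\<integral>\<^sup>+\<omega>. Z \<omega> * J \<phi> s \<omega> \<partial>N) \<ge> c * (\<integral>\<^sup>+\<omega>. Z \<omega> \<partial>N)"
    and "s \<ge> 0" "Z \<in> borel_measurable (\<F> s)" "\<And>\<omega>. X s \<omega> \<notin> K \<Longrightarrow> Z \<omega> = 0"
  shows "(\<integral>\<^sup>+\<omega>. Z \<omega> * J \<phi> s \<omega> ^ n \<partial>N) \<ge> fact n * c ^ n * (\<integral>\<^sup>+\<omega>. Z \<omega> \<partial>N)"
  using assms(4-)
proof (induction n arbitrary: s Z)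
  case (Suc n)
  have Z [measurable]: "Z \<in> borel_measurable N" using Suc by (intro filtration_measurable)
  have "fact (Suc n) * c ^ Suc n * (\<integral>\<^sup>+\<omega>. Z \<omega> \<partial>N) = of_nat (Suc n) * (fact n * c ^ n * (c * (\<integral>\<^sup>+\<omega>. Z \<omega> \<partial>N)))"
    by (simp add: mult_ac)
  also have "\<dots> \<le> of_nat (Suc n) * (fact n * c ^ n * (\<integral>\<^sup>+\<omega>. Z \<omega> * J \<phi> s \<omega> \<partial>N))"
    by (intro mult_left_mono 1 Suc.prems) auto
  also have "\<dots> = of_nat (Suc n) * (\<integral>\<^sup>+r. (fact n * c ^ n) * (indicator {s..} r * (\<integral>\<^sup>+\<omega>. Z \<omega> * \<phi> (X (max 0 r) \<omega>) \<partial>N)) \<partial>lborel)"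
    unfolding J_integral[OF \<phi> Z] by (subst nn_integral_cmult) auto
  also have "\<dots> \<le> of_nat (Suc n) * (\<integral>\<^sup>+r. indicator {s..} r * (\<integral>\<^sup>+\<omega>. Z \<omega> * \<phi> (X (max 0 r) \<omega>) * J \<phi> r \<omega> ^ n \<partial>N) \<partial>lborel)"
  proof (intro mult_left_mono nn_integral_mono)
    fix r :: real
    show "indicator {s..} r * (\<integral>\<^sup>+\<omega>. Z \<omega> * \<phi> (X (max 0 r) \<omega>) * J \<phi> r \<omega> ^ n \<partial>N) \<ge>
      (fact n * c ^ n) * (indicator {s..} r * (\<integral>\<^sup>+\<omega>. Z \<omega> * \<phi> (X (max 0 r) \<omega>) \<partial>N))"
    proof (cases "s \<le> r")
      case True
      have [measurable]: "Z \<in> borel_measurable (\<F> r)" "X (max 0 r) \<in> borel_measurable (\<F> r)"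
        using filtration_mono[OF True Suc.prems(2)] Suc.prems(1) True by (auto intro: X_adapted)
      have "(\<integral>\<^sup>+\<omega>. Z \<omega> * \<phi> (X (max 0 r) \<omega>) * J \<phi> r \<omega> ^ n \<partial>N) \<ge> fact n * c ^ n * (\<integral>\<^sup>+\<omega>. Z \<omega> * \<phi> (X (max 0 r) \<omega>) \<partial>N)"
      proof (rule Suc.IH)
        show "(\<lambda>\<omega>. Z \<omega> * \<phi> (X (max 0 r) \<omega>)) \<in> borel_measurable (\<F> r)" by measurable
      qed (use Suc.prems(1) True K in auto)
      then show ?thesis using True by simp
    qed simp
  qed simp
  also have "\<dots> = (\<integral>\<^sup>+\<omega>. Z \<omega> * J \<phi> s \<omega> ^ Suc n \<partial>N)"
    by (rule J_power_integral[symmetric]) measurable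
  finally show ?case .
qed simp

text \<open>A shift of time by s and the Markov property at each later time turn estimates on the
  potential of the kernels into estimates conditional on the past of s.\<close>

lemma J_integral_markov:
  assumes s: "s \<ge> 0" and \<phi> [measurable]: "\<phi> \<in> borel_measurable borel" and Z: "Z \<in> borel_measurable (\<F> s)"
  shows "(\<integral>\<^sup>+\<omega>. Z \<omega> * J \<phi> s \<omega> \<partial>N) =
    (\<integral>\<^sup>+t. indicator {0..} t * (\<integral>\<^sup>+\<omega>. Z \<omega> * (\<integral>\<^sup>+y. \<phi> y \<partial>P (max 0 t) (max 0 (X s \<omega>))) \<partial>N) \<partial>lborel)"
proof -
  have ZN [measurable]: "Z \<in> borel_measurable N" using Z by (rule filtration_measurable)
  have "(\<integral>\<^sup>+\<omega>. Z \<omega> * J \<phi> s \<omega> \<partial>N) = (\<integral>\<^sup>+t. indicator {s..} (s + 1 * t) * (\<integral>\<^sup>+\<omega>. Z \<omega> * \<phi> (X (max 0 (s + 1 * t)) \<omega>) \<partial>N) \<partial>lborel)"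
    unfolding J_integral[OF \<phi> ZN] by (subst nn_integral_real_affine[where c=1 and t=s]) auto
  also have "\<dots> = (\<integral>\<^sup>+t. indicator {0..} t * (\<integral>\<^sup>+\<omega>. Z \<omega> * (\<integral>\<^sup>+y. \<phi> y \<partial>P (max 0 t) (max 0 (X s \<omega>))) \<partial>N) \<partial>lborel)"
  proof (rule nn_integral_cong)
    fix t :: real
    show "indicator {s..} (s + 1 * t) * (\<integral>\<^sup>+\<omega>. Z \<omega> * \<phi> (X (max 0 (s + 1 * t)) \<omega>) \<partial>N) =
      indicator {0..} t * (\<integral>\<^sup>+\<omega>. Z \<omega> * (\<integral>\<^sup>+y. \<phi> y \<partial>P (max 0 t) (max 0 (X s \<omega>))) \<partial>N)"
      using markov_nn_integral[OF s _ Z \<phi>, of t] s by (cases "t \<ge> 0") (auto simp: max_def)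
  qed
  finally show ?thesis .
qed

end

section \<open>Occupation times of half-lines\<close>

context levy
begin

text \<open>The hypothesis makes V t almost surely positive for almost every t in [0, 1]. Hence each
  d \<le> 1 splits into two good times, and V d is a sum of two almost surely positive increments;
  longer times are cut into steps of length at most 1.\<close>

lemma nonneg_if_positive_ae_time:
  assumes 0: "(\<integral>\<^sup>+t. indicator {0..1} t * (\<integral>\<^sup>+\<omega>. indicator {..0} (V (max 0 t) \<omega>) \<partial>M) \<partial>lborel) = 0"
    and h: "h > 0"
  shows "AE \<omega> in M. V h \<omega> \<ge> 0"
proof -
  define e where "e t = (\<integral>\<^sup>+\<omega>. indicator {..0} (V (max 0 t) \<omega>) \<partial>M)" for t :: real
  have [measurable]: "e \<in> borel_measurable borel" unfolding e_def by measurable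
  have e0: "AE \<omega> in M. V s \<omega> > 0" if "s \<ge> 0" "e s = 0" for s
  proof -
    have "AE \<omega> in M. (indicator {..0} (V (max 0 s) \<omega>) :: ennreal) = 0"
      using that(2) unfolding e_def by (subst (asm) nn_integral_0_iff_AE) auto
    then show ?thesis by eventually_elim (use that in \<open>auto simp: indicator_def split: if_splits\<close>)
  qed
  have small: "AE \<omega> in M. V d \<omega> \<ge> 0" if d: "0 < d" "d \<le> 1" for d
  proof -
    have ae1: "AE t in lborel. t \<in> {0..1} \<longrightarrow> e t = 0"
      using 0 unfolding e_def[symmetric] by (subst (asm) nn_integral_0_iff_AE) (auto simp: indicator_def)
    have "(\<integral>\<^sup>+t. indicator {0..1} (d + (-1) * t) * e (d + (-1) * t) \<partial>lborel) = 0"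
      using 0 unfolding e_def[symmetric] by (subst (asm) nn_integral_real_affine[where c="-1" and t=d]) auto
    then have ae2: "AE t in lborel. d - t \<in> {0..1} \<longrightarrow> e (d - t) = 0"
      by (subst (asm) nn_integral_0_iff_AE) (auto simp: indicator_def)
    \<comment> \<open>Almost every s in ]0, d[ is good, and so is d - s by reflection of the
      exceptional set; d \<le> 1 keeps both in [0, 1].\<close>
    have "\<exists>s\<in>{0<..<d}. e s = 0 \<and> e (d - s) = 0"
    proof (rule ccontr)
      assume neg: "\<not> ?thesis"
      have "AE s in lborel. s \<notin> {0<..<d}"
        using ae1 ae2 by eventually_elim (use d neg in auto)
      then have "emeasure lborel {0<..<d} = 0"
        by (subst (asm) AE_iff_measurable[of "{0<..<d}"]) auto
      then show False using d by simp
    qed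
    then obtain s where s: "0 < s" "s < d" "e s = 0" "e (d - s) = 0" by auto
    have "AE \<omega> in M. V (s + (d - s)) \<omega> - V s \<omega> > 0"
      using s by (intro AE_increment e0) auto
    moreover have "AE \<omega> in M. V s \<omega> > 0" using s by (intro e0) auto
    ultimately show ?thesis by eventually_elim simp
  qed
  obtain n :: nat where n: "h \<le> real (Suc n)" by (metis real_arch_simple of_nat_le_iff le_SucI order_trans order_refl)
  define d where "d = h / real (Suc n)"
  have d: "0 < d" "d \<le> 1" "real (Suc n) * d = h" using h n by (auto simp: d_def)
  have "AE \<omega> in M. V (real k * d) \<omega> \<ge> 0" for k
  proof (induction k)
    case 0
    then show ?case using V_0 by eventually_elim simp
  next
    case (Suc k)
    have "AE \<omega> in M. V (real k * d + d) \<omega> - V (real k * d) \<omega> \<ge> 0"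
      using d by (intro AE_increment small) auto
    then show ?case using Suc by eventually_elim (simp add: distrib_right add.commute)
  qed
  from this[of "Suc n"] show ?thesis unfolding d(3) .
qed

text \<open>Monotone convergence in the window, V and its running infimum being finite. Bounded
  increments with a bounded fall are what keep a path positive when it starts high enough.\<close>

lemma bounded_occupation:
  assumes pos: "(\<integral>\<^sup>+t. indicator {0..1} t * (\<integral>\<^sup>+\<omega>. indicator A (V (max 0 t) \<omega>) \<partial>M) \<partial>lborel) > 0"
    and A [measurable]: "A \<in> sets borel"
  shows "\<exists>m. \<forall>n\<ge>m. (\<integral>\<^sup>+t. indicator {0..1} t * (\<integral>\<^sup>+\<omega>. indicator A (V (max 0 t) \<omega>) *
    (indicator {- real n..real n} (V (max 0 t) \<omega>) * indicator {- real n..} (R (max 0 t) \<omega>)) \<partial>M) \<partial>lborel) > 0"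
proof -
  define h where "h n t \<omega> = (indicator A (V (max 0 t) \<omega>) *
    (indicator {- real n..real n} (V (max 0 t) \<omega>) * indicator {- real n..} (R (max 0 t) \<omega>)) :: ennreal)" for n t \<omega>
  have hm [measurable]: "(\<lambda>p. h n (fst p) (snd p)) \<in> borel_measurable (borel \<Otimes>\<^sub>M M)" for n
    unfolding h_def by measurable
  have hm' [measurable]: "h n t \<in> borel_measurable M" for n t unfolding h_def by measurable
  have hm'' [measurable]: "(\<lambda>t. \<integral>\<^sup>+\<omega>. h n t \<omega> \<partial>M) \<in> borel_measurable borel" for n
    by (rule borel_measurable_nn_integral) (use hm in \<open>simp add: split_beta\<close>)
  have inc: "h n t \<omega> \<le> h m t \<omega>" if "n \<le> m" for n m t \<omega>
    using that unfolding h_def by (auto simp: indicator_def)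
  have sup: "(SUP n. h n t \<omega>) = indicator A (V (max 0 t) \<omega>)" for t \<omega>
  proof (rule antisym)
    show "(SUP n. h n t \<omega>) \<le> indicator A (V (max 0 t) \<omega>)" by (intro SUP_least) (auto simp: h_def indicator_def)
    obtain n where "max \<bar>V (max 0 t) \<omega>\<bar> (- R (max 0 t) \<omega>) \<le> real n" using real_arch_simple by blast
    then show "indicator A (V (max 0 t) \<omega>) \<le> (SUP n. h n t \<omega>)"
      by (intro SUP_upper2[of n]) (auto simp: h_def indicator_def)
  qed
  define I where "I n = (\<integral>\<^sup>+t. indicator {0..1} t * (\<integral>\<^sup>+\<omega>. h n t \<omega> \<partial>M) \<partial>lborel)" for n
  have Iinc: "I n \<le> I m" if "n \<le> m" for n m
    unfolding I_def using inc[OF that] by (intro nn_integral_mono mult_left_mono) auto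
  have "(SUP n. I n) = (\<integral>\<^sup>+t. (SUP n. indicator {0..1} t * (\<integral>\<^sup>+\<omega>. h n t \<omega> \<partial>M)) \<partial>lborel)"
    unfolding I_def by (rule nn_integral_monotone_convergence_SUP[symmetric])
      (auto simp: incseq_def le_fun_def intro!: mult_left_mono nn_integral_mono inc)
  also have "\<dots> = (\<integral>\<^sup>+t. indicator {0..1} t * (\<integral>\<^sup>+\<omega>. indicator A (V (max 0 t) \<omega>) \<partial>M) \<partial>lborel)"
  proof (rule nn_integral_cong)
    fix t :: real
    have "(SUP n. \<integral>\<^sup>+\<omega>. h n t \<omega> \<partial>M) = (\<integral>\<^sup>+\<omega>. (SUP n. h n t \<omega>) \<partial>M)"
      by (rule nn_integral_monotone_convergence_SUP[symmetric]) (auto simp: incseq_def le_fun_def inc)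
    then show "(SUP n. indicator {0..1} t * (\<integral>\<^sup>+\<omega>. h n t \<omega> \<partial>M)) = indicator {0..1} t * (\<integral>\<^sup>+\<omega>. indicator A (V (max 0 t) \<omega>) \<partial>M)"
      unfolding sup by (simp add: SUP_mult_left_ennreal[symmetric])
  qed
  finally have "(SUP n. I n) > 0" using pos by simp
  then obtain m where m: "I m > 0" by (auto simp: less_SUP_iff)
  have "\<forall>n\<ge>m. I n > 0" using Iinc m by (meson less_le_trans)
  then show ?thesis unfolding I_def h_def by blast
qed

end

context levy_laplace
begin

text \<open>Nondecreasing paths without positive jumps have small increments on fine grids, so the
  sum of squares of exp (increment) - 1 over a grid of [0, 1] tends to 0. Its mean is the difference
  quotient at 0 of exp (d \<Psi> 2) - 2 exp (d \<Psi> 1) + 1, which tends to \<Psi> 2 - 2 \<Psi>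
  1.\<close>

lemma exponent_linear_if_nondecreasing:
  assumes mono: "AE \<omega> in M. mono_on {0..} (\<lambda>t. V t \<omega>)"
  shows "\<Psi> 2 = 2 * \<Psi> 1"
proof -
  define \<delta> where "\<delta> n = inverse (real (Suc n))" for n
  have \<delta>: "\<delta> n > 0" "real (Suc n) * \<delta> n = 1" for n by (auto simp: \<delta>_def)
  define S where "S n \<omega> = (\<Sum>k<Suc n. (exp (V (real k * \<delta> n + \<delta> n) \<omega> - V (real k * \<delta> n) \<omega>) - 1)^2)" for n \<omega>
  have [measurable]: "V (real k * \<delta> n) \<in> borel_measurable M" "V (real k * \<delta> n + \<delta> n) \<in> borel_measurable M" for k n
    using \<delta>(1)[of n] by (auto intro!: V_measurable add_nonneg_nonneg simp: less_imp_le)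
  have [measurable]: "S n \<in> borel_measurable M" for n unfolding S_def by measurable
  have [measurable]: "V (\<delta> n) \<in> borel_measurable M" for n using \<delta>(1)[of n] by (intro V_measurable) simp
  have sq: "(exp v - 1)^2 = exp (2 * v) - 2 * exp v + (1::real)" for v
    by (simp add: power2_eq_square algebra_simps exp_add[symmetric])
  have inc: "integrable M (\<lambda>\<omega>. (exp (V (real k * \<delta> n + \<delta> n) \<omega> - V (real k * \<delta> n) \<omega>) - 1)^2) \<and>
    expectation (\<lambda>\<omega>. (exp (V (real k * \<delta> n + \<delta> n) \<omega> - V (real k * \<delta> n) \<omega>) - 1)^2) = exp (\<delta> n * \<Psi> 2) - 2 * exp (\<delta> n * \<Psi> 1) + 1" for k n
  proof -
    have pos: "real k * \<delta> n \<ge> 0" "\<delta> n \<ge> 0" using \<delta>(1)[of n] by auto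
    have int: "integrable M (\<lambda>\<omega>. (exp (V (\<delta> n) \<omega>) - 1)^2)"
      unfolding sq using integrable_exp[OF pos(2), of 2] integrable_exp[OF pos(2), of 1] by simp
    have ex: "expectation (\<lambda>\<omega>. (exp (V (\<delta> n) \<omega>) - 1)^2) = exp (\<delta> n * \<Psi> 2) - 2 * exp (\<delta> n * \<Psi> 1) + 1"
      unfolding sq using integrable_exp[OF pos(2), of 2] integrable_exp[OF pos(2), of 1]
        expectation_exp[OF pos(2), of 2] expectation_exp[OF pos(2), of 1] by (simp add: prob_space)
    have "integrable (distr M borel (V (\<delta> n))) (\<lambda>v. (exp v - 1)^2)"
      using int by (subst integrable_distr_eq) auto
    moreover have "(\<integral>v. (exp v - 1)^2 \<partial>distr M borel (V (\<delta> n))) = exp (\<delta> n * \<Psi> 2) - 2 * exp (\<delta> n * \<Psi> 1) + 1"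
      using ex by (subst integral_distr) auto
    ultimately show ?thesis
      unfolding increments_stationary[OF pos, symmetric]
      by (simp add: integrable_distr_eq integral_distr)
  qed
  have ES: "expectation (S n) = (exp (\<delta> n * \<Psi> 2) - 2 * exp (\<delta> n * \<Psi> 1) + 1) / \<delta> n" for n
  proof -
    have "expectation (S n) = (\<Sum>k<Suc n. exp (\<delta> n * \<Psi> 2) - 2 * exp (\<delta> n * \<Psi> 1) + 1)"
      unfolding S_def using inc[of _ n]
      by (subst Bochner_Integration.integral_sum) (blast, intro sum.cong refl, blast)
    then show ?thesis by (simp add: \<delta>_def divide_inverse mult.commute del: of_nat_Suc)
  qed
  have AE_all: "AE \<omega> in M. V 0 \<omega> = 0 \<and> mono_on {0..} (\<lambda>t. V t \<omega>) \<and> \<omega> \<in> space M \<and> (\<forall>t>0. V t \<omega> - Lim (at_left t) (\<lambda>s. V s \<omega>) \<le> 0)"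
    using V_0 mono no_pos_jumps AE_space by eventually_elim auto
  \<comment> \<open>Since V \<ge> 0, exp (b - a) - 1 is at most exp b - exp a, which telescopes; the
    other factor of the square is bounded by e.\<close>
  have S_le: "S n \<omega> \<le> e * (exp (V 1 \<omega>) - 1) \<and> 0 \<le> S n \<omega>"
    if m: "mono_on {0..} (\<lambda>t. V t \<omega>)" "V 0 \<omega> = 0" and e: "\<And>k. k < Suc n \<Longrightarrow> exp (V (real k * \<delta> n + \<delta> n) \<omega> - V (real k * \<delta> n) \<omega>) - 1 \<le> e"
    for n \<omega> e
  proof -
    have *: "(exp (V (real k * \<delta> n + \<delta> n) \<omega> - V (real k * \<delta> n) \<omega>) - 1)^2 \<le> e * (exp (V (real (Suc k) * \<delta> n) \<omega>) - exp (V (real k * \<delta> n) \<omega>))"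
      if k: "k < Suc n" for k
    proof -
      let ?a = "V (real k * \<delta> n) \<omega>" and ?b = "V (real k * \<delta> n + \<delta> n) \<omega>"
      have a: "?a \<ge> 0" "?b \<ge> ?a" using mono_onD[OF m(1), of 0 "real k * \<delta> n"] mono_onD[OF m(1), of "real k * \<delta> n" "real k * \<delta> n + \<delta> n"] m(2) \<delta>(1)[of n] by auto
      have "exp (?b - ?a) - 1 \<le> exp ?a * (exp (?b - ?a) - 1)"
        using a mult_right_mono[of 1 "exp ?a" "exp (?b - ?a) - 1"] by simp
      also have "\<dots> = exp ?b - exp ?a" by (simp add: exp_diff right_diff_distrib)
      finally have "exp (?b - ?a) - 1 \<le> exp ?b - exp ?a" .
      then have "(exp (?b - ?a) - 1) * (exp (?b - ?a) - 1) \<le> e * (exp ?b - exp ?a)"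
        using e[OF k] a order_trans[OF _ e[OF k], of 0] by (intro mult_mono) auto
      moreover have "real (Suc k) * \<delta> n = real k * \<delta> n + \<delta> n" by (simp add: distrib_right)
      ultimately show ?thesis by (simp add: power2_eq_square)
    qed
    have "S n \<omega> \<le> (\<Sum>k<Suc n. e * (exp (V (real (Suc k) * \<delta> n) \<omega>) - exp (V (real k * \<delta> n) \<omega>)))"
      unfolding S_def using * by (intro sum_mono) auto
    also have "\<dots> = e * (exp (V (real (Suc n) * \<delta> n) \<omega>) - exp (V (real 0 * \<delta> n) \<omega>))"
      unfolding sum_distrib_left[symmetric] by (subst sum_lessThan_telescope) simp
    finally show ?thesis unfolding \<delta>(2) using m(2) by (simp add: S_def sum_nonneg)
  qed
  have "(\<lambda>n. expectation (S n)) \<longlonglongrightarrow> expectation (\<lambda>\<omega>. 0)"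
  proof (rule integral_dominated_convergence[where w="\<lambda>\<omega>. (exp (V 1 \<omega>) - 1)^2"])
    show "integrable M (\<lambda>\<omega>. (exp (V 1 \<omega>) - 1)^2)"
      unfolding sq using integrable_exp[of 1 2] integrable_exp[of 1 1] by simp
    show "AE \<omega> in M. norm (S n \<omega>) \<le> (exp (V 1 \<omega>) - 1)^2" for n
      using AE_all
    proof eventually_elim
      case (elim \<omega>)
      then have m: "mono_on {0..} (\<lambda>t. V t \<omega>)" "V 0 \<omega> = 0" by auto
      have "exp (V (real k * \<delta> n + \<delta> n) \<omega> - V (real k * \<delta> n) \<omega>) - 1 \<le> exp (V 1 \<omega>) - 1" if "k < Suc n" for k
      proof -
        have "real (Suc k) * \<delta> n \<le> 1" unfolding \<delta>(2)[of n, symmetric] using that \<delta>(1)[of n] by (intro mult_right_mono) auto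
        then have "real k * \<delta> n + \<delta> n \<le> 1" by (simp add: distrib_right)
        then have "V (real k * \<delta> n + \<delta> n) \<omega> \<le> V 1 \<omega>" "V (real k * \<delta> n) \<omega> \<ge> 0"
          using mono_onD[OF m(1), of "real k * \<delta> n + \<delta> n" 1] mono_onD[OF m(1), of 0 "real k * \<delta> n"] m(2) \<delta>(1)[of n] by auto
        then show ?thesis by simp
      qed
      from S_le[OF m this] show ?case by (simp add: power2_eq_square)
    qed
    show "AE \<omega> in M. (\<lambda>n. S n \<omega>) \<longlonglongrightarrow> 0"
      using AE_all
    proof eventually_elim
      case (elim \<omega>)
      then have m: "mono_on {0..} (\<lambda>t. V t \<omega>)" "V 0 \<omega> = 0" by auto
      define E where "E = exp (V 1 \<omega>) - 1"
      have E: "E \<ge> 0" using mono_onD[OF m(1), of 0 1] m(2) by (simp add: E_def)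
      show ?case
      proof (rule tendstoI)
        fix r :: real assume r: "r > 0"
        \<comment> \<open>Chosen so that exp e - 1 = r / (E + 1), whence the sum is at most r E / (E
          + 1) < r.\<close>
        define e where "e = ln (1 + r / (E + 1))"
        have "r / (E + 1) > 0" using r E by (intro divide_pos_pos) auto
        then have e: "e > 0" "exp e = 1 + r / (E + 1)" by (auto simp: e_def)
        obtain d where d: "d > 0" "\<And>s u. 0 \<le> s \<Longrightarrow> s \<le> u \<Longrightarrow> u \<le> 2 \<Longrightarrow> u \<le> s + d \<Longrightarrow> V u \<omega> \<le> V s \<omega> + e"
        proof (rule cadlag_no_pos_jump_increment[OF cadlag_V[of \<omega>] _ e(1), of 2])
          show "V t \<omega> \<le> Lim (at_left t) (\<lambda>s. V s \<omega>)" if "t > 0" for t using elim that by auto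
        qed (use that elim in auto)
        have "\<forall>\<^sub>F n in sequentially. \<delta> n < d"
          unfolding \<delta>_def using LIMSEQ_inverse_real_of_nat d(1) by (intro order_tendstoD) auto
        then show "\<forall>\<^sub>F n in sequentially. dist (S n \<omega>) 0 < r"
        proof eventually_elim
          case (elim n)
          have "exp (V (real k * \<delta> n + \<delta> n) \<omega> - V (real k * \<delta> n) \<omega>) - 1 \<le> r / (E + 1)" if "k < Suc n" for k
          proof -
            have "real (Suc k) * \<delta> n \<le> 1" unfolding \<delta>(2)[of n, symmetric] using that \<delta>(1)[of n] by (intro mult_right_mono) auto
            then have "real k * \<delta> n + \<delta> n \<le> 2" by (simp add: distrib_right)
            then have "V (real k * \<delta> n + \<delta> n) \<omega> \<le> V (real k * \<delta> n) \<omega> + e"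
              using \<delta>(1)[of n] elim by (intro d(2)) auto
            then have "exp (V (real k * \<delta> n + \<delta> n) \<omega> - V (real k * \<delta> n) \<omega>) \<le> exp e" by simp
            then show ?thesis unfolding e(2) by simp
          qed
          from S_le[OF m this] have "S n \<omega> \<le> r / (E + 1) * E" "0 \<le> S n \<omega>" by (auto simp: E_def)
          moreover have "r / (E + 1) * E < r" using r E by (simp add: field_simps)
          ultimately show ?case by simp
        qed
      qed
    qed
  qed auto
  then have lim0: "(\<lambda>n. (exp (\<delta> n * \<Psi> 2) - 2 * exp (\<delta> n * \<Psi> 1) + 1) / \<delta> n) \<longlonglongrightarrow> 0"
    unfolding ES by simp
  have "((\<lambda>d. exp (d * \<Psi> 2) - 2 * exp (d * \<Psi> 1) + 1) has_field_derivative (\<Psi> 2 - 2 * \<Psi> 1)) (at 0)"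
    by (auto intro!: derivative_eq_intros)
  then have "((\<lambda>d. (exp (d * \<Psi> 2) - 2 * exp (d * \<Psi> 1) + 1) / d) \<longlongrightarrow> \<Psi> 2 - 2 * \<Psi> 1) (at 0)"
    unfolding DERIV_def by simp
  moreover have "filterlim \<delta> (at 0) sequentially"
    unfolding filterlim_at using LIMSEQ_inverse_real_of_nat by (simp add: \<delta>_def[abs_def])
  ultimately have "(\<lambda>n. (exp (\<delta> n * \<Psi> 2) - 2 * exp (\<delta> n * \<Psi> 1) + 1) / \<delta> n) \<longlonglongrightarrow> \<Psi> 2 - 2 * \<Psi> 1"
    by (rule filterlim_compose)
  then have "\<Psi> 2 - 2 * \<Psi> 1 = 0" using lim0 by (rule LIMSEQ_unique)
  then show ?thesis by simp
qed

text \<open>\<Psi> 2 = 2 \<Psi> 1 makes the variance of exp (V t) vanish, so each V t is almost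
  surely constant; rational times and right continuity give one null set for all t.\<close>

lemma deterministic_if_nondecreasing:
  assumes mono: "AE \<omega> in M. mono_on {0..} (\<lambda>t. V t \<omega>)"
  shows "deterministic_drift M V"
proof -
  have const: "AE \<omega> in M. V t \<omega> = \<Psi> 1 * t" if t: "t \<ge> 0" for t
  proof -
    have [measurable]: "V t \<in> borel_measurable M" using t by (rule V_measurable)
    define m where "m = exp (t * \<Psi> 1)"
    have sq: "(exp v - m)^2 = exp (2 * v) - 2 * m * exp v + m^2" for v
      by (simp add: power2_eq_square algebra_simps exp_add[symmetric])
    have int: "integrable M (\<lambda>\<omega>. (exp (V t \<omega>) - m)^2)"
      unfolding sq using integrable_exp[OF t, of 2] integrable_exp[OF t, of 1] by simp
    have "expectation (\<lambda>\<omega>. (exp (V t \<omega>) - m)^2) = exp (t * \<Psi> 2) - 2 * m * exp (t * \<Psi> 1) + m^2"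
      unfolding sq using integrable_exp[OF t, of 2] integrable_exp[OF t, of 1]
        expectation_exp[OF t, of 2] expectation_exp[OF t, of 1] by (simp add: prob_space)
    also have "\<dots> = 0"
      unfolding exponent_linear_if_nondecreasing[OF mono]
      by (simp add: m_def power2_eq_square exp_add[symmetric] algebra_simps)
    finally have "AE \<omega> in M. (exp (V t \<omega>) - m)^2 = 0"
      using integral_nonneg_eq_0_iff_AE[OF int] by simp
    then show ?thesis by eventually_elim (simp add: m_def mult.commute)
  qed
  have "AE \<omega> in M. \<forall>t\<in>\<rat> \<inter> {0..}. V t \<omega> = \<Psi> 1 * t"
    by (subst AE_ball_countable) (auto intro: const countable_Int1 countable_rat)
  then have "AE \<omega> in M. \<forall>t\<ge>0. V t \<omega> = \<Psi> 1 * t"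
    using AE_space
  proof eventually_elim
    case (elim \<omega>)
    show ?case
    proof (intro allI impI)
      fix t :: real assume t: "t \<ge> 0"
      define g where "g n = real (Suc (nat \<lfloor>real (Suc n) * t\<rfloor>)) / real (Suc n)" for n
      have g: "g \<longlonglongrightarrow> t" "\<And>n. g n \<ge> t" using grid_approx_right[OF t] by (auto simp: g_def[abs_def] less_imp_le)
      have "(\<lambda>n. V (g n) \<omega>) \<longlonglongrightarrow> V t \<omega>" by (rule cadlag_tendsto_right[OF cadlag_V[OF elim(2)] t g])
      moreover have "V (g n) \<omega> = \<Psi> 1 * g n" for n
        using elim(1) by (auto simp: g_def simp del: of_nat_Suc)
      ultimately have "(\<lambda>n. \<Psi> 1 * g n) \<longlonglongrightarrow> V t \<omega>" by simp
      moreover have "(\<lambda>n. \<Psi> 1 * g n) \<longlonglongrightarrow> \<Psi> 1 * t" by (intro tendsto_intros g)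
      ultimately show "V t \<omega> = \<Psi> 1 * t" by (rule LIMSEQ_unique)
    qed
  qed
  then show ?thesis unfolding deterministic_drift_def by blast
qed

text \<open>Failure would make V nondecreasing, hence a pure drift.\<close>

lemma occupation_nonpos:
  assumes "\<not> deterministic_drift M V"
  shows "(\<integral>\<^sup>+t. indicator {0..1} t * (\<integral>\<^sup>+\<omega>. indicator {..0} (V (max 0 t) \<omega>) \<partial>M) \<partial>lborel) > 0"
proof (rule ccontr)
  assume "\<not> ?thesis"
  then have "(\<integral>\<^sup>+t. indicator {0..1} t * (\<integral>\<^sup>+\<omega>. indicator {..0} (V (max 0 t) \<omega>) \<partial>M) \<partial>lborel) = 0" by simp
  then have "AE \<omega> in M. mono_on {0..} (\<lambda>t. V t \<omega>)"
    by (intro nondecreasing_if_nonneg nonneg_if_positive_ae_time)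
  then show False using assms deterministic_if_nondecreasing by blast
qed

text \<open>Failure would make -V a subordinator.\<close>

lemma occupation_nonneg:
  "(\<integral>\<^sup>+t. indicator {0..1} t * (\<integral>\<^sup>+\<omega>. indicator {0..} (V (max 0 t) \<omega>) \<partial>M) \<partial>lborel) > 0"
proof (rule ccontr)
  assume "\<not> ?thesis"
  then have 0: "(\<integral>\<^sup>+t. indicator {0..1} t * (\<integral>\<^sup>+\<omega>. indicator {0..} (V (max 0 t) \<omega>) \<partial>M) \<partial>lborel) = 0" by simp
  interpret m: levy M "\<lambda>t \<omega>. - V t \<omega>" by (rule levy.intro levy_process_uminus levy)+
  have "indicator {..0} (- v) = (indicator {0..} v :: ennreal)" for v :: real by (auto simp: indicator_def)
  then have "AE \<omega> in M. mono_on {0..} (\<lambda>t. - V t \<omega>)"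
    using 0 by (intro m.nondecreasing_if_nonneg m.nonneg_if_positive_ae_time) auto
  then have "subordinator M (\<lambda>t \<omega>. - V t \<omega>)" using m.levy by (simp add: subordinator_def)
  then show False using not_neg_subordinator by simp
qed

end

section \<open>Tails and moments\<close>

text \<open>n^n / n! is one term of the series of exp n, and exp 1 \<le> 3.\<close>

lemma power_self_le_fact: "real n ^ n \<le> 3 ^ n * fact n"
proof -
  have s: "(\<lambda>k. real n ^ k /\<^sub>R fact k) sums exp (real n)" by (rule exp_converges)
  have "(\<Sum>k\<in>{n}. real n ^ k /\<^sub>R fact k) \<le> suminf (\<lambda>k. real n ^ k /\<^sub>R fact k)"
    by (rule sum_le_suminf) (use s in \<open>auto simp: sums_iff\<close>)
  then have "real n ^ n / fact n \<le> exp (real n)" using s by (simp add: sums_iff divide_inverse mult.commute)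
  also have "\<dots> = exp 1 ^ n" by (simp add: exp_of_nat_mult[symmetric])
  also have "\<dots> \<le> 3 ^ n" by (intro power_mono exp_le) simp
  finally show ?thesis by (simp add: divide_le_eq)
qed

text \<open>The central binomial coefficient is at most its row sum 4^n.\<close>

lemma fact_double_le: "(fact (2 * n) :: real) \<le> 4 ^ n * (fact n)\<^sup>2"
proof -
  have "real (2 * n choose n) \<le> real (2 ^ (2 * n))"
    using member_le_sum[of n "{..2 * n}" "\<lambda>k. (2 * n) choose k"] choose_row_sum[of "2 * n"] by (intro of_nat_mono) simp
  then have "real (2 * n choose n) \<le> 4 ^ n" by (simp add: power_mult)
  moreover have "real (2 * n choose n) = fact (2 * n) / (fact n * fact n)"
    using binomial_fact[of n "2 * n", where ?'a=real] by simp
  ultimately show ?thesis by (simp add: divide_le_eq power2_eq_square)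
qed

text \<open>In place of the Cauchy-Schwarz inequality, Y \<le> e/2 Y^2 + 1/(2 e) is used pointwise
  where Y \<ge> \<theta>, and Y \<le> \<theta> elsewhere. For B = 0 division by 0 makes the lower
  bound 0.\<close>

lemma (in prob_space) paley_zygmund:
  fixes Y :: "'a \<Rightarrow> real"
  assumes int: "integrable M Y" "integrable M (\<lambda>\<omega>. (Y \<omega>)\<^sup>2)"
    and L: "expectation Y \<ge> L" "L > 0" and B: "expectation (\<lambda>\<omega>. (Y \<omega>)\<^sup>2) \<le> B"
  shows "prob {\<omega>\<in>space M. Y \<omega> \<ge> L / 2} \<ge> (L / 2)\<^sup>2 / B"
proof -
  define \<theta> where "\<theta> = L / 2"
  have \<theta>: "\<theta> > 0" "L = 2 * \<theta>" using L by (auto simp: \<theta>_def)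
  have [measurable]: "Y \<in> borel_measurable M" using int by auto
  let ?A = "{\<omega>\<in>space M. Y \<omega> \<ge> \<theta>}"
  have B0: "B \<ge> 0" using B by (rule order_trans[rotated]) (simp add: integral_nonneg_AE)
  show ?thesis
  proof (cases "B = 0")
    case True
    then show ?thesis by simp
  next
    case False
    then have B1: "B > 0" using B0 by simp
    \<comment> \<open>With this e the second-moment term costs \<theta> / 2, half of the slack L -
      \<theta>.\<close>
    define e where "e = \<theta> / B"
    have e: "e > 0" using \<theta> B1 by (simp add: e_def)
    have pt: "Y \<omega> \<le> \<theta> + e / 2 * (Y \<omega>)\<^sup>2 + 1 / (2 * e) * indicator ?A \<omega>" if "\<omega> \<in> space M" for \<omega>
    proof (cases "Y \<omega> \<ge> \<theta>")
      case True
      have "0 \<le> (e * Y \<omega> - 1)\<^sup>2" by simp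
      then have "2 * (e * Y \<omega>) \<le> e\<^sup>2 * (Y \<omega>)\<^sup>2 + 1" by (simp add: power2_eq_square algebra_simps)
      then have "Y \<omega> \<le> e / 2 * (Y \<omega>)\<^sup>2 + 1 / (2 * e)" using e by (simp add: field_simps power2_eq_square)
      then show ?thesis using True that \<theta> by simp
    next
      case False
      then have "Y \<omega> \<le> \<theta>" by simp
      moreover have "0 \<le> e / 2 * (Y \<omega>)\<^sup>2" using e by simp
      moreover have "indicator ?A \<omega> = (0::real)" using False by simp
      ultimately show ?thesis by simp
    qed
    have "expectation Y \<le> expectation (\<lambda>\<omega>. \<theta> + e / 2 * (Y \<omega>)\<^sup>2 + 1 / (2 * e) * indicator ?A \<omega>)"
      using int by (intro integral_mono pt) (auto simp: emeasure_eq_measure)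
    also have "\<dots> = \<theta> + e / 2 * expectation (\<lambda>\<omega>. (Y \<omega>)\<^sup>2) + 1 / (2 * e) * prob ?A"
      using int by (simp add: prob_space emeasure_eq_measure)
    also have "\<dots> \<le> \<theta> + e / 2 * B + 1 / (2 * e) * prob ?A"
      using B e by (intro add_mono mult_left_mono) auto
    also have "e / 2 * B = \<theta> / 2" using B1 by (simp add: e_def)
    finally have "\<theta> / 2 \<le> 1 / (2 * e) * prob ?A" using L \<theta> by simp
    also have "\<dots> = B * prob ?A / (2 * \<theta>)" by (simp add: e_def)
    finally have "\<theta>\<^sup>2 \<le> B * prob ?A" using \<theta> by (simp add: field_simps power2_eq_square)
    then show ?thesis using B1 by (simp add: \<theta>_def[symmetric] pos_divide_le_eq mult.commute)
  qed
qed

text \<open>Paley-Zygmund for I^n: the mean is at least L = n! c^n \<rho> and the second moment at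
  most (2 n)! C^(2 n) \<le> 4^n (n!)^2 C^(2 n), so I^n \<ge> L / 2 has probability at least \<rho>^2
  / 4 times (c^2 / (4 C^2))^n. Taking n proportional to x brings L / 2 above x^n.\<close>

lemma (in prob_space) exponential_tail_lower:
  fixes I :: "'a \<Rightarrow> ennreal"
  assumes [measurable]: "I \<in> borel_measurable M" and pos: "C > 0" "c > 0" "\<rho> > 0"
    and upper: "\<And>n. (\<integral>\<^sup>+\<omega>. I \<omega> ^ n \<partial>M) \<le> ennreal (fact n * C ^ n)"
    and lower: "\<And>n. (\<integral>\<^sup>+\<omega>. I \<omega> ^ n \<partial>M) \<ge> ennreal (fact n * c ^ n * \<rho>)"
  shows "\<exists>K. \<forall>\<^sub>F x in at_top. exp (- K * x) \<le> prob {\<omega>\<in>space M. I \<omega> \<ge> ennreal x}"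
proof -
  define Y where "Y \<omega> = enn2real (I \<omega>)" for \<omega>
  have [measurable]: "Y \<in> borel_measurable M" unfolding Y_def by measurable
  have Y0: "Y \<omega> \<ge> 0" for \<omega> by (simp add: Y_def)
  have "(\<integral>\<^sup>+\<omega>. I \<omega> \<partial>M) \<noteq> \<infinity>" using upper[of 1] by (auto simp: top_unique)
  then have fin: "AE \<omega> in M. I \<omega> \<noteq> \<infinity>" by (intro nn_integral_PInf_AE) auto
  have nn: "(\<integral>\<^sup>+\<omega>. ennreal (Y \<omega> ^ n) \<partial>M) = (\<integral>\<^sup>+\<omega>. I \<omega> ^ n \<partial>M)" for n
    by (rule nn_integral_cong_AE)
      (use fin in eventually_elim, auto simp: Y_def ennreal_power[symmetric] less_top)
  have int: "integrable M (\<lambda>\<omega>. Y \<omega> ^ n)" for n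
    using Y0 le_less_trans[OF upper[of n] ennreal_less_top] by (intro integrableI_nonneg) (auto simp: nn)
  have ex: "ennreal (expectation (\<lambda>\<omega>. Y \<omega> ^ n)) = (\<integral>\<^sup>+\<omega>. I \<omega> ^ n \<partial>M)" for n
    using Y0 by (subst nn_integral_eq_integral[OF int, symmetric]) (auto simp: nn)
  have exle: "expectation (\<lambda>\<omega>. Y \<omega> ^ n) \<le> fact n * C ^ n" for n
    using upper[of n] pos unfolding ex[symmetric] by (subst (asm) ennreal_le_iff) auto
  have exge: "expectation (\<lambda>\<omega>. Y \<omega> ^ n) \<ge> fact n * c ^ n * \<rho>" for n
    using lower[of n] Y0 unfolding ex[symmetric] by (subst (asm) ennreal_le_iff) (auto intro!: integral_nonneg_AE)
  \<comment> \<open>The minimum with 1 / 2 ensures \<beta> < 1, so that an upper bound on n is a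
    lower bound on \<beta>^n.\<close>
  define \<beta> where "\<beta> = min (c\<^sup>2 / (4 * C\<^sup>2)) (1 / 2)"
  have \<beta>: "0 < \<beta>" "\<beta> < 1" "\<beta> \<le> c\<^sup>2 / (4 * C\<^sup>2)" using pos by (auto simp: \<beta>_def)
  have tail: "\<rho>\<^sup>2 / 4 * \<beta> ^ n \<le> prob {\<omega>\<in>space M. I \<omega> \<ge> ennreal x}"
    if x: "x > 0" and n: "real n \<ge> 6 * x / c" "2 ^ n * \<rho> \<ge> 2" for x n
  proof -
    define L where "L = fact n * c ^ n * \<rho>"
    have L: "L > 0" using pos by (simp add: L_def)
    have n0: "n > 0" using n(1) x pos by (cases "n = 0") (auto simp: divide_le_0_iff mult_le_0_iff)
    have "expectation (\<lambda>\<omega>. (Y \<omega> ^ n)\<^sup>2) \<le> fact (2 * n) * C ^ (2 * n)"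
      using exle[of "2 * n"] by (simp add: power_mult[symmetric] mult.commute)
    moreover have "integrable M (\<lambda>\<omega>. (Y \<omega> ^ n)\<^sup>2)" using int[of "2 * n"] by (simp add: power_mult[symmetric] mult.commute)
    ultimately have pz: "(L / 2)\<^sup>2 / (fact (2 * n) * C ^ (2 * n)) \<le> prob {\<omega>\<in>space M. Y \<omega> ^ n \<ge> L / 2}"
      using int[of n] exge[of n] L by (intro paley_zygmund) (auto simp: L_def)
    \<comment> \<open>n \<ge> 6 x / c and n^n \<le> 3^n n! give n! c^n \<ge> (2 x)^n; the spare
      factor 2^n absorbs 2 / \<rho>.\<close>
    have "x ^ n * 2 \<le> x ^ n * (2 ^ n * \<rho>)" using n x by (intro mult_left_mono) auto
    also have "\<dots> = (2 * x) ^ n * \<rho>" by (simp add: power_mult_distrib)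
    also have "\<dots> \<le> (real n * c / 3) ^ n * \<rho>"
    proof -
      have "2 * x \<le> real n * c / 3" using n(1) pos by (simp add: field_simps)
      then show ?thesis using x pos by (intro mult_right_mono power_mono) auto
    qed
    also have "(real n * c / 3) ^ n = real n ^ n * c ^ n / 3 ^ n" by (simp add: power_mult_distrib power_divide)
    also have "real n ^ n * c ^ n / 3 ^ n * \<rho> \<le> L"
    proof -
      have "real n ^ n * c ^ n \<le> 3 ^ n * fact n * c ^ n" using power_self_le_fact[of n] pos by (intro mult_right_mono) auto
      then have "real n ^ n * c ^ n / 3 ^ n \<le> fact n * c ^ n" by (simp add: field_simps)
      then show ?thesis unfolding L_def using pos by (intro mult_right_mono) auto
    qed
    finally have xL: "x ^ n \<le> L / 2" by simp
    have sub: "I \<omega> \<ge> ennreal x" if "Y \<omega> ^ n \<ge> L / 2" for \<omega>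
    proof -
      have "x ^ n \<le> Y \<omega> ^ n" using xL that by simp
      then have "x \<le> Y \<omega>" using n0 Y0 x by (simp add: power_mono_iff)
      moreover have "I \<omega> \<noteq> \<infinity>" using \<open>x \<le> Y \<omega>\<close> x by (auto simp: Y_def)
      ultimately show ?thesis unfolding Y_def by (metis ennreal_enn2real ennreal_leI infinity_ennreal_def less_top)
    qed
    have "\<rho>\<^sup>2 / 4 * \<beta> ^ n \<le> \<rho>\<^sup>2 / 4 * (c\<^sup>2 / (4 * C\<^sup>2)) ^ n"
      using \<beta> by (intro mult_left_mono power_mono) auto
    also have "\<dots> = \<rho>\<^sup>2 / 4 * c ^ (2 * n) / (4 ^ n * C ^ (2 * n))"
      by (simp add: power_divide power_mult_distrib power_mult)
    also have "\<dots> = (L / 2)\<^sup>2 / (4 ^ n * (fact n)\<^sup>2 * C ^ (2 * n))"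
      using pos by (simp add: L_def power2_eq_square field_simps power_mult_distrib mult_2_right power_add)
    also have "\<dots> \<le> (L / 2)\<^sup>2 / (fact (2 * n) * C ^ (2 * n))"
      using fact_double_le[of n] pos by (intro divide_left_mono mult_right_mono mult_pos_pos) auto
    also have "\<dots> \<le> prob {\<omega>\<in>space M. Y \<omega> ^ n \<ge> L / 2}" by (rule pz)
    also have "\<dots> \<le> prob {\<omega>\<in>space M. I \<omega> \<ge> ennreal x}" using sub by (intro finite_measure_mono) auto
    finally show ?thesis .
  qed
  \<comment> \<open>With n \<le> 6 x / c + 1 the factor \<beta>^n costs the rate - 6 ln \<beta> / c;
    the additional 1 pays for the constant \<rho>^2 \<beta> / 4 through exp (- x).\<close>
  define K where "K = 1 - 6 * ln \<beta> / c"
  have "((\<lambda>x. exp (- x)) \<longlongrightarrow> 0) (at_top :: real filter)"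
    by (rule filterlim_compose[OF exp_at_bot filterlim_uminus_at_bot_at_top])
  then have e1: "\<forall>\<^sub>F x in at_top. exp (- x) < \<rho>\<^sup>2 / 4 * \<beta>" for x :: real
    using pos \<beta> by (intro order_tendstoD) auto
  have "\<forall>\<^sub>F x in at_top. (6 / c) * x \<ge> (2 / \<rho>)"
  proof -
    have "LIM x at_top. (6 / c) * x :> at_top"
      using pos by (intro filterlim_tendsto_pos_mult_at_top[OF tendsto_const] filterlim_ident) auto
    then show ?thesis by (simp add: filterlim_at_top)
  qed
  then have "\<forall>\<^sub>F x in at_top. exp (- K * x) \<le> prob {\<omega>\<in>space M. I \<omega> \<ge> ennreal x}"
    using e1 eventually_gt_at_top[of 0]
  proof eventually_elim
    case (elim x)
    define n where "n = nat \<lceil>6 * x / c\<rceil>"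
    have q: "6 * x / c \<ge> 0" using elim pos by simp
    have n: "real n \<ge> 6 * x / c" "real n \<le> 6 * x / c + 1" using q unfolding n_def by linarith+
    have "2 / \<rho> \<le> real n" using elim(1) n(1) by simp
    also have "\<dots> \<le> 2 ^ n" using of_nat_less_two_power[of n, where ?'a=real] by simp
    finally have n2: "2 ^ n * \<rho> \<ge> 2" using pos by (simp add: field_simps)
    have "- K * x = - x + (6 * x / c) * ln \<beta>" using pos by (simp add: K_def field_simps)
    then have "exp (- K * x) = exp (- x) * exp ((6 * x / c) * ln \<beta>)" by (simp only: exp_add)
    also have "\<dots> \<le> (\<rho>\<^sup>2 / 4 * \<beta>) * exp ((6 * x / c) * ln \<beta>)"
      using elim by (intro mult_right_mono) auto
    also have "\<dots> = \<rho>\<^sup>2 / 4 * exp ((6 * x / c + 1) * ln \<beta>)"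
      using \<beta> by (simp add: exp_add distrib_right)
    also have "\<dots> \<le> \<rho>\<^sup>2 / 4 * exp (real n * ln \<beta>)"
      using n \<beta> by (intro mult_left_mono) (auto intro!: mult_right_mono_neg)
    also have "exp (real n * ln \<beta>) = \<beta> ^ n" using \<beta> by (simp add: exp_of_nat_mult)
    finally show ?case using tail[OF elim(3) n(1) n2] by simp
  qed
  then show ?thesis by blast
qed

text \<open>In the expanded exponential the factorials cancel and a geometric series of ratio q C <
  1 remains. For q < 0 the integrand is at most 1.\<close>

lemma (in prob_space) exponential_moments:
  fixes I :: "'a \<Rightarrow> ennreal"
  assumes [measurable]: "I \<in> borel_measurable M" and C: "C > 0"
    and upper: "\<And>n. (\<integral>\<^sup>+\<omega>. I \<omega> ^ n \<partial>M) \<le> ennreal (fact n * C ^ n)"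
    and q: "q < 1 / C"
  shows "integrable M (\<lambda>\<omega>. exp (q * enn2real (I \<omega>)))"
proof (cases "q \<ge> 0")
  case False
  then show ?thesis
    by (intro integrable_const_bound[where B=1]) (auto simp: mult_nonpos_nonneg)
next
  case q0: True
  have "(\<integral>\<^sup>+\<omega>. I \<omega> \<partial>M) \<noteq> \<infinity>" using upper[of 1] by (auto simp: top_unique)
  then have fin: "AE \<omega> in M. I \<omega> \<noteq> \<infinity>" by (intro nn_integral_PInf_AE) auto
  have exp_sum: "ennreal (exp (q * r)) = (\<Sum>n. ennreal (q ^ n / fact n) * ennreal r ^ n)" if "r \<ge> 0" for r
  proof -
    have s: "(\<lambda>n. (q * r) ^ n /\<^sub>R fact n) sums exp (q * r)" by (rule exp_converges)
    have "(\<Sum>n. ennreal ((q * r) ^ n /\<^sub>R fact n)) = ennreal (exp (q * r))"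
      using s that q0 by (subst suminf_ennreal2) (auto simp: sums_iff)
    moreover have "ennreal ((q * r) ^ n /\<^sub>R fact n) = ennreal (q ^ n / fact n) * ennreal r ^ n" for n
      using that q0 by (simp add: ennreal_power ennreal_mult[symmetric] power_mult_distrib divide_inverse mult_ac)
    ultimately show ?thesis by simp
  qed
  have "(\<integral>\<^sup>+\<omega>. ennreal (exp (q * enn2real (I \<omega>))) \<partial>M) = (\<integral>\<^sup>+\<omega>. (\<Sum>n. ennreal (q ^ n / fact n) * I \<omega> ^ n) \<partial>M)"
    by (rule nn_integral_cong_AE) (use fin in eventually_elim, auto simp: exp_sum less_top)
  also have "\<dots> = (\<Sum>n. ennreal (q ^ n / fact n) * (\<integral>\<^sup>+\<omega>. I \<omega> ^ n \<partial>M))"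
    by (subst nn_integral_suminf) (auto simp: nn_integral_cmult)
  also have "\<dots> \<le> (\<Sum>n. ennreal ((q * C) ^ n))"
  proof (rule suminf_le)
    fix n
    have "ennreal (q ^ n / fact n) * (\<integral>\<^sup>+\<omega>. I \<omega> ^ n \<partial>M) \<le> ennreal (q ^ n / fact n) * ennreal (fact n * C ^ n)"
      by (intro mult_left_mono upper) simp
    also have "\<dots> = ennreal ((q * C) ^ n)"
      using q0 C by (simp add: ennreal_mult[symmetric] power_mult_distrib)
    finally show "ennreal (q ^ n / fact n) * (\<integral>\<^sup>+\<omega>. I \<omega> ^ n \<partial>M) \<le> ennreal ((q * C) ^ n)" .
  qed auto
  also have "\<dots> < \<infinity>"
  proof -
    have "norm (q * C) < 1" using q q0 C by (simp add: field_simps)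
    then have "summable (\<lambda>n. (q * C) ^ n)" by (rule summable_geometric)
    then show ?thesis using q0 C by (subst suminf_ennreal2) auto
  qed
  finally show ?thesis by (intro integrableI_nonneg) auto
qed

text \<open>Markov's inequality at the larger rate q; the surplus q - k absorbs the constant E for
  large x.\<close>

lemma (in prob_space) exponential_tail_upper:
  fixes I :: "'a \<Rightarrow> ennreal"
  assumes [measurable]: "I \<in> borel_measurable M" and fin: "AE \<omega> in M. I \<omega> < \<infinity>"
    and int: "integrable M (\<lambda>\<omega>. exp (q * enn2real (I \<omega>)))" and k: "0 \<le> k" "k < q"
  shows "\<forall>\<^sub>F x in at_top. prob {\<omega>\<in>space M. I \<omega> \<ge> ennreal x} \<le> exp (- k * x)"
proof -
  define E where "E = expectation (\<lambda>\<omega>. exp (q * enn2real (I \<omega>)))"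
  have "((\<lambda>x. exp ((q - k) * x)) \<longlongrightarrow> 0) at_bot"
    using k by (intro filterlim_compose[OF exp_at_bot] filterlim_tendsto_pos_mult_at_bot[OF tendsto_const] filterlim_ident) auto
  then have "((\<lambda>x. E * exp (- (q - k) * x)) \<longlongrightarrow> E * 0) at_top"
    unfolding at_bot_mirror by (intro tendsto_intros) (simp add: filterlim_filtermap algebra_simps)
  then have "\<forall>\<^sub>F x in at_top. E * exp (- (q - k) * x) < 1"
    by (intro order_tendstoD) auto
  then show ?thesis using eventually_ge_at_top[of 0]
  proof eventually_elim
    case (elim x)
    have "exp (q * x) * prob {\<omega>\<in>space M. I \<omega> \<ge> ennreal x} = expectation (\<lambda>\<omega>. exp (q * x) * indicator {\<omega>\<in>space M. I \<omega> \<ge> ennreal x} \<omega>)"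
      by simp
    also have "\<dots> \<le> E"
      unfolding E_def
    proof (rule integral_mono_AE)
      show "AE \<omega> in M. exp (q * x) * indicator {\<omega>\<in>space M. I \<omega> \<ge> ennreal x} \<omega> \<le> exp (q * enn2real (I \<omega>))"
        using fin
      proof eventually_elim
        case (elim \<omega>)
        have "x \<le> enn2real (I \<omega>)" if "I \<omega> \<ge> ennreal x"
          using enn2real_mono[OF that] elim \<open>0 \<le> x\<close> by simp
        then show ?case using k by (auto simp: indicator_def)
      qed
    qed (use int in \<open>auto simp: emeasure_eq_measure\<close>)
    finally have "prob {\<omega>\<in>space M. I \<omega> \<ge> ennreal x} \<le> E * exp (- q * x)"
      by (simp add: exp_minus field_simps)
    also have "\<dots> = (E * exp (- (q - k) * x)) * exp (- k * x)"
      by (simp add: mult.assoc exp_add[symmetric] algebra_simps)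
    also have "\<dots> \<le> 1 * exp (- k * x)" using elim by (intro mult_right_mono) auto
    finally show ?case by simp
  qed
qed

lemma fact_ennreal: "(fact n :: ennreal) = ennreal (fact n)"
  by (metis ennreal_of_nat_eq_real_of_nat of_nat_fact)

section \<open>The process conditioned to stay positive\<close>

locale conditioned_levy = levy_scale M V \<Psi> W
  for M :: "'a measure" and V :: "real \<Rightarrow> 'a \<Rightarrow> real" and \<Psi> W :: "real \<Rightarrow> real" +
  fixes N :: "'b measure" and X :: "real \<Rightarrow> 'b \<Rightarrow> real" and P :: "real \<Rightarrow> real \<Rightarrow> real measure"
  assumes cadlag_X: "cadlag_process N X" and markov_X: "markov_process N X P"
    and nonneg_X: "AE \<omega> in N. \<forall>t\<ge>0. X t \<omega> \<ge> 0"
    and feller: "feller_semigroup P"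
    and P_eq: "\<And>t x. t \<ge> 0 \<Longrightarrow> x > 0 \<Longrightarrow> P t x = p_up M V W t x"
begin

lemma P_props:
  assumes "t \<ge> 0" "x \<ge> 0"
  shows "sets (P t x) = sets borel" "prob_space (P t x)" "AE y in P t x. y \<ge> 0"
  using feller assms by (auto simp: feller_semigroup_def)

text \<open>Joint measurability in t and x is visible on the expectation formula, in which W x may
  be replaced by the Borel function \<open>Wp\<close> because x > 0.\<close>

lemma p_up_integral_measurable:
  assumes [measurable]: "h \<in> borel_measurable borel"
  shows "(\<lambda>p. if snd p > 0 then \<integral>\<^sup>+y. h y \<partial>p_up M V W (max 0 (fst p)) (snd p) else 0) \<in> borel_measurable (borel \<Otimes>\<^sub>M borel)"
proof -
  have "(\<lambda>p. if snd p > 0 then \<integral>\<^sup>+y. h y \<partial>p_up M V W (max 0 (fst p)) (snd p) else 0) =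
    (\<lambda>p. if snd p > 0 then \<integral>\<^sup>+\<omega>. indicator {0<..} (snd p + R (max 0 (fst p)) \<omega>) *
      (ennreal (Wp (snd p + V (max 0 (fst p)) \<omega>) / Wp (snd p)) * h (snd p + V (max 0 (fst p)) \<omega>)) \<partial>M else 0)"
    by (auto simp: nn_integral_p_up Wp_pos fun_eq_iff)
  also have "\<dots> \<in> borel_measurable (borel \<Otimes>\<^sub>M borel)" by measurable
  finally show ?thesis .
qed

lemma kernel_measurable:
  assumes t: "t \<ge> 0"
  shows "(\<lambda>x. P t (max 0 x)) \<in> borel \<rightarrow>\<^sub>M subprob_algebra borel"
proof (rule measurable_subprob_algebra)
  show "subprob_space (P t (max 0 x))" "sets (P t (max 0 x)) = sets borel" for x
    using P_props[OF t, of "max 0 x"] by (auto intro: prob_space_imp_subprob_space)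
  fix B :: "real set" assume B [measurable]: "B \<in> sets borel"
  have "(\<lambda>x. if x > 0 then \<integral>\<^sup>+y. indicator B y \<partial>p_up M V W (max 0 t) x else 0) \<in> borel_measurable borel"
    using measurable_compose[OF measurable_Pair1' p_up_integral_measurable[of "indicator B"], of t] by (simp cong: if_cong)
  moreover have "max 0 t = t" using t by simp
  ultimately have [measurable]: "(\<lambda>x. if x > 0 then \<integral>\<^sup>+y. indicator B y \<partial>p_up M V W t x else 0) \<in> borel_measurable borel"
    by (simp only:)
  have "(\<lambda>x. emeasure (P t (max 0 x)) B) =
    (\<lambda>x. if x > 0 then (if x > 0 then \<integral>\<^sup>+y. indicator B y \<partial>p_up M V W t x else 0) else emeasure (P t 0) B)"
  proof
    fix x :: real
    have "sets (p_up M V W t x) = sets borel" by (simp add: p_up_def killed_law_def)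
    then show "emeasure (P t (max 0 x)) B = (if x > 0 then (if x > 0 then \<integral>\<^sup>+y. indicator B y \<partial>p_up M V W t x else 0) else emeasure (P t 0) B)"
      using P_eq[OF t, of x] by (auto simp: max_def)
  qed
  then show "(\<lambda>x. emeasure (P t (max 0 x)) B) \<in> borel_measurable borel" by simp
qed

sublocale X: cadlag_markov N X P
  by (rule cadlag_markov.intro) (fact cadlag_X markov_X nonneg_X kernel_measurable)+

definition f :: "real \<Rightarrow> ennreal" where "f y = ennreal (exp (- y))"

lemma f_measurable [measurable]: "f \<in> borel_measurable borel"
  unfolding f_def by measurable

definition Pf :: "real \<Rightarrow> real \<Rightarrow> ennreal" where "Pf t x = (\<integral>\<^sup>+y. f y \<partial>P (max 0 t) (max 0 x))"

text \<open>exp (- y) is continuous on the half-line and vanishes at infinity, so the Feller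
  property makes its image under P t continuous at 0.\<close>

lemma Pf_at_0: "(\<lambda>n. Pf t (inverse (real (Suc n)))) \<longlonglongrightarrow> Pf t 0"
proof -
  define s where "s = max 0 t"
  have s: "s \<ge> 0" by (simp add: s_def)
  have "C0_nonneg (\<lambda>y. exp (- y))"
    unfolding C0_nonneg_def by (auto intro!: continuous_intros filterlim_compose[OF exp_at_bot filterlim_uminus_at_bot_at_top])
  then have c: "continuous_on {0..} (\<lambda>x. LINT y:{0..}|P s x. exp (- y))"
    using feller s unfolding feller_semigroup_def C0_nonneg_def by blast
  have eq: "Pf t x = ennreal (LINT y:{0..}|P s x. exp (- y))" if x: "x \<ge> 0" for x
  proof -
    note p = P_props[OF s x]
    interpret p: prob_space "P s x" by (rule p)
    have [measurable_cong]: "sets (P s x) = sets borel" by (rule p)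
    have int: "integrable (P s x) (\<lambda>y. indicator {0..} y *\<^sub>R exp (- y))"
      by (intro p.integrable_const_bound[where B=1]) (auto simp: indicator_def)
    have "Pf t x = (\<integral>\<^sup>+y. ennreal (indicator {0..} y *\<^sub>R exp (- y)) \<partial>P s x)"
      unfolding Pf_def f_def using x
      by (simp add: s_def[symmetric]) (rule nn_integral_cong_AE, use p(3) in eventually_elim, auto)
    also have "\<dots> = ennreal (LINT y:{0..}|P s x. exp (- y))"
      unfolding set_lebesgue_integral_def by (rule nn_integral_eq_integral[OF int]) auto
    finally show ?thesis .
  qed
  have "(\<lambda>n. LINT y:{0..}|P s (inverse (real (Suc n))). exp (- y)) \<longlonglongrightarrow> (LINT y:{0..}|P s 0. exp (- y))"
    using c LIMSEQ_inverse_real_of_nat unfolding continuous_on_sequentially o_def by fastforce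
  then show ?thesis unfolding eq[OF order_refl] by (subst eq) (auto intro: tendsto_ennrealI)
qed

lemma Pf_measurable [measurable]: "(\<lambda>p. Pf (fst p) (snd p)) \<in> borel_measurable (borel \<Otimes>\<^sub>M borel)"
proof -
  define h where "h t x = (if x > 0 then \<integral>\<^sup>+y. f y \<partial>p_up M V W (max 0 t) x else 0)" for t x :: real
  have [measurable]: "(\<lambda>p. h (fst p) (snd p)) \<in> borel_measurable (borel \<Otimes>\<^sub>M borel)"
    unfolding h_def by (rule p_up_integral_measurable) measurable
  have h: "Pf t x = h t x" if "x > 0" for t x
    using P_eq[of "max 0 t" x] that by (simp add: Pf_def h_def)
  have "(\<lambda>p. Pf (fst p) (snd p)) = (\<lambda>p. if snd p > 0 then h (fst p) (snd p) else
      liminf (\<lambda>n. h (fst p) (inverse (real (Suc n)))))"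
  proof
    fix p :: "real \<times> real"
    have "(\<lambda>n. h (fst p) (inverse (real (Suc n)))) \<longlonglongrightarrow> Pf (fst p) 0"
      using Pf_at_0[of "fst p"] by (subst (asm) h) auto
    then have "liminf (\<lambda>n. h (fst p) (inverse (real (Suc n)))) = Pf (fst p) 0"
      by (intro lim_imp_Liminf) auto
    moreover have "Pf (fst p) (snd p) = Pf (fst p) 0" if "\<not> snd p > 0"
      using that by (simp add: Pf_def max_def)
    ultimately show "Pf (fst p) (snd p) = (if snd p > 0 then h (fst p) (snd p) else
      liminf (\<lambda>n. h (fst p) (inverse (real (Suc n)))))" using h by simp
  qed
  also have "\<dots> \<in> borel_measurable (borel \<Otimes>\<^sub>M borel)"
  proof -
    have "(\<lambda>p. h (fst p) (inverse (real (Suc n)))) \<in> borel_measurable (borel \<Otimes>\<^sub>M (borel :: real measure))" for n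
      using measurable_compose[OF _ \<open>(\<lambda>p. h (fst p) (snd p)) \<in> borel_measurable (borel \<Otimes>\<^sub>M borel)\<close>,
        of "\<lambda>p. (fst p, inverse (real (Suc n)))" "borel \<Otimes>\<^sub>M (borel :: real measure)"] by simp
    then show ?thesis by measurable
  qed
  finally show ?thesis .
qed

text \<open>Fatou's lemma carries \<open>p_up_potential\<close> from the points 1 / (n + 1) to 0;
  negative x are clipped to 0.\<close>

lemma Pf_potential: "(\<integral>\<^sup>+t. indicator {0..} t * Pf t x \<partial>lborel) \<le> ennreal C"
proof -
  have [measurable]: "(\<lambda>t. Pf t x) \<in> borel_measurable borel" for x
    using measurable_compose[OF measurable_Pair2' Pf_measurable, of x] by simp
  have pos: "(\<integral>\<^sup>+t. indicator {0..} t * Pf t x \<partial>lborel) \<le> ennreal C" if "x > 0" for x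
    using p_up_potential[OF that] P_eq[OF _ that] that by (simp add: Pf_def f_def)
  show ?thesis
  proof (cases "x > 0")
    case False
    then have "(\<integral>\<^sup>+t. indicator {0..} t * Pf t x \<partial>lborel) = (\<integral>\<^sup>+t. indicator {0..} t * Pf t 0 \<partial>lborel)"
      by (simp add: Pf_def max_def)
    also have "\<dots> = (\<integral>\<^sup>+t. liminf (\<lambda>n. indicator {0..} t * Pf t (inverse (real (Suc n)))) \<partial>lborel)"
    proof (rule nn_integral_cong)
      fix t :: real
      show "indicator {0..} t * Pf t 0 = liminf (\<lambda>n. indicator {0..} t * Pf t (inverse (real (Suc n))))"
        using lim_imp_Liminf[OF _ Pf_at_0[of t]] by (auto simp: indicator_def Liminf_const)
    qed
    also have "\<dots> \<le> liminf (\<lambda>n. \<integral>\<^sup>+t. indicator {0..} t * Pf t (inverse (real (Suc n))) \<partial>lborel)"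
      by (rule nn_integral_liminf) measurable
    also have "\<dots> \<le> liminf (\<lambda>n :: nat. ennreal C)"
      by (intro Liminf_mono always_eventually allI pos) simp
    also have "\<dots> = ennreal C" by (simp add: Liminf_const)
    finally show ?thesis .
  qed (rule pos)
qed

lemma exp_functional_eq: "exp_functional X \<omega> = X.J f 0 \<omega>"
  unfolding exp_functional_def X.J_def f_def
  by (intro nn_integral_cong) (auto simp: indicator_def)

lemma exp_functional_measurable: "exp_functional X \<in> borel_measurable N"
proof -
  have "(\<lambda>\<omega>. X.J f 0 \<omega>) \<in> borel_measurable N" by measurable
  then show ?thesis by (simp add: exp_functional_eq[abs_def])
qed

lemma J_f_le:
  assumes s: "s \<ge> 0" and Z: "Z \<in> borel_measurable (X.\<F> s)"
  shows "(\<integral>\<^sup>+\<omega>. Z \<omega> * X.J f s \<omega> \<partial>N) \<le> ennreal C * (\<integral>\<^sup>+\<omega>. Z \<omega> \<partial>N)"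
proof -
  have [measurable]: "Z \<in> borel_measurable N" "X s \<in> borel_measurable N"
    using Z s by (auto intro: X.filtration_measurable X.X_measurable)
  interpret Q: pair_sigma_finite lborel N ..
  have Pfm: "(\<lambda>p. Pf (fst p) (X s (snd p))) \<in> borel_measurable (lborel \<Otimes>\<^sub>M N)"
    using measurable_compose[OF _ Pf_measurable, of "\<lambda>p. (fst p, X s (snd p))" "lborel \<Otimes>\<^sub>M N"] by simp
  then have Pfm': "(\<lambda>t. Pf t (X s \<omega>)) \<in> borel_measurable lborel" if "\<omega> \<in> space N" for \<omega>
    using measurable_compose[OF measurable_Pair2'[OF that] Pfm] by simp
  have "(\<integral>\<^sup>+\<omega>. Z \<omega> * X.J f s \<omega> \<partial>N) = (\<integral>\<^sup>+t. indicator {0..} t * (\<integral>\<^sup>+\<omega>. Z \<omega> * Pf t (X s \<omega>) \<partial>N) \<partial>lborel)"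
    unfolding Pf_def by (rule X.J_integral_markov[OF s _ Z]) measurable
  also have "\<dots> = (\<integral>\<^sup>+t. \<integral>\<^sup>+\<omega>. indicator {0..} t * (Z \<omega> * Pf t (X s \<omega>)) \<partial>N \<partial>lborel)"
    using measurable_compose[OF measurable_Pair1' Pfm]
    by (intro nn_integral_cong nn_integral_cmult[symmetric]) simp
  also have "\<dots> = (\<integral>\<^sup>+\<omega>. \<integral>\<^sup>+t. indicator {0..} t * (Z \<omega> * Pf t (X s \<omega>)) \<partial>lborel \<partial>N)"
    by (rule Q.Fubini'[symmetric]) (use Pfm in \<open>simp add: split_beta\<close>)
  also have "\<dots> \<le> (\<integral>\<^sup>+\<omega>. ennreal C * Z \<omega> \<partial>N)"
  proof (rule nn_integral_mono)
    fix \<omega> assume w: "\<omega> \<in> space N"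
    have "(\<integral>\<^sup>+t. indicator {0..} t * (Z \<omega> * Pf t (X s \<omega>)) \<partial>lborel) = (\<integral>\<^sup>+t. Z \<omega> * (indicator {0..} t * Pf t (X s \<omega>)) \<partial>lborel)"
      by (simp only: mult_ac)
    also have "\<dots> = Z \<omega> * (\<integral>\<^sup>+t. indicator {0..} t * Pf t (X s \<omega>) \<partial>lborel)"
      using Pfm'[OF w] by (intro nn_integral_cmult) simp
    also have "\<dots> \<le> Z \<omega> * ennreal C" by (intro mult_left_mono Pf_potential) simp
    finally show "(\<integral>\<^sup>+t. indicator {0..} t * (Z \<omega> * Pf t (X s \<omega>)) \<partial>lborel) \<le> ennreal C * Z \<omega>"
      by (simp add: mult.commute)
  qed
  also have "\<dots> = ennreal C * (\<integral>\<^sup>+\<omega>. Z \<omega> \<partial>N)" by (rule nn_integral_cmult) measurable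
  finally show ?thesis .
qed

lemma moments_upper: "(\<integral>\<^sup>+\<omega>. exp_functional X \<omega> ^ n \<partial>N) \<le> ennreal (fact n * C ^ n)"
proof -
  have "(\<integral>\<^sup>+\<omega>. 1 * X.J f 0 \<omega> ^ n \<partial>N) \<le> fact n * ennreal C ^ n * (\<integral>\<^sup>+\<omega>. 1 \<partial>N)"
    by (rule X.J_moment_upper[OF f_measurable J_f_le]) auto
  also have "\<dots> = ennreal (fact n * C ^ n)"
    using C_pos by (simp add: X.N.emeasure_space_1 fact_ennreal ennreal_mult ennreal_power)
  finally show ?thesis by (simp add: exp_functional_eq)
qed

lemma exp_functional_finite: "AE \<omega> in N. exp_functional X \<omega> < \<infinity>"
proof -
  have "(\<integral>\<^sup>+\<omega>. exp_functional X \<omega> \<partial>N) \<noteq> \<infinity>" using moments_upper[of 1] by (auto simp: top_unique)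
  then have "AE \<omega> in N. exp_functional X \<omega> \<noteq> \<infinity>"
    using exp_functional_measurable by (intro nn_integral_PInf_AE) auto
  then show ?thesis by eventually_elim (simp add: less_top)
qed

section \<open>Lower bound for the moments\<close>

lemma p_up_ge:
  assumes t: "0 \<le> t" and x: "0 < a" "a \<le> x" "x \<le> b" and r: "r < a" and D: "D \<in> sets borel" "\<And>v. v \<in> D \<Longrightarrow> x + v \<in> {a..b}"
  shows "ennreal (W a / W b) * (\<integral>\<^sup>+\<omega>. indicator D (V t \<omega>) * indicator {- r..} (R t \<omega>) \<partial>M) \<le> (\<integral>\<^sup>+y. indicator {a..b} y \<partial>p_up M V W t x)"
proof -
  have [measurable]: "V t \<in> borel_measurable M" "R t \<in> borel_measurable M" "D \<in> sets borel"
    using t D by (auto intro: V_measurable R_measurable)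
  \<comment> \<open>Monotonicity of W bounds the density from below uniformly in the starting point
    x \<le> b and the end point z \<ge> a.\<close>
  have Wab: "W a / W b \<le> Wp z / W x" if "z \<ge> a" for z
  proof -
    have "W a \<le> Wp z" using monoD[OF Wp_mono that] x by (simp add: Wp_pos)
    moreover have "W x \<le> W b" using monoD[OF Wp_mono x(3)] x by (simp add: Wp_pos)
    ultimately show ?thesis using W_pos[of a] W_pos[of x] x by (intro frac_le) auto
  qed
  have "ennreal (W a / W b) * (\<integral>\<^sup>+\<omega>. indicator D (V t \<omega>) * indicator {- r..} (R t \<omega>) \<partial>M) =
    (\<integral>\<^sup>+\<omega>. ennreal (W a / W b) * (indicator D (V t \<omega>) * indicator {- r..} (R t \<omega>)) \<partial>M)"
    by (rule nn_integral_cmult[symmetric]) measurable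
  also have "\<dots> \<le> (\<integral>\<^sup>+\<omega>. indicator {0<..} (x + R t \<omega>) * (ennreal (Wp (x + V t \<omega>) / W x) * indicator {a..b} (x + V t \<omega>)) \<partial>M)"
  proof (rule nn_integral_mono)
    fix \<omega>
    show "ennreal (W a / W b) * (indicator D (V t \<omega>) * indicator {- r..} (R t \<omega>)) \<le>
      indicator {0<..} (x + R t \<omega>) * (ennreal (Wp (x + V t \<omega>) / W x) * indicator {a..b} (x + V t \<omega>))"
    proof (cases "V t \<omega> \<in> D \<and> R t \<omega> \<ge> - r")
      case True
      \<comment> \<open>A path started at x \<ge> a > r survives because it never falls by more than
        r.\<close>
      then have "x + V t \<omega> \<in> {a..b}" "x + R t \<omega> > 0" using D(2) x r by auto
      then show ?thesis using True Wab[of "x + V t \<omega>"] by (simp add: ennreal_leI)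
    qed (auto simp: indicator_def)
  qed
  also have "\<dots> = (\<integral>\<^sup>+y. indicator {a..b} y \<partial>p_up M V W t x)"
    by (rule nn_integral_p_up[OF t, symmetric]) measurable
  finally show ?thesis .
qed

text \<open>If X stayed at or below a at each time, exp (- X) would have mean at least exp (- a) at
  all times and the mean of the functional would be infinite, against the first moment
  bound.\<close>

lemma X_unbounded: "\<exists>t\<ge>0. \<not> (AE \<omega> in N. X t \<omega> \<le> a)"
proof (rule ccontr)
  assume "\<not> ?thesis"
  then have h: "AE \<omega> in N. X t \<omega> \<le> a" if "t \<ge> 0" for t using that by blast
  have "(\<integral>\<^sup>+\<omega>. 1 * X.J f 0 \<omega> \<partial>N) = (\<integral>\<^sup>+r. indicator {0..} r * (\<integral>\<^sup>+\<omega>. 1 * f (X (max 0 r) \<omega>) \<partial>N) \<partial>lborel)"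
    by (rule X.J_integral) auto
  also have "\<dots> \<ge> (\<integral>\<^sup>+(r::real). ennreal (exp (- a)) * indicator {0..} r \<partial>lborel)"
  proof (rule nn_integral_mono)
    fix r :: real
    have "(\<integral>\<^sup>+\<omega>. ennreal (exp (- a)) \<partial>N) \<le> (\<integral>\<^sup>+\<omega>. 1 * f (X (max 0 r) \<omega>) \<partial>N)"
      using h[of "max 0 r"] by (intro nn_integral_mono_AE) (auto simp: f_def intro: ennreal_leI elim: eventually_mono)
    then show "ennreal (exp (- a)) * indicator {0..} r \<le> indicator {0..} r * (\<integral>\<^sup>+\<omega>. 1 * f (X (max 0 r) \<omega>) \<partial>N)"
      by (auto simp: X.N.emeasure_space_1 indicator_def)
  qed
  also have "(\<integral>\<^sup>+(r::real). ennreal (exp (- a)) * indicator {0..} r \<partial>lborel) = \<infinity>"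
  proof -
    have "emeasure lborel {0::real..} = \<infinity>"
    proof (rule ccontr)
      assume ne: "emeasure lborel {0::real..} \<noteq> \<infinity>"
      have "ennreal r \<le> emeasure lborel {0::real..}" if "r \<ge> 0" for r
        using emeasure_mono[of "{0..r}" "{0..}" lborel] that by simp
      from this[of "enn2real (emeasure lborel {0::real..}) + 1"] ne show False
        by (auto simp: ennreal_plus less_top[symmetric] enn2real_nonneg top_unique)
    qed
    then show ?thesis by (simp add: nn_integral_cmult_indicator ennreal_mult_top)
  qed
  finally have "(\<integral>\<^sup>+\<omega>. exp_functional X \<omega> \<partial>N) = \<infinity>" by (simp add: exp_functional_eq top_unique)
  then show False using moments_upper[of 1] by (auto simp: top_unique)
qed

text \<open>K = [2 m, b] with b \<ge> 4 m is cut at 3 m: the lower part is moved up and the upper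
  part down, by at most m within time 1, so that X ends in K. Positive occupation of both half-lines
  by V and the bounded ratio of W give the mean time in K; K is entered at time t0 with probability
  \<rho>.\<close>

lemma moments_lower:
  assumes nd: "\<not> deterministic_drift M V"
  obtains c \<rho> where "c > 0" "\<rho> > 0" "\<And>n. ennreal (fact n * c ^ n * \<rho>) \<le> (\<integral>\<^sup>+\<omega>. exp_functional X \<omega> ^ n \<partial>N)"
proof -
  define h where "h A m t = (\<integral>\<^sup>+\<omega>. indicator A (V (max 0 t) \<omega>) *
    (indicator {- m..m} (V (max 0 t) \<omega>) * indicator {- m..} (R (max 0 t) \<omega>)) \<partial>M)" for A and m t :: real
  have hm [measurable]: "h A m \<in> borel_measurable borel" if [measurable]: "A \<in> sets borel" for A m
    unfolding h_def by measurable
  obtain m1 where m1: "\<And>n. n \<ge> m1 \<Longrightarrow> (\<integral>\<^sup>+t. indicator {0..1} t * h {0..} (real n) t \<partial>lborel) > 0"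
    using bounded_occupation[OF occupation_nonneg] unfolding h_def by auto
  obtain m2 where m2: "\<And>n. n \<ge> m2 \<Longrightarrow> (\<integral>\<^sup>+t. indicator {0..1} t * h {..0} (real n) t \<partial>lborel) > 0"
    using bounded_occupation[OF occupation_nonpos[OF nd]] unfolding h_def by auto
  \<comment> \<open>One window size for both directions; the successor makes it positive.\<close>
  define m where "m = real (Suc (max m1 m2))"
  have m: "m > 0" by (simp add: m_def)
  define Ip where "Ip = (\<integral>\<^sup>+t. indicator {0..1} t * h {0..} m t \<partial>lborel)"
  define Im where "Im = (\<integral>\<^sup>+t. indicator {0..1} t * h {..0} m t \<partial>lborel)"
  have I: "Ip > 0" "Im > 0"
    unfolding Ip_def Im_def m_def by (intro m1 m2; simp)+
  have h1: "h A m t \<le> 1" for A t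
  proof -
    have "h A m t \<le> (\<integral>\<^sup>+\<omega>. 1 \<partial>M)" unfolding h_def by (intro nn_integral_mono) (auto simp: indicator_def)
    then show ?thesis by (simp add: emeasure_space_1)
  qed
  have fin: "(\<integral>\<^sup>+t. indicator {0..1} t * h A m t \<partial>lborel) \<le> 1" for A
  proof -
    have "(\<integral>\<^sup>+t. indicator {0..1} t * h A m t \<partial>lborel) \<le> (\<integral>\<^sup>+(t::real). indicator {0..1} t \<partial>lborel)"
      using h1 by (intro nn_integral_mono) (auto simp: indicator_def)
    then show ?thesis by simp
  qed
  \<comment> \<open>Starting at or above 2 m and falling by at most m, the path stays
    positive.\<close>
  define a where "a = 2 * m"
  have a: "a > 0" using m by (simp add: a_def)
  obtain t0 where t0: "t0 \<ge> 0" "\<not> (AE \<omega> in N. X t0 \<omega> \<le> a)" using X_unbounded by blast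
  have [measurable]: "X t0 \<in> borel_measurable N" using t0 by (intro X.X_measurable)
  \<comment> \<open>X t0 exceeds a with positive probability, so some bounded window [a, b] already
    has positive probability.\<close>
  have "\<exists>b\<ge>4 * m. \<not> (AE \<omega> in N. X t0 \<omega> \<notin> {a..b})"
  proof (rule ccontr)
    assume "\<not> ?thesis"
    then have "AE \<omega> in N. X t0 \<omega> \<notin> {a..4 * m + real n}" for n by auto
    then have "AE \<omega> in N. \<forall>n. X t0 \<omega> \<notin> {a..4 * m + real n}" by (subst AE_all_countable) auto
    then have "AE \<omega> in N. X t0 \<omega> \<le> a"
    proof eventually_elim
      case (elim \<omega>)
      obtain n where "X t0 \<omega> \<le> real n" using real_arch_simple by blast
      then show ?case using elim m by (auto dest!: spec[of _ n])
    qed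
    then show False using t0 by simp
  qed
  then obtain b where b: "b \<ge> 4 * m" "\<not> (AE \<omega> in N. X t0 \<omega> \<notin> {a..b})" by blast
  define K where "K = {a..b}"
  define \<rho> where "\<rho> = X.N.prob {\<omega> \<in> space N. X t0 \<omega> \<in> K}"
  have \<rho>: "\<rho> > 0"
  proof -
    have "\<rho> \<noteq> 0"
    proof
      assume "\<rho> = 0"
      then have "{\<omega> \<in> space N. \<not> X t0 \<omega> \<notin> K} \<in> null_sets N"
        by (auto simp: \<rho>_def null_sets_def X.N.emeasure_eq_measure K_def)
      then show False using b by (auto simp: AE_iff_null K_def)
    qed
    then show ?thesis by (simp add: \<rho>_def less_le)
  qed
  define w where "w = ennreal (exp (- b)) * ennreal (W a / W b)"
  \<comment> \<open>A truncation of the integrand: at most exp (- y), and zero outside K as the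
    lower moment induction requires.\<close>
  define \<phi> where "\<phi> y = ennreal (exp (- b)) * indicator K y" for y
  have Km [measurable]: "K \<in> sets borel" by (simp add: K_def)
  have \<phi>m [measurable]: "\<phi> \<in> borel_measurable borel" unfolding \<phi>_def by measurable
  \<comment> \<open>The worse of the two directions, so that one constant serves all starting points
    in K.\<close>
  define c where "c = w * min Ip Im"
  have W: "W a / W b > 0" using W_pos[of a] W_pos[of b] a b m by simp
  have w: "w > 0" "w < \<infinity>" using W by (auto simp: w_def ennreal_zero_less_mult_iff ennreal_mult_less_top)
  have c: "c > 0" "c < \<infinity>"
    using w I fin[of "{0..}"] by (auto simp: c_def ennreal_zero_less_mult_iff ennreal_mult_less_top Ip_def[symmetric] min_less_iff_disj intro: le_less_trans)
  have kernel_ge: "w * h A m t \<le> (\<integral>\<^sup>+y. \<phi> y \<partial>P (max 0 t) (max 0 x))"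
    if t: "t \<in> {0..1}" and x: "x \<in> K" and A: "A \<in> sets borel" "\<And>v. v \<in> A \<Longrightarrow> \<bar>v\<bar> \<le> m \<Longrightarrow> x + v \<in> K" for A t x
  proof -
    have x': "0 < x" "a \<le> x" "x \<le> b" using x a by (auto simp: K_def)
    have "ennreal (W a / W b) * (\<integral>\<^sup>+\<omega>. indicator (A \<inter> {-m..m}) (V (max 0 t) \<omega>) * indicator {- m..} (R (max 0 t) \<omega>) \<partial>M) \<le>
       (\<integral>\<^sup>+y. indicator {a..b} y \<partial>p_up M V W (max 0 t) x)"
      using x' a A m by (intro p_up_ge) (auto simp: a_def K_def abs_le_iff)
    moreover have "(\<integral>\<^sup>+\<omega>. indicator (A \<inter> {-m..m}) (V (max 0 t) \<omega>) * indicator {- m..} (R (max 0 t) \<omega>) \<partial>M) = h A m t"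
      unfolding h_def by (intro nn_integral_cong) (auto simp: indicator_def)
    ultimately have "ennreal (W a / W b) * h A m t \<le> (\<integral>\<^sup>+y. indicator K y \<partial>P (max 0 t) (max 0 x))"
      using P_eq[of "max 0 t" x] x' by (simp add: K_def)
    then have "w * h A m t \<le> ennreal (exp (- b)) * (\<integral>\<^sup>+y. indicator K y \<partial>P (max 0 t) (max 0 x))"
      unfolding w_def mult.assoc by (rule mult_left_mono) simp
    also have "\<dots> = (\<integral>\<^sup>+y. \<phi> y \<partial>P (max 0 t) (max 0 x))"
      unfolding \<phi>_def using X.sets_kernel[of "max 0 t" x] by (subst nn_integral_cmult) auto
    finally show ?thesis .
  qed
  \<comment> \<open>Only times in [0, 1] and increments in A are kept; A will be the half-line that
    points back into K from the position X s.\<close>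
  have half: "w * (\<integral>\<^sup>+t. indicator {0..1} t * h A m t \<partial>lborel) * (\<integral>\<^sup>+\<omega>. Z \<omega> \<partial>N) \<le> (\<integral>\<^sup>+\<omega>. Z \<omega> * X.J \<phi> s \<omega> \<partial>N)"
    if s: "s \<ge> 0" and Z: "Z \<in> borel_measurable (X.\<F> s)" and A [measurable]: "A \<in> sets borel"
      and AZ: "\<And>\<omega> v. Z \<omega> \<noteq> 0 \<Longrightarrow> X s \<omega> \<in> K \<and> (v \<in> A \<longrightarrow> \<bar>v\<bar> \<le> m \<longrightarrow> X s \<omega> + v \<in> K)" for s Z A
  proof -
    have [measurable]: "Z \<in> borel_measurable N" using Z by (rule X.filtration_measurable)
    have "w * (\<integral>\<^sup>+t. indicator {0..1} t * h A m t \<partial>lborel) * (\<integral>\<^sup>+\<omega>. Z \<omega> \<partial>N) =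
       (\<integral>\<^sup>+t. (w * (\<integral>\<^sup>+\<omega>. Z \<omega> \<partial>N)) * (indicator {0..1} t * h A m t) \<partial>lborel)"
      by (subst nn_integral_cmult) (auto simp: mult_ac)
    also have "\<dots> \<le> (\<integral>\<^sup>+t. indicator {0..} t * (\<integral>\<^sup>+\<omega>. Z \<omega> * (\<integral>\<^sup>+y. \<phi> y \<partial>P (max 0 t) (max 0 (X s \<omega>))) \<partial>N) \<partial>lborel)"
    proof (rule nn_integral_mono)
      fix t :: real
      show "(w * (\<integral>\<^sup>+\<omega>. Z \<omega> \<partial>N)) * (indicator {0..1} t * h A m t) \<le>
        indicator {0..} t * (\<integral>\<^sup>+\<omega>. Z \<omega> * (\<integral>\<^sup>+y. \<phi> y \<partial>P (max 0 t) (max 0 (X s \<omega>))) \<partial>N)"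
      proof (cases "t \<in> {0..1}")
        case True
        have "(w * h A m t) * (\<integral>\<^sup>+\<omega>. Z \<omega> \<partial>N) = (\<integral>\<^sup>+\<omega>. (w * h A m t) * Z \<omega> \<partial>N)"
          by (rule nn_integral_cmult[symmetric]) measurable
        also have "\<dots> \<le> (\<integral>\<^sup>+\<omega>. Z \<omega> * (\<integral>\<^sup>+y. \<phi> y \<partial>P (max 0 t) (max 0 (X s \<omega>))) \<partial>N)"
        proof (rule nn_integral_mono)
          fix \<omega>
          show "(w * h A m t) * Z \<omega> \<le> Z \<omega> * (\<integral>\<^sup>+y. \<phi> y \<partial>P (max 0 t) (max 0 (X s \<omega>)))"
            using kernel_ge[OF True _ A, of "X s \<omega>"] AZ[of \<omega>]
            by (cases "Z \<omega> = 0") (auto simp: mult.commute[of _ "Z \<omega>"] intro!: mult_left_mono)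
        qed
        finally show ?thesis using True by (simp add: mult_ac)
      qed simp
    qed
    also have "\<dots> = (\<integral>\<^sup>+\<omega>. Z \<omega> * X.J \<phi> s \<omega> \<partial>N)"
      by (rule X.J_integral_markov[OF s \<phi>m Z, symmetric])
    finally show ?thesis .
  qed
  have base: "c * (\<integral>\<^sup>+\<omega>. Z \<omega> \<partial>N) \<le> (\<integral>\<^sup>+\<omega>. Z \<omega> * X.J \<phi> s \<omega> \<partial>N)"
    if s: "s \<ge> 0" and Z: "Z \<in> borel_measurable (X.\<F> s)" and ZK: "\<And>\<omega>. X s \<omega> \<notin> K \<Longrightarrow> Z \<omega> = 0" for s Z
  proof -
    have [measurable]: "Z \<in> borel_measurable N" "X s \<in> borel_measurable N"
      using Z s by (auto intro: X.filtration_measurable X.X_measurable)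
    have Xs [measurable]: "X s \<in> borel_measurable (X.\<F> s)" using s by (intro X.X_adapted) auto
    define Z1 where "Z1 \<omega> = Z \<omega> * indicator {..3 * m} (X s \<omega>)" for \<omega>
    define Z2 where "Z2 \<omega> = Z \<omega> * indicator {3 * m<..} (X s \<omega>)" for \<omega>
    have Z1 [measurable]: "Z1 \<in> borel_measurable (X.\<F> s)" and Z2 [measurable]: "Z2 \<in> borel_measurable (X.\<F> s)"
      unfolding Z1_def Z2_def using Z by measurable
    have [measurable]: "Z1 \<in> borel_measurable N" "Z2 \<in> borel_measurable N"
      by (rule X.filtration_measurable[OF Z1] X.filtration_measurable[OF Z2])+
    have Z12: "Z \<omega> = Z1 \<omega> + Z2 \<omega>" for \<omega> by (auto simp: Z1_def Z2_def indicator_def)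
    have K1: "X s \<omega> \<in> K \<and> (v \<in> {0..} \<longrightarrow> \<bar>v\<bar> \<le> m \<longrightarrow> X s \<omega> + v \<in> K)" if "Z1 \<omega> \<noteq> 0" for \<omega> v
      using that ZK[of \<omega>] b by (auto simp: Z1_def K_def a_def split: split_indicator_asm)
    have K2: "X s \<omega> \<in> K \<and> (v \<in> {..0} \<longrightarrow> \<bar>v\<bar> \<le> m \<longrightarrow> X s \<omega> + v \<in> K)" if "Z2 \<omega> \<noteq> 0" for \<omega> v
      using that ZK[of \<omega>] b by (auto simp: Z2_def K_def a_def split: split_indicator_asm)
    have "c * (\<integral>\<^sup>+\<omega>. Z \<omega> \<partial>N) = c * (\<integral>\<^sup>+\<omega>. Z1 \<omega> \<partial>N) + c * (\<integral>\<^sup>+\<omega>. Z2 \<omega> \<partial>N)"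
      unfolding Z12 by (subst nn_integral_add) (auto simp: distrib_left)
    also have "\<dots> \<le> w * Ip * (\<integral>\<^sup>+\<omega>. Z1 \<omega> \<partial>N) + w * Im * (\<integral>\<^sup>+\<omega>. Z2 \<omega> \<partial>N)"
      unfolding c_def by (intro add_mono mult_right_mono mult_left_mono) auto
    also have "\<dots> \<le> (\<integral>\<^sup>+\<omega>. Z1 \<omega> * X.J \<phi> s \<omega> \<partial>N) + (\<integral>\<^sup>+\<omega>. Z2 \<omega> * X.J \<phi> s \<omega> \<partial>N)"
      unfolding Ip_def Im_def by (intro add_mono half[OF s Z1 _ K1] half[OF s Z2 _ K2]) auto
    also have "\<dots> = (\<integral>\<^sup>+\<omega>. Z \<omega> * X.J \<phi> s \<omega> \<partial>N)"
      unfolding Z12 distrib_right by (rule nn_integral_add[symmetric]) measurable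
    finally show ?thesis .
  qed
  define c' where "c' = enn2real c"
  have c': "c' > 0" "ennreal c' = c" using c by (auto simp: c'_def enn2real_positive_iff less_top)
  have "ennreal (fact n * c' ^ n * \<rho>) \<le> (\<integral>\<^sup>+\<omega>. exp_functional X \<omega> ^ n \<partial>N)" for n
  proof -
    define Z where "Z \<omega> = (indicator K (X t0 \<omega>) :: ennreal)" for \<omega>
    have [measurable]: "X t0 \<in> borel_measurable (X.\<F> t0)" using t0 by (intro X.X_adapted) auto
    have Z: "Z \<in> borel_measurable (X.\<F> t0)" unfolding Z_def by measurable
    have "(\<integral>\<^sup>+\<omega>. Z \<omega> \<partial>N) = (\<integral>\<^sup>+\<omega>. indicator {\<omega> \<in> space N. X t0 \<omega> \<in> K} \<omega> \<partial>N)"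
      by (intro nn_integral_cong) (auto simp: Z_def indicator_def)
    also have "\<dots> = ennreal \<rho>" by (simp add: \<rho>_def X.N.emeasure_eq_measure)
    finally have "ennreal (fact n * c' ^ n * \<rho>) = fact n * c ^ n * (\<integral>\<^sup>+\<omega>. Z \<omega> \<partial>N)"
      using c' \<rho> by (simp add: fact_ennreal ennreal_mult ennreal_power[symmetric])
    also have "\<dots> \<le> (\<integral>\<^sup>+\<omega>. Z \<omega> * X.J \<phi> t0 \<omega> ^ n \<partial>N)"
      by (rule X.J_moment_lower[OF \<phi>m _ _ t0(1) Z, where K=K]) (auto simp: \<phi>_def Z_def intro!: base)
    also have "\<dots> \<le> (\<integral>\<^sup>+\<omega>. exp_functional X \<omega> ^ n \<partial>N)"
    proof (rule nn_integral_mono)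
      fix \<omega>
      \<comment> \<open>The contribution before t0 is discarded, and \<phi> is at most exp (-
        y).\<close>
      have "X.J \<phi> t0 \<omega> \<le> X.J f 0 \<omega>"
        unfolding X.J_def using t0 by (intro nn_integral_mono mult_mono)
          (auto simp: indicator_def \<phi>_def f_def K_def intro: ennreal_leI)
      then have "X.J \<phi> t0 \<omega> ^ n \<le> exp_functional X \<omega> ^ n" unfolding exp_functional_eq by (intro power_mono) auto
      then show "Z \<omega> * X.J \<phi> t0 \<omega> ^ n \<le> exp_functional X \<omega> ^ n" by (auto simp: Z_def indicator_def)
    qed
    finally show ?thesis .
  qed
  then show ?thesis using that c' \<rho> by blast
qed

section \<open>Tail estimates and the theorem\<close>

lemma tail_lower:
  assumes "\<not> deterministic_drift M V"
  shows "\<exists>K. \<forall>\<^sub>F x in at_top. exp (- K * x) \<le> measure N {\<omega> \<in> space N. exp_functional X \<omega> \<ge> ennreal x}"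
proof -
  obtain c \<rho> where *: "c > 0" "\<rho> > 0" "\<And>n. ennreal (fact n * c ^ n * \<rho>) \<le> (\<integral>\<^sup>+\<omega>. exp_functional X \<omega> ^ n \<partial>N)"
    using moments_lower[OF assms] by blast
  show ?thesis
    by (rule X.N.exponential_tail_lower[OF exp_functional_measurable C_pos *(1,2) moments_upper *(3)])
qed

lemma exp_functional_exponential_moments:
  "q < \<Psi> (\<kappa> + 1) \<Longrightarrow> integrable N (\<lambda>\<omega>. exp (q * enn2real (exp_functional X \<omega>)))"
  by (rule X.N.exponential_moments[OF exp_functional_measurable C_pos moments_upper]) (simp add: C_def)

lemma tail_upper:
  assumes "0 \<le> k" "k < \<Psi> (\<kappa> + 1)"
  shows "\<forall>\<^sub>F x in at_top. measure N {\<omega> \<in> space N. exp_functional X \<omega> \<ge> ennreal x} \<le> exp (- k * x)"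
proof -
  obtain q where "k < q" "q < \<Psi> (\<kappa> + 1)" using dense[OF assms(2)] by blast
  then show ?thesis
    using assms(1) by (intro X.N.exponential_tail_upper[OF exp_functional_measurable exp_functional_finite
      exp_functional_exponential_moments]) auto
qed

lemma tail_bounds:
  assumes e: "e > 0"
  shows "\<exists>K1 K2 :: real. K1 > K2 \<and> K2 > 0 \<and> \<bar>K2 - \<Psi> (\<kappa> + 1)\<bar> < e \<and>
    (\<forall>\<^sub>F x in at_top.
      (\<not> deterministic_drift M V \<longrightarrow>
         exp (- K1 * x) \<le> measure N {\<omega> \<in> space N. exp_functional X \<omega> \<ge> ennreal x}) \<and>
      measure N {\<omega> \<in> space N. exp_functional X \<omega> \<ge> ennreal x} \<le> exp (- K2 * x))"
proof -
  define p where "p = \<Psi> (\<kappa> + 1)"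
  have p: "p > 0" using \<Psi>_pos[of "\<kappa> + 1"] by (simp add: p_def)
  \<comment> \<open>Positive, within e of p, and strictly below p, which leaves room for Markov's
    inequality.\<close>
  define K2 where "K2 = max (p / 2) (p - e / 2)"
  have K2: "K2 > 0" "K2 < p" "\<bar>K2 - p\<bar> < e" using p e by (auto simp: K2_def max_def)
  obtain K where K: "\<not> deterministic_drift M V \<Longrightarrow> \<forall>\<^sub>F x in at_top. exp (- K * x) \<le> measure N {\<omega> \<in> space N. exp_functional X \<omega> \<ge> ennreal x}"
    using tail_lower by blast
  \<comment> \<open>At least K2 + 1 secures K1 > K2; increasing K only weakens the lower bound for x
    \<ge> 0.\<close>
  define K1 where "K1 = max K (K2 + 1)"
  have up: "\<forall>\<^sub>F x in at_top. measure N {\<omega> \<in> space N. exp_functional X \<omega> \<ge> ennreal x} \<le> exp (- K2 * x)"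
    using K2 by (intro tail_upper) (auto simp: p_def)
  have lo: "\<forall>\<^sub>F x in at_top. \<not> deterministic_drift M V \<longrightarrow> exp (- K1 * x) \<le> measure N {\<omega> \<in> space N. exp_functional X \<omega> \<ge> ennreal x}"
  proof (cases "deterministic_drift M V")
    case False
    from K[OF False] eventually_ge_at_top[of 0] show ?thesis
    proof eventually_elim
      case (elim x)
      have "exp (- K1 * x) \<le> exp (- K * x)" using elim by (simp add: K1_def mult_right_mono)
      from order_trans[OF this elim(1)] show ?case by simp
    qed
  qed simp
  show ?thesis
    by (rule exI[of _ K1], rule exI[of _ K2]) (use K2 lo up in \<open>auto simp: K1_def p_def intro: eventually_conj\<close>)
qed

end

theorem theorem1p1:
  fixes M :: "'a measure" and V :: "real \<Rightarrow> 'a \<Rightarrow> real"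
    and \<Psi> W :: "real \<Rightarrow> real"
    and N :: "real \<Rightarrow> 'b measure" and Vup_from :: "real \<Rightarrow> real \<Rightarrow> 'b \<Rightarrow> real"
    and N0 :: "'c measure" and Vup :: "real \<Rightarrow> 'c \<Rightarrow> real"
  assumes "spectrally_negative_levy M V"
    and "\<not> subordinator M (\<lambda>t \<omega>. - V t \<omega>)"
    and "laplace_exponent M V \<Psi>"
    and "scale_function M V \<Psi> W"
    and "conditioned_positive_from_0 M V W N Vup_from N0 Vup"
  shows "(exp_functional Vup \<in> borel_measurable N0) \<and>
         (AE \<omega> in N0. exp_functional Vup \<omega> < \<infinity>) \<and>
         (\<forall>q < \<Psi> (kappa M V \<Psi> + 1).
             integrable N0 (\<lambda>\<omega>. exp (q * enn2real (exp_functional Vup \<omega>)))) \<and>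
         (\<exists>K1 K2 :: real. K1 > K2 \<and> K2 > 0 \<and>
             (\<forall>\<^sub>F x in at_top.
                (\<not> deterministic_drift M V \<longrightarrow>
                   exp (- K1 * x) \<le> measure N0 {\<omega> \<in> space N0. exp_functional Vup \<omega> \<ge> ennreal x}) \<and>
                measure N0 {\<omega> \<in> space N0. exp_functional Vup \<omega> \<ge> ennreal x} \<le> exp (- K2 * x))) \<and>
         (\<forall>\<epsilon>>0. \<exists>K1 K2 :: real. K1 > K2 \<and> K2 > 0 \<and> \<bar>K2 - \<Psi> (kappa M V \<Psi> + 1)\<bar> < \<epsilon> \<and>
             (\<forall>\<^sub>F x in at_top.
                (\<not> deterministic_drift M V \<longrightarrow>
                   exp (- K1 * x) \<le> measure N0 {\<omega> \<in> space N0. exp_functional Vup \<omega> \<ge> ennreal x}) \<and>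
                measure N0 {\<omega> \<in> space N0. exp_functional Vup \<omega> \<ge> ennreal x} \<le> exp (- K2 * x)))"
proof -
  obtain P where P: "feller_semigroup P" "\<And>t x. t \<ge> 0 \<Longrightarrow> x > 0 \<Longrightarrow> P t x = p_up M V W t x" "markov_process N0 Vup P"
    and c: "cadlag_process N0 Vup" "AE \<omega> in N0. \<forall>t\<ge>0. Vup t \<omega> \<ge> 0"
    using assms(5) unfolding conditioned_positive_from_0_def by blast
  \<comment> \<open>A Feller semigroup has mass one and equals \<open>p_up\<close> at positive
    points; this is what makes W positive and invariant.\<close>
  have cons: "prob_space (p_up M V W t x)" if "t \<ge> 0" "x > 0" for t x
    using P(1) unfolding feller_semigroup_def P(2)[OF that, symmetric] using that by (meson less_imp_le)
  have V: "levy_process M V" "AE \<omega> in M. \<forall>t>0. V t \<omega> - Lim (at_left t) (\<lambda>s. V s \<omega>) \<le> 0"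
    using assms(1) by (auto simp: spectrally_negative_levy_def)
  interpret conditioned_levy M V \<Psi> W N0 Vup P
    by (intro conditioned_levy.intro conditioned_levy_axioms.intro levy_scale.intro levy_scale_axioms.intro
      levy_laplace.intro levy_laplace_axioms.intro spectrally_negative.intro spectrally_negative_axioms.intro levy.intro)
      (fact V assms(2-4) cons c P)+
  show ?thesis
  proof (intro conjI)
    show "\<forall>q<\<Psi> (\<kappa> + 1). integrable N0 (\<lambda>\<omega>. exp (q * enn2real (exp_functional Vup \<omega>)))"
      using exp_functional_exponential_moments by blast
  next
    show "\<exists>K1 K2 :: real. K1 > K2 \<and> K2 > 0 \<and>
             (\<forall>\<^sub>F x in at_top.
                (\<not> deterministic_drift M V \<longrightarrow>
                   exp (- K1 * x) \<le> measure N0 {\<omega> \<in> space N0. exp_functional Vup \<omega> \<ge> ennreal x}) \<and>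
                measure N0 {\<omega> \<in> space N0. exp_functional Vup \<omega> \<ge> ennreal x} \<le> exp (- K2 * x))"
      \<comment> \<open>Any precision yields existence, so 1 is taken.\<close>
      using tail_bounds[OF zero_less_one] by (elim exE conjE) (intro exI conjI)
  next
    show "\<forall>\<epsilon>>0. \<exists>K1 K2 :: real. K1 > K2 \<and> K2 > 0 \<and> \<bar>K2 - \<Psi> (\<kappa> + 1)\<bar> < \<epsilon> \<and>
             (\<forall>\<^sub>F x in at_top.
                (\<not> deterministic_drift M V \<longrightarrow>
                   exp (- K1 * x) \<le> measure N0 {\<omega> \<in> space N0. exp_functional Vup \<omega> \<ge> ennreal x}) \<and>
                measure N0 {\<omega> \<in> space N0. exp_functional Vup \<omega> \<ge> ennreal x} \<le> exp (- K2 * x))"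
      by (intro allI impI tail_bounds)
  qed (fact exp_functional_measurable exp_functional_finite)+
qed

end
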